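(* Let $\mathcal{M}$ be a Poisson manifold with a flat, torsion-free contravariant connection $\mathcal{D}$. Then $\mathcal{D}$ determines a tensor $M^{ijk}_{lm}$ on $\mathcal{M}$, symmetric in the contravariant indices $i,j,k$ and antisymmetric in the covariant indices $l,m$, such that, viewing $M$ as a $C^\infty(\mathcal{M})$-trilinear map from $1$-forms to $2$-forms, $M(\alpha,\beta,\gamma)_{lm}=M^{ijk}_{lm}\alpha_i\beta_j\gamma_k$, $$M(df,\beta,\gamma)=\{f,\{\beta,\gamma\}\}-\{\{f,\beta\},\gamma\}-\{\{f,\gamma\},\beta\}$$ for all $f\in C^\infty(\mathcal{M})$ and $\beta,\gamma\in\Omega^1(\mathcal{M})$.
   Context: A Poisson manifold carries a bivector $\pi$ whose bracket $\{f,g\}=\pi^{ij}\partial_if\,\partial_jg$ satisfies the Jacobi identity. The anchor $\#:T^*\mathcal{M}\to T\mathcal{M}$ is $(\#\alpha)^i=\pi^{ji}\alpha_j$. The Koszul bracket $[\cdot,\cdot]_\pi$ on $\Omega^1(\mathcal{M})$ is the unique Lie bracket with $[\alpha,f\beta]_\pi=f[\alpha,\beta]_\pi+(\#\alpha)(f)\beta$ and $[df,dg]_\pi=d\{f,g\}$. A contravariant connection is a bilinear map $(\alpha,\beta)\mapsto\mathcal{D}_\alpha\beta$ on $\Omega^1(\mathcal{M})$ with $\mathcal{D}_{f\alpha}\beta=f\mathcal{D}_\alpha\beta$ and $\mathcal{D}_\alpha(f\beta)=f\mathcal{D}_\alpha\beta+(\#\alpha)(f)\beta$; it is flat if $\mathcal{D}_\alpha\mathcal{D}_\beta-\mathcal{D}_\beta\mathcal{D}_\alpha-\mathcal{D}_{[\alpha,\beta]_\pi}=0$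 and torsion-free if $\mathcal{D}_\alpha\beta-\mathcal{D}_\beta\alpha=[\alpha,\beta]_\pi$. It extends to all tensors by the Leibniz rule, with $\mathcal{D}_\alpha f=(\#\alpha)(f)$ on functions. Brackets: for $f\in C^\infty(\mathcal{M})$ and a differential form $\sigma$, $\{f,\sigma\}:=\mathcal{D}_{df}\sigma$ (for functions this is the Poisson bracket). The bracket of two $1$-forms is the unique symmetric bilinear map $\Omega^1(\mathcal{M})\times\Omega^1(\mathcal{M})\to\Omega^2(\mathcal{M})$ satisfying $\{f\alpha,\beta\}=f\{\alpha,\beta\}+\alpha\wedge\{f,\beta\}$ and $d\{f,\beta\}=\{df,\beta\}+\{f,d\beta\}$. *)

theory Defs
  imports "HOL-Analysis.Analysis" "HOL-Library.Function_Algebras"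
begin

text \<open>
  Sums, differences and \<open>0\<close> of functions, vectors, fields and forms, and products of real
  functions, are the pointwise operations of \<open>Function_Algebras\<close>.
\<close>

section \<open>Smooth manifolds\<close>

fun Ck_on :: "nat \<Rightarrow> 'a::real_normed_vector set \<Rightarrow> ('a \<Rightarrow> 'b::real_normed_vector) \<Rightarrow> bool" where
  "Ck_on 0 S f \<longleftrightarrow> continuous_on S f"
| "Ck_on (Suc k) S f \<longleftrightarrow>
     (\<forall>x\<in>S. f differentiable (at x)) \<and> (\<forall>v. Ck_on k S (\<lambda>x. frechet_derivative f (at x) v))"

text \<open>Only used for open \<open>S\<close>.\<close>
definition smooth_on :: "'a::real_normed_vector set \<Rightarrow> ('a \<Rightarrow> 'b::real_normed_vector) \<Rightarrow> bool" where
  "smooth_on S f \<longleftrightarrow> (\<forall>k. Ck_on k S f)"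

type_synonym ('a, 'n) chart = "'a set \<times> ('a \<Rightarrow> real ^ 'n)"

text \<open>
  The manifold is the whole type \<open>'a\<close> (Hausdorff and second countable), with the smooth structure
  given by an atlas, which need not be maximal.
\<close>
definition smooth_atlas ::
    "('a::{t2_space,second_countable_topology}, 'n::finite) chart set \<Rightarrow> bool" where
  "smooth_atlas A \<longleftrightarrow>
     (\<Union>(U, \<phi>)\<in>A. U) = UNIV \<and>
     (\<forall>(U, \<phi>)\<in>A. open U \<and> open (\<phi> ` U) \<and> homeomorphism U (\<phi> ` U) \<phi> (inv_into U \<phi>)) \<and>
     (\<forall>(U, \<phi>)\<in>A. \<forall>(V, \<psi>)\<in>A. smooth_on (\<phi> ` (U \<inter> V)) (\<psi> \<circ> inv_into U \<phi>))"

definition cinf :: "('a, 'n::finite) chart set \<Rightarrow> ('a \<Rightarrow> real) set" where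
  "cinf A = {f. \<forall>(U, \<phi>)\<in>A. smooth_on (\<phi> ` U) (f \<circ> inv_into U \<phi>)}"


section \<open>Tangent and cotangent vectors\<close>

text \<open>
  Linear functionals on a space \<open>V\<close> of real functions, extended by \<open>0\<close> outside \<open>V\<close> so that
  they are determined by their values on \<open>V\<close>.
\<close>
definition lin_on :: "('b \<Rightarrow> real) set \<Rightarrow> (('b \<Rightarrow> real) \<Rightarrow> real) \<Rightarrow> bool" where
  "lin_on V L \<longleftrightarrow>
     (\<forall>u\<in>V. \<forall>v\<in>V. L (u + v) = L u + L v) \<and>
     (\<forall>c. \<forall>v\<in>V. L (\<lambda>x. c * v x) = c * L v) \<and>
     (\<forall>v. v \<notin> V \<longrightarrow> L v = 0)"

type_synonym 'a tvec = "('a \<Rightarrow> real) \<Rightarrow> real"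
type_synonym 'a covec = "'a tvec \<Rightarrow> real"

text \<open>Tangent vectors at \<open>p\<close> are the derivations of \<open>C\<^sup>\<infinity>(M)\<close> at \<open>p\<close>.\<close>
definition tangent_space :: "('a, 'n::finite) chart set \<Rightarrow> 'a \<Rightarrow> 'a tvec set" where
  "tangent_space A p =
     {v. lin_on (cinf A) v \<and> (\<forall>f\<in>cinf A. \<forall>g\<in>cinf A. v (f * g) = v f * g p + f p * v g)}"

definition cotangent_space :: "('a, 'n::finite) chart set \<Rightarrow> 'a \<Rightarrow> 'a covec set" where
  "cotangent_space A p = {a. lin_on (tangent_space A p) a}"


section \<open>Vector fields, forms and tensors\<close>

type_synonym 'a vfield = "'a \<Rightarrow> 'a tvec"
type_synonym 'a form1 = "'a \<Rightarrow> 'a covec"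
type_synonym 'a form2 = "'a \<Rightarrow> 'a tvec \<Rightarrow> 'a tvec \<Rightarrow> real"
type_synonym 'a bivector = "'a \<Rightarrow> 'a covec \<Rightarrow> 'a covec \<Rightarrow> real"
type_synonym 'a tensor32 =
  "'a \<Rightarrow> 'a covec \<Rightarrow> 'a covec \<Rightarrow> 'a covec \<Rightarrow> 'a tvec \<Rightarrow> 'a tvec \<Rightarrow> real"

definition vfields :: "('a, 'n::finite) chart set \<Rightarrow> 'a vfield set" where
  "vfields A =
     {X. (\<forall>p. X p \<in> tangent_space A p) \<and> (\<forall>f\<in>cinf A. (\<lambda>p. X p f) \<in> cinf A)}"

definition forms1 :: "('a, 'n::finite) chart set \<Rightarrow> 'a form1 set" where
  "forms1 A =
     {\<alpha>. (\<forall>p. \<alpha> p \<in> cotangent_space A p) \<and> (\<forall>X\<in>vfields A. (\<lambda>p. \<alpha> p (X p)) \<in> cinf A)}"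

definition forms2 :: "('a, 'n::finite) chart set \<Rightarrow> 'a form2 set" where
  "forms2 A =
     {\<sigma>. (\<forall>p v. lin_on (tangent_space A p) (\<lambda>w. \<sigma> p v w)) \<and>
         (\<forall>p w. lin_on (tangent_space A p) (\<lambda>v. \<sigma> p v w)) \<and>
         (\<forall>p v w. \<sigma> p v w = - \<sigma> p w v) \<and>
         (\<forall>X\<in>vfields A. \<forall>Y\<in>vfields A. (\<lambda>p. \<sigma> p (X p) (Y p)) \<in> cinf A)}"

definition bivectors :: "('a, 'n::finite) chart set \<Rightarrow> 'a bivector set" where
  "bivectors A =
     {\<pi>. (\<forall>p a. lin_on (cotangent_space A p) (\<lambda>b. \<pi> p a b)) \<and>
         (\<forall>p b. lin_on (cotangent_space A p) (\<lambda>a. \<pi> p a b)) \<and>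
         (\<forall>p a b. \<pi> p a b = - \<pi> p b a) \<and>
         (\<forall>\<alpha>\<in>forms1 A. \<forall>\<beta>\<in>forms1 A. (\<lambda>p. \<pi> p (\<alpha> p) (\<beta> p)) \<in> cinf A)}"

text \<open>
  Tensor fields \<open>M\<^sup>i\<^sup>j\<^sup>k\<^sub>l\<^sub>m\<close>, with \<open>M p a b c v w\<close> being
  \<open>M\<^sup>i\<^sup>j\<^sup>k\<^sub>l\<^sub>m a\<^sub>i b\<^sub>j c\<^sub>k v\<^sup>l w\<^sup>m\<close> at \<open>p\<close>.
\<close>
definition tensors32 :: "('a, 'n::finite) chart set \<Rightarrow> 'a tensor32 set" where
  "tensors32 A =
     {M. (\<forall>p b c v w. lin_on (cotangent_space A p) (\<lambda>a. M p a b c v w)) \<and>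
         (\<forall>p a c v w. lin_on (cotangent_space A p) (\<lambda>b. M p a b c v w)) \<and>
         (\<forall>p a b v w. lin_on (cotangent_space A p) (\<lambda>c. M p a b c v w)) \<and>
         (\<forall>p a b c w. lin_on (tangent_space A p) (\<lambda>v. M p a b c v w)) \<and>
         (\<forall>p a b c v. lin_on (tangent_space A p) (\<lambda>w. M p a b c v w)) \<and>
         (\<forall>\<alpha>\<in>forms1 A. \<forall>\<beta>\<in>forms1 A. \<forall>\<gamma>\<in>forms1 A. \<forall>X\<in>vfields A. \<forall>Y\<in>vfields A.
            (\<lambda>p. M p (\<alpha> p) (\<beta> p) (\<gamma> p) (X p) (Y p)) \<in> cinf A)}"

definition contra_symmetric :: "'a tensor32 \<Rightarrow> bool" where
  "contra_symmetric M \<longleftrightarrow>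
     (\<forall>p a b c v w. M p a b c v w = M p b a c v w \<and> M p a b c v w = M p a c b v w)"

definition co_antisymmetric :: "'a tensor32 \<Rightarrow> bool" where
  "co_antisymmetric M \<longleftrightarrow> (\<forall>p a b c v w. M p a b c v w = - M p a b c w v)"

definition tensor_apply :: "'a tensor32 \<Rightarrow> 'a form1 \<Rightarrow> 'a form1 \<Rightarrow> 'a form1 \<Rightarrow> 'a form2" where
  "tensor_apply M \<alpha> \<beta> \<gamma> = (\<lambda>p. M p (\<alpha> p) (\<beta> p) (\<gamma> p))"

definition scale1 :: "('a \<Rightarrow> real) \<Rightarrow> 'a form1 \<Rightarrow> 'a form1" where
  "scale1 f \<alpha> = (\<lambda>p v. f p * \<alpha> p v)"

definition scale2 :: "('a \<Rightarrow> real) \<Rightarrow> 'a form2 \<Rightarrow> 'a form2" where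
  "scale2 f \<sigma> = (\<lambda>p v w. f p * \<sigma> p v w)"

definition wedge :: "'a form1 \<Rightarrow> 'a form1 \<Rightarrow> 'a form2" where
  "wedge \<alpha> \<beta> = (\<lambda>p v w. \<alpha> p v * \<beta> p w - \<alpha> p w * \<beta> p v)"

definition lie_bracket :: "'a vfield \<Rightarrow> 'a vfield \<Rightarrow> 'a vfield" where
  "lie_bracket X Y = (\<lambda>p f. X p (\<lambda>q. Y q f) - Y p (\<lambda>q. X q f))"

definition d0 :: "('a, 'n::finite) chart set \<Rightarrow> ('a \<Rightarrow> real) \<Rightarrow> 'a form1" where
  "d0 A f = (\<lambda>p v. if v \<in> tangent_space A p then v f else 0)"

text \<open>In coordinates, \<open>(d\<alpha>)\<^sub>l\<^sub>m = \<partial>\<^sub>l \<alpha>\<^sub>m - \<partial>\<^sub>m \<alpha>\<^sub>l\<close>.\<close>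
definition d1 :: "('a, 'n::finite) chart set \<Rightarrow> 'a form1 \<Rightarrow> 'a form2" where
  "d1 A \<alpha> = (THE \<sigma>. \<sigma> \<in> forms2 A \<and>
     (\<forall>X\<in>vfields A. \<forall>Y\<in>vfields A. \<forall>p.
        \<sigma> p (X p) (Y p) =
          X p (\<lambda>q. \<alpha> q (Y q)) - Y p (\<lambda>q. \<alpha> q (X q)) - \<alpha> p (lie_bracket X Y p)))"


section \<open>Poisson manifolds\<close>

definition poisson_bracket ::
    "('a, 'n::finite) chart set \<Rightarrow> 'a bivector \<Rightarrow> ('a \<Rightarrow> real) \<Rightarrow> ('a \<Rightarrow> real) \<Rightarrow> ('a \<Rightarrow> real)" where
  "poisson_bracket A \<pi> f g = (\<lambda>p. \<pi> p (d0 A f p) (d0 A g p))"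

definition poisson_manifold ::
    "('a::{t2_space,second_countable_topology}, 'n::finite) chart set \<Rightarrow> 'a bivector \<Rightarrow> bool" where
  "poisson_manifold A \<pi> \<longleftrightarrow> smooth_atlas A \<and> \<pi> \<in> bivectors A \<and>
     (\<forall>f\<in>cinf A. \<forall>g\<in>cinf A. \<forall>h\<in>cinf A.
        poisson_bracket A \<pi> f (poisson_bracket A \<pi> g h) +
        poisson_bracket A \<pi> g (poisson_bracket A \<pi> h f) +
        poisson_bracket A \<pi> h (poisson_bracket A \<pi> f g) = 0)"

text \<open>\<open>(#\<alpha>)\<^sup>i = \<pi>\<^sup>j\<^sup>i \<alpha>\<^sub>j\<close>, that is, \<open>(#\<alpha>)(f) = \<pi>(\<alpha>, df)\<close>; in particular \<open>(#df)(g) = {f, g}\<close>.\<close>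
definition anchor :: "('a, 'n::finite) chart set \<Rightarrow> 'a bivector \<Rightarrow> 'a form1 \<Rightarrow> 'a vfield" where
  "anchor A \<pi> \<alpha> = (\<lambda>p f. if f \<in> cinf A then \<pi> p (\<alpha> p) (d0 A f p) else 0)"

abbreviation anchor_app ::
    "('a, 'n::finite) chart set \<Rightarrow> 'a bivector \<Rightarrow> 'a form1 \<Rightarrow> ('a \<Rightarrow> real) \<Rightarrow> ('a \<Rightarrow> real)" where
  "anchor_app A \<pi> \<alpha> f \<equiv> (\<lambda>p. anchor A \<pi> \<alpha> p f)"

definition bilinear_op1 ::
    "('a, 'n::finite) chart set \<Rightarrow> ('a form1 \<Rightarrow> 'a form1 \<Rightarrow> 'a form1) \<Rightarrow> bool" where
  "bilinear_op1 A K \<longleftrightarrow>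
     (\<forall>\<alpha>\<in>forms1 A. \<forall>\<beta>\<in>forms1 A. K \<alpha> \<beta> \<in> forms1 A) \<and>
     (\<forall>\<alpha>\<in>forms1 A. \<forall>\<beta>\<in>forms1 A. \<forall>\<gamma>\<in>forms1 A.
        K (\<alpha> + \<beta>) \<gamma> = K \<alpha> \<gamma> + K \<beta> \<gamma> \<and> K \<gamma> (\<alpha> + \<beta>) = K \<gamma> \<alpha> + K \<gamma> \<beta>) \<and>
     (\<forall>c. \<forall>\<alpha>\<in>forms1 A. \<forall>\<beta>\<in>forms1 A.
        K (scale1 (\<lambda>_. c) \<alpha>) \<beta> = scale1 (\<lambda>_. c) (K \<alpha> \<beta>) \<and>
        K \<alpha> (scale1 (\<lambda>_. c) \<beta>) = scale1 (\<lambda>_. c) (K \<alpha> \<beta>))"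

definition is_koszul_bracket ::
    "('a, 'n::finite) chart set \<Rightarrow> 'a bivector \<Rightarrow> ('a form1 \<Rightarrow> 'a form1 \<Rightarrow> 'a form1) \<Rightarrow> bool" where
  "is_koszul_bracket A \<pi> K \<longleftrightarrow> bilinear_op1 A K \<and>
     (\<forall>\<alpha>\<in>forms1 A. \<forall>\<beta>\<in>forms1 A. K \<alpha> \<beta> = - K \<beta> \<alpha>) \<and>
     (\<forall>\<alpha>\<in>forms1 A. \<forall>\<beta>\<in>forms1 A. \<forall>\<gamma>\<in>forms1 A.
        K \<alpha> (K \<beta> \<gamma>) + K \<beta> (K \<gamma> \<alpha>) + K \<gamma> (K \<alpha> \<beta>) = 0) \<and>
     (\<forall>f\<in>cinf A. \<forall>\<alpha>\<in>forms1 A. \<forall>\<beta>\<in>forms1 A.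
        K \<alpha> (scale1 f \<beta>) = scale1 f (K \<alpha> \<beta>) + scale1 (anchor_app A \<pi> \<alpha> f) \<beta>) \<and>
     (\<forall>f\<in>cinf A. \<forall>g\<in>cinf A. K (d0 A f) (d0 A g) = d0 A (poisson_bracket A \<pi> f g))"

text \<open>
  The characterisation determines the bracket on \<open>forms1 A\<close>, and only its values there are ever
  used; a definite description would fail because values elsewhere are unconstrained.
\<close>
definition koszul_bracket ::
    "('a, 'n::finite) chart set \<Rightarrow> 'a bivector \<Rightarrow> 'a form1 \<Rightarrow> 'a form1 \<Rightarrow> 'a form1" where
  "koszul_bracket A \<pi> = (SOME K. is_koszul_bracket A \<pi> K)"


section \<open>Contravariant connections\<close>

definition contravariant_connection ::
    "('a, 'n::finite) chart set \<Rightarrow> 'a bivector \<Rightarrow> ('a form1 \<Rightarrow> 'a form1 \<Rightarrow> 'a form1) \<Rightarrow> bool" where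
  "contravariant_connection A \<pi> D \<longleftrightarrow> bilinear_op1 A D \<and>
     (\<forall>f\<in>cinf A. \<forall>\<alpha>\<in>forms1 A. \<forall>\<beta>\<in>forms1 A.
        D (scale1 f \<alpha>) \<beta> = scale1 f (D \<alpha> \<beta>) \<and>
        D \<alpha> (scale1 f \<beta>) = scale1 f (D \<alpha> \<beta>) + scale1 (anchor_app A \<pi> \<alpha> f) \<beta>)"

definition flat_connection ::
    "('a, 'n::finite) chart set \<Rightarrow> 'a bivector \<Rightarrow> ('a form1 \<Rightarrow> 'a form1 \<Rightarrow> 'a form1) \<Rightarrow> bool" where
  "flat_connection A \<pi> D \<longleftrightarrow>
     (\<forall>\<alpha>\<in>forms1 A. \<forall>\<beta>\<in>forms1 A. \<forall>\<gamma>\<in>forms1 A.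
        D \<alpha> (D \<beta> \<gamma>) - D \<beta> (D \<alpha> \<gamma>) - D (koszul_bracket A \<pi> \<alpha> \<beta>) \<gamma> = 0)"

definition torsion_free ::
    "('a, 'n::finite) chart set \<Rightarrow> 'a bivector \<Rightarrow> ('a form1 \<Rightarrow> 'a form1 \<Rightarrow> 'a form1) \<Rightarrow> bool" where
  "torsion_free A \<pi> D \<longleftrightarrow>
     (\<forall>\<alpha>\<in>forms1 A. \<forall>\<beta>\<in>forms1 A. D \<alpha> \<beta> - D \<beta> \<alpha> = koszul_bracket A \<pi> \<alpha> \<beta>)"

text \<open>
  Extension to vector fields: the Leibniz rule for the pairing of \<open>df\<close> and \<open>X\<close>,
  \<open>(#\<alpha>)(X f) = (D\<^sub>\<alpha> df)(X) + df(D\<^sub>\<alpha> X)\<close>, solved for \<open>(D\<^sub>\<alpha> X) f\<close>.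
\<close>
definition conn_vfield ::
    "('a, 'n::finite) chart set \<Rightarrow> 'a bivector \<Rightarrow> ('a form1 \<Rightarrow> 'a form1 \<Rightarrow> 'a form1)
      \<Rightarrow> 'a form1 \<Rightarrow> 'a vfield \<Rightarrow> 'a vfield" where
  "conn_vfield A \<pi> D \<alpha> X =
     (\<lambda>p f. if f \<in> cinf A
             then anchor A \<pi> \<alpha> p (\<lambda>q. X q f) - D \<alpha> (d0 A f) p (X p)
             else 0)"

text \<open>
  Extension to 2-forms: the Leibniz rule
  \<open>(#\<alpha>)(\<sigma>(X, Y)) = (D\<^sub>\<alpha> \<sigma>)(X, Y) + \<sigma>(D\<^sub>\<alpha> X, Y) + \<sigma>(X, D\<^sub>\<alpha> Y)\<close>.
\<close>
definition conn_form2 ::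
    "('a, 'n::finite) chart set \<Rightarrow> 'a bivector \<Rightarrow> ('a form1 \<Rightarrow> 'a form1 \<Rightarrow> 'a form1)
      \<Rightarrow> 'a form1 \<Rightarrow> 'a form2 \<Rightarrow> 'a form2" where
  "conn_form2 A \<pi> D \<alpha> \<sigma> = (THE \<tau>. \<tau> \<in> forms2 A \<and>
     (\<forall>X\<in>vfields A. \<forall>Y\<in>vfields A. \<forall>p.
        \<tau> p (X p) (Y p) =
          anchor A \<pi> \<alpha> p (\<lambda>q. \<sigma> q (X q) (Y q))
          - \<sigma> p (conn_vfield A \<pi> D \<alpha> X p) (Y p)
          - \<sigma> p (X p) (conn_vfield A \<pi> D \<alpha> Y p)))"


section \<open>The brackets\<close>

definition fun_form1_bracket ::
    "('a, 'n::finite) chart set \<Rightarrow> ('a form1 \<Rightarrow> 'a form1 \<Rightarrow> 'a form1)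
      \<Rightarrow> ('a \<Rightarrow> real) \<Rightarrow> 'a form1 \<Rightarrow> 'a form1" where
  "fun_form1_bracket A D f \<beta> = D (d0 A f) \<beta>"

definition fun_form2_bracket ::
    "('a, 'n::finite) chart set \<Rightarrow> 'a bivector \<Rightarrow> ('a form1 \<Rightarrow> 'a form1 \<Rightarrow> 'a form1)
      \<Rightarrow> ('a \<Rightarrow> real) \<Rightarrow> 'a form2 \<Rightarrow> 'a form2" where
  "fun_form2_bracket A \<pi> D f \<sigma> = conn_form2 A \<pi> D (d0 A f) \<sigma>"

definition is_form1_bracket ::
    "('a, 'n::finite) chart set \<Rightarrow> 'a bivector \<Rightarrow> ('a form1 \<Rightarrow> 'a form1 \<Rightarrow> 'a form1)
      \<Rightarrow> ('a form1 \<Rightarrow> 'a form1 \<Rightarrow> 'a form2) \<Rightarrow> bool" where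
  "is_form1_bracket A \<pi> D B \<longleftrightarrow>
     (\<forall>\<alpha>\<in>forms1 A. \<forall>\<beta>\<in>forms1 A. B \<alpha> \<beta> \<in> forms2 A) \<and>
     (\<forall>\<alpha>\<in>forms1 A. \<forall>\<beta>\<in>forms1 A. B \<alpha> \<beta> = B \<beta> \<alpha>) \<and>
     (\<forall>\<alpha>\<in>forms1 A. \<forall>\<beta>\<in>forms1 A. \<forall>\<gamma>\<in>forms1 A.
        B (\<alpha> + \<beta>) \<gamma> = B \<alpha> \<gamma> + B \<beta> \<gamma> \<and> B \<gamma> (\<alpha> + \<beta>) = B \<gamma> \<alpha> + B \<gamma> \<beta>) \<and>
     (\<forall>c. \<forall>\<alpha>\<in>forms1 A. \<forall>\<beta>\<in>forms1 A.
        B (scale1 (\<lambda>_. c) \<alpha>) \<beta> = scale2 (\<lambda>_. c) (B \<alpha> \<beta>) \<and>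
        B \<alpha> (scale1 (\<lambda>_. c) \<beta>) = scale2 (\<lambda>_. c) (B \<alpha> \<beta>)) \<and>
     (\<forall>f\<in>cinf A. \<forall>\<alpha>\<in>forms1 A. \<forall>\<beta>\<in>forms1 A.
        B (scale1 f \<alpha>) \<beta> = scale2 f (B \<alpha> \<beta>) + wedge \<alpha> (fun_form1_bracket A D f \<beta>)) \<and>
     (\<forall>f\<in>cinf A. \<forall>\<beta>\<in>forms1 A.
        d1 A (fun_form1_bracket A D f \<beta>) =
          B (d0 A f) \<beta> + fun_form2_bracket A \<pi> D f (d1 A \<beta>))"

text \<open>As for \<^const>\<open>koszul_bracket\<close>, uniqueness is on \<open>forms1 A\<close>.\<close>
definition form1_bracket ::
    "('a, 'n::finite) chart set \<Rightarrow> 'a bivector \<Rightarrow> ('a form1 \<Rightarrow> 'a form1 \<Rightarrow> 'a form1)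
      \<Rightarrow> 'a form1 \<Rightarrow> 'a form1 \<Rightarrow> 'a form2" where
  "form1_bracket A \<pi> D = (SOME B. is_form1_bracket A \<pi> D B)"

end

(*
  Write N(f, b, c) for the right-hand side. Flatness makes N(f, b, c) linear over smooth functions
  in b and c, and flatness, vanishing torsion and d{f, b} = {df, b} + {f, db} give
  N(f, dg, dh) = N(g, df, dh); b and c are interchangeable as the bracket of 1-forms is symmetric.
  Every covector at a point is the differential of a global function there, so N depends on df, b
  and c pointwise only and is a tensor M.

  Since the Koszul bracket and the bracket of 1-forms are chosen by their characterisation, both
  have to be constructed. This rests on one fact about manifolds: near each point there are global
  functions x_i and global vector fields e_i with v = sum_i v(x_i) e_i for all derivations v, which
  is Hadamard's lemma multiplied by bump functions. An identity that is linear over smooth functions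
  in a 1-form then only has to be checked for exact 1-forms.
*)
theory Submission
  imports Defs
begin

section \<open>Calculus of smooth functions\<close>

text \<open>A priori N(f, b, c) involves second derivatives of f: \<open>D\<close> is linear over
  functions in df, but its value D_df b then enters the bracket of 1-forms, which obeys a Leibniz
  rule. The symmetry on exact forms removes this obstacle: if b = dg and c = dh at p, then N(f, b,
  c) = N(f, dg, dh) = N(g, df, dh) at p, and in the last expression df stands in a slot already
  known to be pointwise. The Poisson and torsion hypotheses also enter the two constructions. The
  Jacobi identity makes the anchor a homomorphism, and this makes the Jacobiator of the constructed
  Koszul bracket linear over functions. Vanishing torsion gives the constructed bracket of 1-forms
  its Leibniz rule in the second argument and its symmetry. That \<open>D\<close> determines the
  tensor is read as unique existence.\<close>

lemma Ck_on_subset: "Ck_on k S f \<Longrightarrow> T \<subseteq> S \<Longrightarrow> Ck_on k T f"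
  by (induction k arbitrary: f) (auto intro: continuous_on_subset)

text \<open>Derivatives are taken in the full space, so agreement on \<open>S\<close> passes to them
  because \<open>S\<close> is open.\<close>

lemma Ck_on_cong:
  assumes "open S" "\<And>x. x \<in> S \<Longrightarrow> f x = g x" "Ck_on k S f"
  shows "Ck_on k S g"
  using assms(2,3)
proof (induction k arbitrary: f g)
  case 0
  then show ?case by (simp cong: continuous_on_cong)
next
  case (Suc k)
  have der: "(g has_derivative frechet_derivative f (at x)) (at x)" if "x \<in> S" for x
    using Suc.prems that assms(1)
    by (auto simp: frechet_derivative_works intro: has_derivative_transform_within_open)
  show ?case
    unfolding Ck_on.simps
  proof (intro conjI ballI allI)
    show "g differentiable at x" if "x \<in> S" for x
      using der[OF that] by (auto simp: differentiable_def)
    show "Ck_on k S (\<lambda>x. frechet_derivative g (at x) v)" for v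
    proof (rule Suc.IH[where f = "\<lambda>x. frechet_derivative f (at x) v"])
      show "frechet_derivative f (at x) v = frechet_derivative g (at x) v" if "x \<in> S" for x
        using frechet_derivative_at[OF der[OF that]] by simp
      show "Ck_on k S (\<lambda>x. frechet_derivative f (at x) v)"
        using Suc.prems by simp
    qed
  qed
qed

text \<open>Lets an explicit derivative stand in for \<open>frechet_derivative\<close> in the
  inductions below.\<close>

lemma Ck_on_SucI:
  assumes "open S" "\<And>x. x \<in> S \<Longrightarrow> (f has_derivative f' x) (at x)"
    "\<And>v. Ck_on k S (\<lambda>x. f' x v)"
  shows "Ck_on (Suc k) S f"
  unfolding Ck_on.simps
proof (intro conjI ballI allI)
  show "f differentiable at x" if "x \<in> S" for x
    using assms(2)[OF that] by (auto simp: differentiable_def)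
  show "Ck_on k S (\<lambda>x. frechet_derivative f (at x) v)" for v
    by (rule Ck_on_cong[OF assms(1) _ assms(3)[of v]]) (metis assms(2) frechet_derivative_at)
qed

lemma Ck_on_SucD:
  assumes "Ck_on (Suc k) S f"
  shows "x \<in> S \<Longrightarrow> (f has_derivative frechet_derivative f (at x)) (at x)"
    "Ck_on k S (\<lambda>x. frechet_derivative f (at x) v)"
  using assms by (auto simp: frechet_derivative_works)

lemma Ck_on_Suc_imp: "Ck_on (Suc k) S f \<Longrightarrow> Ck_on k S f"
proof (induction k arbitrary: f)
  case 0
  then show ?case
    by (auto intro!: continuous_at_imp_continuous_on differentiable_imp_continuous_within)
next
  case (Suc k)
  then show ?case by (metis Ck_on.simps(2))
qed

lemma Ck_on_local:
  assumes "\<And>x. x \<in> S \<Longrightarrow> \<exists>T. open T \<and> x \<in> T \<and> Ck_on k T f"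
  shows "Ck_on k S f"
  using assms
proof (induction k arbitrary: f)
  case 0
  have "continuous (at x) f" if "x \<in> S" for x
    using 0[OF that] by (auto simp: continuous_on_eq_continuous_at)
  then show ?case by (simp add: continuous_at_imp_continuous_on)
next
  case (Suc k)
  have "Ck_on k S (\<lambda>x. frechet_derivative f (at x) v)" for v
  proof (rule Suc.IH)
    fix x assume "x \<in> S"
    then obtain T where "open T" "x \<in> T" "Ck_on (Suc k) T f" using Suc.prems by blast
    then show "\<exists>T. open T \<and> x \<in> T \<and> Ck_on k T (\<lambda>x. frechet_derivative f (at x) v)"
      using Ck_on_SucD(2) by blast
  qed
  moreover have "f differentiable at x" if "x \<in> S" for x
    using Suc.prems[OF that] by auto
  ultimately show ?case by simp
qed

lemma Ck_on_const: "open S \<Longrightarrow> Ck_on k S (\<lambda>x. c)"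
proof (induction k arbitrary: c)
  case (Suc k)
  show ?case by (rule Ck_on_SucI[OF Suc.prems has_derivative_const]) (use Suc in auto)
qed simp

lemma Ck_on_bounded_linear:
  assumes "open S" "bounded_linear h"
  shows "Ck_on k S h"
proof (cases k)
  case 0
  then show ?thesis using assms by (simp add: linear_continuous_on)
next
  case (Suc m)
  show ?thesis unfolding Suc
    by (rule Ck_on_SucI[OF assms(1) bounded_linear_imp_has_derivative[OF assms(2)]])
      (rule Ck_on_const[OF assms(1)])
qed

lemma Ck_on_linear_image:
  assumes "open S" "bounded_linear h" "Ck_on k S f"
  shows "Ck_on k S (\<lambda>x. h (f x))"
  using assms(3)
proof (induction k arbitrary: f)
  case 0
  then show ?case
    using assms(2) by (auto intro: bounded_linear.continuous_on)
next
  case (Suc k)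
  show ?case
    by (rule Ck_on_SucI[OF assms(1) bounded_linear.has_derivative[OF assms(2) Ck_on_SucD(1)[OF Suc.prems]]])
      (use Ck_on_SucD(2)[OF Suc.prems] Suc.IH in auto)
qed

lemma Ck_on_add:
  assumes "open S" "Ck_on k S f" "Ck_on k S g"
  shows "Ck_on k S (\<lambda>x. f x + g x)"
  using assms(2,3)
proof (induction k arbitrary: f g)
  case 0
  then show ?case by (auto intro: continuous_intros)
next
  case (Suc k)
  show ?case
    by (rule Ck_on_SucI[OF assms(1) has_derivative_add[OF Ck_on_SucD(1)[OF Suc.prems(1)] Ck_on_SucD(1)[OF Suc.prems(2)]]])
      (use Ck_on_SucD(2)[OF Suc.prems(1)] Ck_on_SucD(2)[OF Suc.prems(2)] Suc.IH in auto)
qed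

lemma Ck_on_scaleR:
  assumes "open S" "Ck_on k S f" "Ck_on k S g"
  shows "Ck_on k S (\<lambda>x. f x *\<^sub>R g x)"
  using assms(2,3)
proof (induction k arbitrary: f g)
  case 0
  then show ?case by (auto intro: continuous_intros)
next
  case (Suc k)
  note f = Suc.prems(1) and g = Suc.prems(2)
  show ?case
  proof (rule Ck_on_SucI[OF assms(1) has_derivative_scaleR[OF Ck_on_SucD(1)[OF f] Ck_on_SucD(1)[OF g]]])
    fix v
    show "Ck_on k S (\<lambda>x. f x *\<^sub>R frechet_derivative g (at x) v + frechet_derivative f (at x) v *\<^sub>R g x)"
      by (intro Ck_on_add[OF assms(1)] Suc.IH Ck_on_Suc_imp[OF f] Ck_on_Suc_imp[OF g]
        Ck_on_SucD(2)[OF f] Ck_on_SucD(2)[OF g])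
  qed
qed

lemma Ck_on_sum:
  assumes "open S" "\<And>i. i \<in> I \<Longrightarrow> Ck_on k S (f i)"
  shows "Ck_on k S (\<lambda>x. \<Sum>i\<in>I. f i x)"
  using assms(2)
  by (induction I rule: infinite_finite_induct) (auto intro: Ck_on_add Ck_on_const assms(1))

lemma Ck_on_compose:
  fixes f :: "'b::euclidean_space \<Rightarrow> 'c::real_normed_vector"
    and g :: "'a::real_normed_vector \<Rightarrow> 'b"
  assumes "open S" "open T" "g ` S \<subseteq> T" "Ck_on k T f" "Ck_on k S g"
  shows "Ck_on k S (\<lambda>x. f (g x))"
  using assms(4,5)
proof (induction k arbitrary: f)
  case 0
  then show ?case
    using assms(3) by (auto intro: continuous_on_compose2)
next
  case (Suc k)
  note f = Suc.prems(1) and g = Suc.prems(2)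
  let ?f' = "\<lambda>y. frechet_derivative f (at y)" and ?g' = "\<lambda>x. frechet_derivative g (at x)"
  show ?case
  proof (rule Ck_on_SucI[OF assms(1)])
    fix x assume x: "x \<in> S"
    have f': "(f has_derivative ?f' (g x)) (at (g x))"
      using Ck_on_SucD(1)[OF f] x assms(3) by blast
    have g': "(g has_derivative ?g' x) (at x)"
      by (rule Ck_on_SucD(1)[OF g x])
    \<comment> \<open>In the chain rule the direction \<open>?g' x v\<close> moves with
      \<open>x\<close>, while \<open>Ck_on\<close> speaks of fixed directions only. Expanding it in
      \<open>Basis\<close> leaves derivatives of \<open>f\<close> in fixed directions; this is why
      \<open>f\<close> lives on a Euclidean space.\<close>
    have "(\<lambda>v. ?f' (g x) (?g' x v)) = (\<lambda>v. \<Sum>b\<in>Basis. (?g' x v \<bullet> b) *\<^sub>R ?f' (g x) b)"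
    proof
      fix v
      have "?f' (g x) (\<Sum>b\<in>Basis. (?g' x v \<bullet> b) *\<^sub>R b) = (\<Sum>b\<in>Basis. (?g' x v \<bullet> b) *\<^sub>R ?f' (g x) b)"
        using f'[THEN has_derivative_linear] by (simp add: linear_sum linear_scale)
      then show "?f' (g x) (?g' x v) = (\<Sum>b\<in>Basis. (?g' x v \<bullet> b) *\<^sub>R ?f' (g x) b)"
        by (simp add: euclidean_representation)
    qed
    then show "((\<lambda>x. f (g x)) has_derivative (\<lambda>v. \<Sum>b\<in>Basis. (?g' x v \<bullet> b) *\<^sub>R ?f' (g x) b)) (at x)"
      using has_derivative_compose[OF g' f'] by simp
  next
    fix v
    show "Ck_on k S (\<lambda>x. \<Sum>b\<in>Basis. (?g' x v \<bullet> b) *\<^sub>R ?f' (g x) b)"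
      by (intro Ck_on_sum Ck_on_scaleR assms(1) Ck_on_linear_image[OF assms(1) bounded_linear_inner_left]
          Suc.IH Ck_on_SucD(2)[OF f] Ck_on_SucD(2)[OF g] Ck_on_Suc_imp[OF g])
  qed
qed

lemma smooth_on_subset: "smooth_on S f \<Longrightarrow> T \<subseteq> S \<Longrightarrow> smooth_on T f"
  unfolding smooth_on_def by (blast intro: Ck_on_subset)

lemma smooth_on_cong:
  assumes "open S" "\<And>x. x \<in> S \<Longrightarrow> f x = g x" "smooth_on S f"
  shows "smooth_on S g"
  using assms Ck_on_cong[of S f g] unfolding smooth_on_def by blast

lemma smooth_on_const: "open S \<Longrightarrow> smooth_on S (\<lambda>x. c)"
  unfolding smooth_on_def by (intro allI Ck_on_const)

lemma smooth_on_bounded_linear: "open S \<Longrightarrow> bounded_linear h \<Longrightarrow> smooth_on S h"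
  unfolding smooth_on_def by (intro allI Ck_on_bounded_linear)

lemma smooth_on_add:
  "open S \<Longrightarrow> smooth_on S f \<Longrightarrow> smooth_on S g \<Longrightarrow> smooth_on S (\<lambda>x. f x + g x)"
  unfolding smooth_on_def by (rule allI, rule Ck_on_add) auto

lemma smooth_on_linear_image:
  "open S \<Longrightarrow> bounded_linear h \<Longrightarrow> smooth_on S f \<Longrightarrow> smooth_on S (\<lambda>x. h (f x))"
  unfolding smooth_on_def by (rule allI, rule Ck_on_linear_image) auto

lemma smooth_on_sum:
  "open S \<Longrightarrow> (\<And>i. i \<in> I \<Longrightarrow> smooth_on S (F i)) \<Longrightarrow> smooth_on S (\<lambda>x. \<Sum>i\<in>I. F i x)"
  unfolding smooth_on_def by (rule allI, rule Ck_on_sum) auto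

lemma smooth_on_local:
  assumes "\<And>x. x \<in> S \<Longrightarrow> \<exists>T. open T \<and> x \<in> T \<and> smooth_on T f"
  shows "smooth_on S f"
  unfolding smooth_on_def
proof (intro allI Ck_on_local)
  fix k x assume "x \<in> S"
  then show "\<exists>T. open T \<and> x \<in> T \<and> Ck_on k T f"
    using assms by (auto simp: smooth_on_def)
qed

lemma smooth_on_mult:
  fixes f g :: "_ \<Rightarrow> real"
  shows "open S \<Longrightarrow> smooth_on S f \<Longrightarrow> smooth_on S g \<Longrightarrow> smooth_on S (\<lambda>x. f x * g x)"
  unfolding smooth_on_def by (rule allI, rule Ck_on_scaleR[of S _ f g, unfolded real_scaleR_def]) auto

lemma smooth_on_compose:
  fixes f :: "'b::euclidean_space \<Rightarrow> 'c::real_normed_vector"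
  shows "open S \<Longrightarrow> open T \<Longrightarrow> g ` S \<subseteq> T \<Longrightarrow> smooth_on T f \<Longrightarrow> smooth_on S g
    \<Longrightarrow> smooth_on S (\<lambda>x. f (g x))"
  unfolding smooth_on_def by (rule allI, rule Ck_on_compose) auto

lemma smooth_on_has_derivative:
  "smooth_on S f \<Longrightarrow> x \<in> S \<Longrightarrow> (f has_derivative frechet_derivative f (at x)) (at x)"
  by (meson Ck_on_SucD(1) smooth_on_def)

lemma smooth_on_frechet_derivative:
  "smooth_on S f \<Longrightarrow> smooth_on S (\<lambda>x. frechet_derivative f (at x) v)"
  unfolding smooth_on_def using Ck_on_SucD(2) by blast

lemma smooth_on_imp_continuous_on: "smooth_on S f \<Longrightarrow> continuous_on S f"
  by (metis Ck_on.simps(1) smooth_on_def)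


section \<open>Smooth cutoff functions built from exp(-1/x)\<close>

definition flat_exp :: "nat \<Rightarrow> real \<Rightarrow> real" where
  "flat_exp n x = (if x > 0 then (1 / x) ^ n * exp (- (1 / x)) else 0)"

lemma flat_exp_tendsto_0: "((\<lambda>x. flat_exp n x) \<longlongrightarrow> 0) (at 0)"
proof -
  have "((\<lambda>y::real. y ^ n / exp y) \<longlongrightarrow> 0) at_top"
    by (rule tendsto_power_div_exp_0)
  then have "((\<lambda>x::real. (inverse x) ^ n / exp (inverse x)) \<longlongrightarrow> 0) (at_right 0)"
    by (rule filterlim_compose) (rule filterlim_inverse_at_top_right)
  moreover have "\<forall>\<^sub>F x in at_right 0. (inverse x) ^ n / exp (inverse x) = flat_exp n x"
    by (auto simp: flat_exp_def eventually_at_right_field exp_minus field_simps intro!: exI[of _ 1])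
  ultimately have r: "(flat_exp n \<longlongrightarrow> 0) (at_right 0)"
    using tendsto_cong by force
  have "\<forall>\<^sub>F x in at_left 0. flat_exp n x = 0"
    by (auto simp: flat_exp_def eventually_at_left_field intro!: exI[of _ "-1"])
  then have "(flat_exp n \<longlongrightarrow> 0) (at_left 0)"
    by (rule tendsto_eventually)
  with r show ?thesis by (simp add: filterlim_at_split)
qed

text \<open>Differentiating x^(-n) exp(-1/x) only raises the power of 1/x. Carrying all powers along
  makes the family closed under differentiation up to linear combinations, so that smoothness
  becomes an induction for all \<open>n\<close> at once.\<close>

lemma flat_exp_DERIV:
  "(flat_exp n has_field_derivative (flat_exp (n + 2) x - real n * flat_exp (n + 1) x)) (at x)"
proof (cases x "0::real" rule: linorder_cases)
  case less
  have "((\<lambda>x. 0) has_field_derivative 0) (at x)" by simp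
  then have "(flat_exp n has_field_derivative 0) (at x)"
    by (rule has_field_derivative_transform_within_open[where S = "{..<0}"])
      (use less in \<open>auto simp: flat_exp_def\<close>)
  then show ?thesis using less by (simp add: flat_exp_def)
next
  case equal
  have "((\<lambda>h. flat_exp n (0 + h) - flat_exp n 0) has_field_derivative 0) (at 0)"
  proof -
    \<comment> \<open>As \<open>flat_exp n 0 = 0\<close>, the difference quotient at 0 is
      \<open>flat_exp (n + 1)\<close>, which tends to 0.\<close>
    have "((\<lambda>h. (flat_exp n (0 + h) - flat_exp n 0) / h) \<longlongrightarrow> 0) (at 0)"
    proof (rule Lim_transform_eventually[OF flat_exp_tendsto_0[of "n + 1"]])
      show "\<forall>\<^sub>F h in at 0. flat_exp (n + 1) h = (flat_exp n (0 + h) - flat_exp n 0) / h"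
        by (auto simp: flat_exp_def eventually_at_filter)
    qed
    then show ?thesis by (simp add: has_field_derivative_iff flat_exp_def)
  qed
  moreover have "(\<lambda>h. flat_exp n (0 + h) - flat_exp n 0) = flat_exp n"
    by (auto simp: flat_exp_def fun_eq_iff)
  ultimately show ?thesis using equal by (simp add: flat_exp_def)
next
  case greater
  have "((\<lambda>x. (1 / x) ^ n * exp (- (1 / x))) has_field_derivative
      (flat_exp (n + 2) x - real n * flat_exp (n + 1) x)) (at x)"
    using greater
  proof -
    have "((\<lambda>x. inverse x ^ n * exp (- inverse x)) has_field_derivative
        real n * (- (inverse x * inverse x)) * inverse x ^ (n - Suc 0) * exp (- inverse x)
        + inverse x ^ n * (exp (- inverse x) * (inverse x * inverse x))) (at x)"
      using greater by (auto intro!: derivative_eq_intros)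
    moreover have "real n * (- (inverse x * inverse x)) * inverse x ^ (n - Suc 0) * exp (- inverse x)
        + inverse x ^ n * (exp (- inverse x) * (inverse x * inverse x))
        = flat_exp (n + 2) x - real n * flat_exp (n + 1) x"
      using greater by (cases n) (simp_all add: flat_exp_def inverse_eq_divide[symmetric])
    ultimately show ?thesis
      by (simp add: inverse_eq_divide)
  qed
  then show ?thesis
    by (rule has_field_derivative_transform_within_open[where S = "{0<..}"])
      (use greater in \<open>auto simp: flat_exp_def\<close>)
qed

lemma smooth_on_flat_exp: "smooth_on UNIV (flat_exp n)"
proof -
  have "Ck_on k UNIV (flat_exp n)" for k n
  proof (induction k arbitrary: n)
    case 0
    show ?case
      using flat_exp_DERIV by (auto intro!: continuous_at_imp_continuous_on DERIV_isCont)
  next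
    case (Suc k)
    show ?case
    proof (rule Ck_on_SucI)
      show "(flat_exp n has_derivative (\<lambda>v. (flat_exp (n + 2) x - real n * flat_exp (n + 1) x) * v)) (at x)" for x
        using flat_exp_DERIV unfolding has_field_derivative_def .
      fix v
      have "Ck_on k UNIV (\<lambda>x. v * (flat_exp (n + 2) x + (- real n) * flat_exp (n + 1) x))"
        by (intro Ck_on_linear_image[OF _ bounded_linear_mult_right] Ck_on_add Suc.IH) auto
      then show "Ck_on k UNIV (\<lambda>x. (flat_exp (n + 2) x - real n * flat_exp (n + 1) x) * v)"
        by (simp add: mult.commute)
    qed simp
  qed
  then show ?thesis by (simp add: smooth_on_def)
qed

text \<open>With e(t) = exp(-1/t) for positive t and 0 otherwise, the function e(e(1) - e(t)) /
  e(e(1)) is 1 where e(t) = 0 and is 0 where e(t) is at least e(1), that is, from t = 1 on. Nesting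
  e in itself replaces the usual quotient with a varying denominator.\<close>

lemma smooth_step_exists:
  obtains u :: "real \<Rightarrow> real"
  where "smooth_on UNIV u" "\<And>t. t \<le> 0 \<Longrightarrow> u t = 1" "\<And>t. t \<ge> 1 \<Longrightarrow> u t = 0"
proof
  define e where "e = flat_exp 0"
  let ?u = "\<lambda>t. inverse (e (e 1)) * e (e 1 + (-1) * e t)"
  have e: "smooth_on UNIV e"
    unfolding e_def by (rule smooth_on_flat_exp)
  show "smooth_on UNIV ?u"
    by (intro smooth_on_linear_image[OF _ bounded_linear_mult_right] smooth_on_add smooth_on_const
        smooth_on_compose[OF _ _ _ e] e) auto
  show "?u t = 1" if "t \<le> 0" for t
    using that by (simp add: e_def flat_exp_def)
  show "?u t = 0" if "t \<ge> 1" for t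
    using that by (simp add: e_def flat_exp_def)
qed

lemma smooth_bump_exists:
  fixes y :: "'b::euclidean_space"
  assumes "0 < r" "r < R"
  obtains \<psi> :: "'b \<Rightarrow> real"
  where "smooth_on UNIV \<psi>" "\<And>z. z \<in> cball y r \<Longrightarrow> \<psi> z = 1" "\<And>z. z \<notin> ball y R \<Longrightarrow> \<psi> z = 0"
proof -
  obtain u :: "real \<Rightarrow> real"
    where u: "smooth_on UNIV u" "\<And>t. t \<le> 0 \<Longrightarrow> u t = 1" "\<And>t. t \<ge> 1 \<Longrightarrow> u t = 0"
    using smooth_step_exists by metis
  have lt: "r\<^sup>2 < R\<^sup>2"
    using assms by (simp add: power_strict_mono)
  \<comment> \<open>\<open>?q\<close> is the squared distance to \<open>y\<close>, written as a
    polynomial in coordinates to be visibly smooth; \<open>?s\<close> rescales it so that radius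
    \<open>r\<close> goes to 0 and radius \<open>R\<close> to 1.\<close>
  let ?q = "\<lambda>z::'b. (\<Sum>b\<in>Basis. (z \<bullet> b + - (y \<bullet> b)) * (z \<bullet> b + - (y \<bullet> b)))"
  let ?s = "\<lambda>z. inverse (R\<^sup>2 - r\<^sup>2) * (?q z + - (r\<^sup>2))"
  have q: "?q z = (dist y z)\<^sup>2" for z
    unfolding dist_norm power2_norm_eq_inner
    by (subst euclidean_inner) (auto intro!: sum.cong simp: inner_diff_left algebra_simps)
  show ?thesis
  proof
    show "smooth_on UNIV (\<lambda>z. u (?s z))"
      by (intro smooth_on_compose[OF open_UNIV open_UNIV subset_UNIV u(1)]
        smooth_on_linear_image[OF open_UNIV bounded_linear_mult_right] smooth_on_add smooth_on_const
        smooth_on_sum smooth_on_mult smooth_on_bounded_linear[OF _ bounded_linear_inner_left] open_UNIV)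
    show "u (?s z) = 1" if "z \<in> cball y r" for z
    proof (rule u(2))
      have "(dist y z)\<^sup>2 \<le> r\<^sup>2" using that by (simp add: power_mono)
      then show "?s z \<le> 0"
        unfolding q using lt by (simp add: field_simps)
    qed
    show "u (?s z) = 0" if "z \<notin> ball y R" for z
    proof (rule u(3))
      have "R\<^sup>2 \<le> (dist y z)\<^sup>2" using that assms by (simp add: power_mono)
      then show "1 \<le> ?s z"
        unfolding q using lt by (simp add: field_simps)
    qed
  qed
qed

section \<open>Hadamard's lemma\<close>

lemma Ck_on_segment_integral:
  fixes F :: "'b::euclidean_space \<Rightarrow> real" and w :: "real \<Rightarrow> real"
  assumes U: "open U" "convex U" "a \<in> U" and w: "continuous_on {0..1} w" and F: "Ck_on k U F"
  shows "Ck_on k U (\<lambda>y. integral {0..1} (\<lambda>t. w t * F (a + t *\<^sub>R (y - a))))"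
  using w F
proof (induction k arbitrary: F w)
  case 0
  have seg: "a + t *\<^sub>R (y - a) \<in> U" if "y \<in> U" "t \<in> {0..1}" for y t
    using convexD_alt[OF U(2) U(3) that(1), of t] that by (simp add: algebra_simps)
  show ?case
    unfolding Ck_on.simps cbox_interval[symmetric]
  proof (rule integral_continuous_on_param)
    show "continuous_on (U \<times> cbox 0 1) (\<lambda>(y, t). w t * F (a + t *\<^sub>R (y - a)))"
      unfolding split_beta
    proof (intro continuous_intros)
      show "continuous_on (U \<times> cbox 0 1) (\<lambda>x. w (snd x))"
        by (rule continuous_on_compose2[OF 0(1)]) (auto intro: continuous_intros)
      show "continuous_on (U \<times> cbox 0 1) (\<lambda>x. F (a + snd x *\<^sub>R (fst x - a)))"
        by (rule continuous_on_compose2[OF 0(2)[unfolded Ck_on.simps]])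
          (use seg in \<open>auto intro!: continuous_intros\<close>)
    qed
  qed
next
  case (Suc k)
  have seg: "a + t *\<^sub>R (y - a) \<in> U" if "y \<in> U" "t \<in> {0..1}" for y t
    using convexD_alt[OF U(2) U(3) that(1), of t] that by (simp add: algebra_simps)
  let ?F' = "\<lambda>y. frechet_derivative F (at y)"
  have F': "(F has_derivative ?F' y) (at y)" if "y \<in> U" for y
    by (rule Ck_on_SucD(1)[OF Suc.prems(2) that])
  have cont: "continuous_on U F" "continuous_on U (\<lambda>y. ?F' y v)" for v
  proof -
    show "continuous_on U F"
      using F' by (meson continuous_at_imp_continuous_on has_derivative_continuous)
    have "Ck_on 0 U (\<lambda>y. ?F' y v)"
      using Ck_on_SucD(2)[OF Suc.prems(2), of v]
      by (induction k) (blast intro: Ck_on_Suc_imp)+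
    then show "continuous_on U (\<lambda>y. ?F' y v)" by simp
  qed
  \<comment> \<open>\<open>leibniz_rule\<close> takes the derivative of the integrand as a bounded
    linear function that is continuous in (y, t); its continuity is checked on each vector
    separately.\<close>
  define B where "B y t = Blinfun (\<lambda>v. w t * ?F' (a + t *\<^sub>R (y - a)) (t *\<^sub>R v))" for y t
  have B: "blinfun_apply (B y t) v = w t * (t * ?F' (a + t *\<^sub>R (y - a)) v)"
    if "y \<in> U" "t \<in> {0..1}" for y t v
  proof -
    have bl: "bounded_linear (?F' (a + t *\<^sub>R (y - a)))"
      using F'[OF seg[OF that]] by (rule has_derivative_bounded_linear)
    have "bounded_linear (\<lambda>v. w t * ?F' (a + t *\<^sub>R (y - a)) (t *\<^sub>R v))"
      by (intro bounded_linear_const_mult bounded_linear_compose[OF bl] bounded_linear_scaleR_right)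
    then show ?thesis
      using linear_scale[OF bounded_linear.linear[OF bl]] by (simp add: B_def bounded_linear_Blinfun_apply)
  qed
  have wc: "continuous_on (U \<times> cbox 0 1) (\<lambda>x. w (snd x))"
    by (rule continuous_on_compose2[OF Suc.prems(1)]) (auto intro: continuous_intros)
  have Bc: "continuous_on (U \<times> cbox 0 1) (\<lambda>(y, t). B y t)"
  proof (rule continuous_on_blinfun_componentwise)
    fix i :: 'b
    have "continuous_on (U \<times> cbox 0 1) (\<lambda>x. ?F' (a + snd x *\<^sub>R (fst x - a)) i)"
      by (rule continuous_on_compose2[OF cont(2)])
        (use seg in \<open>auto intro!: continuous_intros\<close>)
    then have "continuous_on (U \<times> cbox 0 1) (\<lambda>x. w (snd x) * (snd x * ?F' (a + snd x *\<^sub>R (fst x - a)) i))"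
      by (intro continuous_intros wc)
    then show "continuous_on (U \<times> cbox 0 1) (\<lambda>x. blinfun_apply (case x of (y, t) \<Rightarrow> B y t) i)"
      by (rule continuous_on_eq) (use B in auto)
  qed
  have der: "((\<lambda>y. integral (cbox 0 1) (\<lambda>t. w t * F (a + t *\<^sub>R (y - a)))) has_derivative
      blinfun_apply (integral (cbox 0 1) (B y))) (at y)" if y: "y \<in> U" for y
  proof -
    have "((\<lambda>y. integral (cbox 0 1) (\<lambda>t. w t * F (a + t *\<^sub>R (y - a)))) has_derivative
      blinfun_apply (integral (cbox 0 1) (B y))) (at y within U)"
    proof (rule leibniz_rule[OF _ _ Bc y U(2)])
      fix x t assume xt: "x \<in> U" "t \<in> cbox (0::real) 1"
      then have t: "t \<in> {0..1}" by simp
      have g: "((\<lambda>y. a + t *\<^sub>R (y - a)) has_derivative (\<lambda>v. t *\<^sub>R v)) (at x within U)"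
        by (auto intro!: derivative_eq_intros)
      have "((\<lambda>y. F (a + t *\<^sub>R (y - a))) has_derivative (\<lambda>v. ?F' (a + t *\<^sub>R (x - a)) (t *\<^sub>R v))) (at x within U)"
        by (rule has_derivative_compose[OF g F'[OF seg[OF xt(1) t]]])
      then have "((\<lambda>y. w t * F (a + t *\<^sub>R (y - a))) has_derivative
          (\<lambda>v. w t * ?F' (a + t *\<^sub>R (x - a)) (t *\<^sub>R v))) (at x within U)"
        by (rule has_derivative_mult_right)
      moreover have "(\<lambda>v. w t * ?F' (a + t *\<^sub>R (x - a)) (t *\<^sub>R v)) = blinfun_apply (B x t)"
      proof
        fix v
        show "w t * ?F' (a + t *\<^sub>R (x - a)) (t *\<^sub>R v) = blinfun_apply (B x t) v"
          using linear_scale[OF has_derivative_linear[OF F'[OF seg[OF xt(1) t]]]] B[OF xt(1) t]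
          by simp
      qed
      ultimately show "((\<lambda>y. w t * F (a + t *\<^sub>R (y - a))) has_derivative blinfun_apply (B x t)) (at x within U)"
        by simp
    next
      fix x assume x: "x \<in> U"
      show "(\<lambda>t. w t * F (a + t *\<^sub>R (x - a))) integrable_on cbox 0 1"
        unfolding cbox_interval
        by (intro integrable_continuous_interval continuous_intros Suc.prems(1)
            continuous_on_compose2[OF cont(1)]) (use seg[OF x] in auto)
    qed
    then show ?thesis using at_within_open[OF y U(1)] by simp
  qed
  have int: "blinfun_apply (integral (cbox 0 1) (B y)) v
      = integral {0..1} (\<lambda>t. (w t * t) * ?F' (a + t *\<^sub>R (y - a)) v)" if y: "y \<in> U" for y v
  proof -
    have "continuous_on (cbox 0 1) (B y)"
      using continuous_on_compose2[OF Bc, of "cbox 0 1" "\<lambda>t. (y, t)"] y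
      by (auto simp: continuous_on_Pair)
    then have "B y integrable_on cbox 0 1" by (rule integrable_continuous)
    then have "blinfun_apply (integral (cbox 0 1) (B y)) v = integral (cbox 0 1) (\<lambda>t. blinfun_apply (B y t) v)"
      by (rule blinfun_apply_integral)
    also have "\<dots> = integral {0..1} (\<lambda>t. (w t * t) * ?F' (a + t *\<^sub>R (y - a)) v)"
      unfolding cbox_interval
      by (rule integral_cong) (use B[OF y] in auto)
    finally show ?thesis .
  qed
  show ?case
  proof (rule Ck_on_SucI[OF U(1)])
    show "((\<lambda>y. integral {0..1} (\<lambda>t. w t * F (a + t *\<^sub>R (y - a)))) has_derivative
      blinfun_apply (integral (cbox 0 1) (B y))) (at y)" if "y \<in> U" for y
      using der[OF that] by simp
    fix v
    show "Ck_on k U (\<lambda>y. blinfun_apply (integral (cbox 0 1) (B y)) v)"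
    proof (rule Ck_on_cong[OF U(1)])
      \<comment> \<open>Each derivative in \<open>y\<close> brings down a factor t. The weight
        absorbs it, which is why \<open>w\<close> is arbitrary in the induction.\<close>
      show "Ck_on k U (\<lambda>y. integral {0..1} (\<lambda>t. (w t * t) * ?F' (a + t *\<^sub>R (y - a)) v))"
        by (rule Suc.IH) (intro continuous_intros Suc.prems(1) Ck_on_SucD(2)[OF Suc.prems(2)])+
    qed (rule int[symmetric])
  qed
qed

text \<open>The fundamental theorem of calculus along the segment from \<open>a\<close> to
  \<open>y\<close>: the derivative along the segment is a sum of coordinates of y - a times partial
  derivatives of \<open>F\<close>, and averaging the latter over the segment gives
  \<open>h b\<close>.\<close>

lemma Hadamard:
  fixes F :: "'b::euclidean_space \<Rightarrow> real"
  assumes U: "open U" "convex U" "a \<in> U" and F: "smooth_on U F"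
  obtains h where "\<And>b. b \<in> Basis \<Longrightarrow> smooth_on U (h b)"
    "\<And>b. b \<in> Basis \<Longrightarrow> h b a = frechet_derivative F (at a) b"
    "\<And>y. y \<in> U \<Longrightarrow> F y = F a + (\<Sum>b\<in>Basis. ((y - a) \<bullet> b) * h b y)"
proof
  let ?F' = "\<lambda>y. frechet_derivative F (at y)"
  \<comment> \<open>The factor 1 is the constant weight in
    \<open>Ck_on_segment_integral\<close>.\<close>
  let ?h = "\<lambda>b y. integral {0..1} (\<lambda>t. 1 * ?F' (a + t *\<^sub>R (y - a)) b)"
  show "smooth_on U (?h b)" for b
    unfolding smooth_on_def
    by (intro allI Ck_on_segment_integral[OF U] continuous_intros)
      (use smooth_on_frechet_derivative[OF F] in \<open>simp add: smooth_on_def\<close>)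
  show "?h b a = ?F' a b" for b by simp
  fix y assume y: "y \<in> U"
  have seg: "a + t *\<^sub>R (y - a) \<in> U" if "t \<in> {0..1}" for t
    using convexD_alt[OF U(2) U(3) y, of t] that by (simp add: algebra_simps)
  have F': "(F has_derivative ?F' z) (at z)" if "z \<in> U" for z
    by (rule smooth_on_has_derivative[OF F that])
  have *: "?F' (a + t *\<^sub>R (y - a)) (y - a) = (\<Sum>b\<in>Basis. ((y - a) \<bullet> b) * ?F' (a + t *\<^sub>R (y - a)) b)"
    if "t \<in> {0..1}" for t
  proof -
    let ?L = "?F' (a + t *\<^sub>R (y - a))"
    have "?L (\<Sum>b\<in>Basis. ((y - a) \<bullet> b) *\<^sub>R b) = (\<Sum>b\<in>Basis. ((y - a) \<bullet> b) * ?L b)"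
      using has_derivative_linear[OF F'[OF seg[OF that]]] by (simp add: linear_sum linear_scale)
    then show ?thesis by (simp add: euclidean_representation)
  qed
  have "((\<lambda>t. ?F' (a + t *\<^sub>R (y - a)) (y - a)) has_integral
      F (a + 1 *\<^sub>R (y - a)) - F (a + 0 *\<^sub>R (y - a))) {0..1}"
  proof (rule fundamental_theorem_of_calculus)
    fix t :: real assume t: "t \<in> {0..1}"
    have g: "((\<lambda>t. a + t *\<^sub>R (y - a)) has_derivative (\<lambda>v. v *\<^sub>R (y - a))) (at t within {0..1})"
      by (auto intro!: derivative_eq_intros)
    show "((\<lambda>t. F (a + t *\<^sub>R (y - a))) has_vector_derivative ?F' (a + t *\<^sub>R (y - a)) (y - a)) (at t within {0..1})"
      using has_derivative_compose[OF g F'[OF seg[OF t]]]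
        linear_scale[OF has_derivative_linear[OF F'[OF seg[OF t]]]]
      by (simp add: has_vector_derivative_def)
  qed simp
  then have "F y - F a = integral {0..1} (\<lambda>t. ?F' (a + t *\<^sub>R (y - a)) (y - a))"
    by (simp add: integral_unique)
  also have "\<dots> = integral {0..1} (\<lambda>t. \<Sum>b\<in>Basis. ((y - a) \<bullet> b) * ?F' (a + t *\<^sub>R (y - a)) b)"
    by (rule integral_cong) (rule *)
  also have "\<dots> = (\<Sum>b\<in>Basis. integral {0..1} (\<lambda>t. ((y - a) \<bullet> b) * ?F' (a + t *\<^sub>R (y - a)) b))"
  proof (rule integral_sum)
    fix b :: 'b
    have "continuous_on U (\<lambda>z. ?F' z b)"
      by (rule smooth_on_imp_continuous_on[OF smooth_on_frechet_derivative[OF F]])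
    then have "continuous_on {0..1} (\<lambda>t. ?F' (a + t *\<^sub>R (y - a)) b)"
      by (rule continuous_on_compose2) (use seg in \<open>auto intro!: continuous_intros\<close>)
    then show "(\<lambda>t. ((y - a) \<bullet> b) * ?F' (a + t *\<^sub>R (y - a)) b) integrable_on {0..1}"
      by (intro integrable_continuous_interval continuous_on_mult_left)
  qed simp
  also have "\<dots> = (\<Sum>b\<in>Basis. ((y - a) \<bullet> b) * ?h b y)"
    by simp
  finally show "F y = F a + (\<Sum>b\<in>Basis. ((y - a) \<bullet> b) * ?h b y)" by simp
qed

section \<open>Local frames\<close>

locale smooth_manifold =
  fixes A :: "('a::{t2_space,second_countable_topology}, 'n::finite) chart set"
  assumes atlas: "smooth_atlas A"
begin

lemma chart:
  assumes "(U, \<phi>) \<in> A"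
  shows "open U" "open (\<phi> ` U)" "homeomorphism U (\<phi> ` U) \<phi> (inv_into U \<phi>)"
proof -
  have "\<forall>(U, \<phi>)\<in>A. open U \<and> open (\<phi> ` U) \<and> homeomorphism U (\<phi> ` U) \<phi> (inv_into U \<phi>)"
    using atlas unfolding smooth_atlas_def by (elim conjE)
  from bspec[OF this assms] show "open U" "open (\<phi> ` U)" "homeomorphism U (\<phi> ` U) \<phi> (inv_into U \<phi>)"
    by simp_all
qed

lemma chart_transition:
  assumes "(U, \<phi>) \<in> A" "(V, \<psi>) \<in> A"
  shows "smooth_on (\<phi> ` (U \<inter> V)) (\<psi> \<circ> inv_into U \<phi>)"
proof -
  have "\<forall>(U, \<phi>)\<in>A. \<forall>(V, \<psi>)\<in>A. smooth_on (\<phi> ` (U \<inter> V)) (\<psi> \<circ> inv_into U \<phi>)"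
    using atlas unfolding smooth_atlas_def by (elim conjE)
  from bspec[OF this assms(1)]
  have "\<forall>(V, \<psi>)\<in>A. smooth_on (\<phi> ` (U \<inter> V)) (\<psi> \<circ> inv_into U \<phi>)"
    by (simp only: prod.case)
  from bspec[OF this assms(2)] show ?thesis by (simp only: prod.case)
qed

lemma chart_inj_on: "(U, \<phi>) \<in> A \<Longrightarrow> inj_on \<phi> U"
  by (rule inj_on_inverseI, rule homeomorphism_apply1[OF chart(3)])

lemma chart_inv: "(U, \<phi>) \<in> A \<Longrightarrow> q \<in> U \<Longrightarrow> inv_into U \<phi> (\<phi> q) = q"
  by (simp add: chart_inj_on)

lemma chart_open_image:
  assumes "(U, \<phi>) \<in> A" "open W"
  shows "open (\<phi> ` (U \<inter> W))"
proof -
  have "open ({y \<in> \<phi> ` U. inv_into U \<phi> y \<in> W})"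
    using continuous_open_preimage[OF homeomorphism_cont2[OF chart(3)[OF assms(1)]] chart(2)[OF assms(1)] assms(2)]
    by (simp add: vimage_def Int_def)
  moreover have "{y \<in> \<phi> ` U. inv_into U \<phi> y \<in> W} = \<phi> ` (U \<inter> W)"
    using chart_inv[OF assms(1)] by auto
  ultimately show ?thesis by simp
qed

lemma chart_continuous_on: "(U, \<phi>) \<in> A \<Longrightarrow> continuous_on U \<phi>"
  by (rule homeomorphism_cont1[OF chart(3)])

lemma chart_at: obtains U \<phi> where "(U, \<phi>) \<in> A" "p \<in> U"
proof -
  have "p \<in> (\<Union>(U, \<phi>)\<in>A. U)"
    using atlas unfolding smooth_atlas_def by (elim conjE) simp
  then show ?thesis using that by auto
qed

definition smooth_in :: "'a set \<Rightarrow> ('a \<Rightarrow> real) \<Rightarrow> bool" where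
  "smooth_in W f \<longleftrightarrow> (\<forall>(V, \<psi>)\<in>A. smooth_on (\<psi> ` (V \<inter> W)) (f \<circ> inv_into V \<psi>))"

lemma cinf_chart: "f \<in> cinf A \<Longrightarrow> (U, \<phi>) \<in> A \<Longrightarrow> smooth_on (\<phi> ` U) (f \<circ> inv_into U \<phi>)"
  by (auto simp: cinf_def)

lemma cinf_local:
  assumes "\<And>p. \<exists>W. open W \<and> p \<in> W \<and> smooth_in W f"
  shows "f \<in> cinf A"
proof -
  have "smooth_on (\<psi> ` V) (f \<circ> inv_into V \<psi>)" if c: "(V, \<psi>) \<in> A" for V \<psi>
  proof (rule smooth_on_local)
    fix y assume "y \<in> \<psi> ` V"
    then obtain q where q: "q \<in> V" "y = \<psi> q" by auto
    obtain W where W: "open W" "q \<in> W" "smooth_in W f" using assms by blast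
    show "\<exists>T. open T \<and> y \<in> T \<and> smooth_on T (f \<circ> inv_into V \<psi>)"
      using q W c chart_open_image[OF c W(1)]
      by (intro exI[of _ "\<psi> ` (V \<inter> W)"]) (auto simp: smooth_in_def)
  qed
  then show ?thesis by (auto simp: cinf_def)
qed

lemma smooth_in_cinf: "f \<in> cinf A \<Longrightarrow> smooth_in W f"
  unfolding cinf_def smooth_in_def by (fastforce intro: smooth_on_subset)

lemma smooth_in_cong:
  assumes "open W" "\<And>q. q \<in> W \<Longrightarrow> f q = g q" "smooth_in W f"
  shows "smooth_in W g"
  unfolding smooth_in_def
proof safe
  fix V \<psi> assume c: "(V, \<psi>) \<in> A"
  show "smooth_on (\<psi> ` (V \<inter> W)) (g \<circ> inv_into V \<psi>)"
    by (rule smooth_on_cong[OF chart_open_image[OF c assms(1)], where f = "f \<circ> inv_into V \<psi>"])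
      (use assms(2,3) c chart_inv[OF c] in \<open>auto simp: smooth_in_def\<close>)
qed

text \<open>\<open>smooth_in\<close> asks for smoothness in every chart; the smooth transition maps
  reduce this to the chart in which \<open>H\<close> is given.\<close>

lemma smooth_in_chart:
  assumes c: "(U, \<phi>) \<in> A" and W: "open W" "W \<subseteq> U" and H: "smooth_on (\<phi> ` W) H"
  shows "smooth_in W (\<lambda>q. H (\<phi> q))"
  unfolding smooth_in_def
proof safe
  fix V \<psi> assume c': "(V, \<psi>) \<in> A"
  have "smooth_on (\<psi> ` (V \<inter> U)) (\<phi> \<circ> inv_into V \<psi>)"
    by (rule chart_transition[OF c' c])
  then have tr: "smooth_on (\<psi> ` (V \<inter> W)) (\<phi> \<circ> inv_into V \<psi>)"
    by (rule smooth_on_subset) (use W in auto)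
  have op: "open (\<phi> ` W)"
    using chart_open_image[OF c W(1)] W(2) by (simp add: Int_absorb1)
  have "smooth_on (\<psi> ` (V \<inter> W)) (\<lambda>y. H ((\<phi> \<circ> inv_into V \<psi>) y))"
    by (rule smooth_on_compose[OF chart_open_image[OF c' W(1)] op _ H tr])
      (use chart_inv[OF c'] in auto)
  then show "smooth_on (\<psi> ` (V \<inter> W)) ((\<lambda>q. H (\<phi> q)) \<circ> inv_into V \<psi>)"
    by (simp add: o_def)
qed

lemma cinf_const [simp]: "(\<lambda>p. c) \<in> cinf A"
  unfolding cinf_def using chart(2) by (auto simp: o_def intro: smooth_on_const)

lemma cinf_add: "f \<in> cinf A \<Longrightarrow> g \<in> cinf A \<Longrightarrow> (\<lambda>p. f p + g p) \<in> cinf A"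
  unfolding cinf_def using chart(2) by (auto simp: o_def intro!: smooth_on_add)

lemma cinf_mult: "f \<in> cinf A \<Longrightarrow> g \<in> cinf A \<Longrightarrow> (\<lambda>p. f p * g p) \<in> cinf A"
  unfolding cinf_def using chart(2) by (auto simp: o_def intro!: smooth_on_mult)

lemma cinf_minus: "f \<in> cinf A \<Longrightarrow> (\<lambda>p. - f p) \<in> cinf A"
  using cinf_mult[OF cinf_const, of f "-1"] by simp

lemma cinf_diff: "f \<in> cinf A \<Longrightarrow> g \<in> cinf A \<Longrightarrow> (\<lambda>p. f p - g p) \<in> cinf A"
  using cinf_add[OF _ cinf_minus, of f g] by simp

lemma cinf_sum: "(\<And>i. i \<in> I \<Longrightarrow> f i \<in> cinf A) \<Longrightarrow> (\<lambda>p. \<Sum>i\<in>I. f i p) \<in> cinf A"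
  by (induction I rule: infinite_finite_induct) (auto intro: cinf_add)

lemmas cinf_intros = cinf_const cinf_add cinf_mult cinf_minus cinf_diff cinf_sum

definition transplant :: "'a set \<Rightarrow> ('a \<Rightarrow> real ^ 'n) \<Rightarrow> (real ^ 'n) set \<Rightarrow> (real ^ 'n \<Rightarrow> real) \<Rightarrow> 'a \<Rightarrow> real" where
  "transplant U \<phi> K H = (\<lambda>q. if q \<in> U \<and> \<phi> q \<in> K then H (\<phi> q) else 0)"

text \<open>The preimage of \<open>B\<close> and the complement of the preimage of \<open>K\<close>
  cover the manifold. On the first set the function is \<open>H\<close> read in the chart, on the
  second it is 0. The complement is open because compact subsets of a Hausdorff space are
  closed.\<close>

lemma transplant_cinf:
  assumes c: "(U, \<phi>) \<in> A" and K: "compact K" "K \<subseteq> B" "open B" "B \<subseteq> \<phi> ` U"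
    and H: "smooth_on B H" "\<And>y. y \<in> B - K \<Longrightarrow> H y = 0"
  shows "transplant U \<phi> K H \<in> cinf A"
proof (rule cinf_local)
  fix p
  define W where "W = inv_into U \<phi> ` B"
  have W: "W = {q \<in> U. \<phi> q \<in> B}"
    unfolding W_def using K(4) chart_inv[OF c] inv_into_into[of _ \<phi> U] f_inv_into_f[of _ \<phi> U]
    by (auto simp: image_iff) (metis in_mono)+
  have oW: "open W"
    using continuous_open_preimage[OF chart_continuous_on[OF c] chart(1)[OF c] K(3)]
    by (simp add: W vimage_def Int_def)
  have "continuous_on K (inv_into U \<phi>)"
    using homeomorphism_cont2[OF chart(3)[OF c]] K(2,4) by (meson continuous_on_subset subset_trans)
  then have "compact (inv_into U \<phi> ` K)"
    using K(1) compact_continuous_image by blast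
  then have cl: "closed (inv_into U \<phi> ` K)"
    by (rule compact_imp_closed)
  have img: "inv_into U \<phi> ` K = {q \<in> U. \<phi> q \<in> K}"
    using K(2,4) chart_inv[OF c] inv_into_into[of _ \<phi> U] f_inv_into_f[of _ \<phi> U]
    by (auto simp: image_iff) (metis in_mono)+
  show "\<exists>W. open W \<and> p \<in> W \<and> smooth_in W (transplant U \<phi> K H)"
  proof (cases "p \<in> W")
    case True
    have "\<phi> ` W \<subseteq> B" using W by auto
    then have "smooth_in W (\<lambda>q. H (\<phi> q))"
      by (intro smooth_in_chart[OF c oW] smooth_on_subset[OF H(1)]) (use W in auto)
    then have "smooth_in W (transplant U \<phi> K H)"
      by (rule smooth_in_cong[OF oW, rotated]) (use W H(2) in \<open>auto simp: transplant_def\<close>)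
    then show ?thesis using True oW by blast
  next
    case False
    let ?V = "- (inv_into U \<phi> ` K)"
    have "smooth_in ?V (\<lambda>q. 0)"
      by (rule smooth_in_cinf[OF cinf_const])
    then have "smooth_in ?V (transplant U \<phi> K H)"
      by (rule smooth_in_cong[rotated 2]) (use cl img in \<open>auto simp: transplant_def\<close>)
    moreover have "p \<in> ?V" using False img W K(2) by auto
    ultimately show ?thesis using cl by blast
  qed
qed


section \<open>Derivations at a point and their coordinates\<close>

lemma tangent_add: "v \<in> tangent_space A p \<Longrightarrow> f \<in> cinf A \<Longrightarrow> g \<in> cinf A \<Longrightarrow>
    v (\<lambda>x. f x + g x) = v f + v g"
  by (simp add: tangent_space_def lin_on_def func_plus)

lemma tangent_cmult: "v \<in> tangent_space A p \<Longrightarrow> f \<in> cinf A \<Longrightarrow> v (\<lambda>x. c * f x) = c * v f"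
  by (simp add: tangent_space_def lin_on_def)

lemma tangent_mult: "v \<in> tangent_space A p \<Longrightarrow> f \<in> cinf A \<Longrightarrow> g \<in> cinf A \<Longrightarrow>
    v (\<lambda>x. f x * g x) = v f * g p + f p * v g"
  by (simp add: tangent_space_def func_times)

lemma tangent_outside: "v \<in> tangent_space A p \<Longrightarrow> f \<notin> cinf A \<Longrightarrow> v f = 0"
  by (simp add: tangent_space_def lin_on_def)

lemma tangentI:
  assumes "\<And>f g. f \<in> cinf A \<Longrightarrow> g \<in> cinf A \<Longrightarrow> v (\<lambda>x. f x + g x) = v f + v g"
    "\<And>c f. f \<in> cinf A \<Longrightarrow> v (\<lambda>x. c * f x) = c * v f"
    "\<And>f g. f \<in> cinf A \<Longrightarrow> g \<in> cinf A \<Longrightarrow> v (\<lambda>x. f x * g x) = v f * g p + f p * v g"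
    "\<And>f. f \<notin> cinf A \<Longrightarrow> v f = 0"
  shows "v \<in> tangent_space A p"
  using assms by (simp add: tangent_space_def lin_on_def func_times func_plus)

lemma tangent_const: 
  assumes v: "v \<in> tangent_space A p"
  shows "v (\<lambda>x. c) = 0"
proof -
  have "v (\<lambda>x. 1 * 1) = v (\<lambda>x. 1) * 1 + 1 * v (\<lambda>x. 1)"
    by (rule tangent_mult[OF v]) auto
  then have "v (\<lambda>x. 1) = 0" by simp
  then show ?thesis using tangent_cmult[OF v cinf_const, of c 1] by simp
qed

lemma tangent_minus: "v \<in> tangent_space A p \<Longrightarrow> f \<in> cinf A \<Longrightarrow> v (\<lambda>x. - f x) = - v f"
  using tangent_cmult[of v p f "-1"] by simp

lemma tangent_diff: "v \<in> tangent_space A p \<Longrightarrow> f \<in> cinf A \<Longrightarrow> g \<in> cinf A \<Longrightarrow>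
    v (\<lambda>x. f x - g x) = v f - v g"
  using tangent_add[of v p f "\<lambda>x. - g x"] by (simp add: tangent_minus cinf_minus)

lemma tangent_sum:
  assumes v: "v \<in> tangent_space A p" and f: "\<And>i. i \<in> I \<Longrightarrow> f i \<in> cinf A"
  shows "v (\<lambda>x. \<Sum>i\<in>I. f i x) = (\<Sum>i\<in>I. v (f i))"
  using f
proof (induction I rule: infinite_finite_induct)
  case (insert i I)
  then show ?case
    using tangent_add[OF v, of "f i" "\<lambda>x. \<Sum>i\<in>I. f i x"] cinf_sum[of I f] by simp
qed (simp_all add: tangent_const[OF v])

definition coord_deriv ::
    "'a set \<Rightarrow> ('a \<Rightarrow> real ^ 'n) \<Rightarrow> real ^ 'n \<Rightarrow> ('a \<Rightarrow> real) \<Rightarrow> real ^ 'n \<Rightarrow> real" where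
  "coord_deriv U \<phi> b f y = frechet_derivative (f \<circ> inv_into U \<phi>) (at y) b"

text \<open>The factor \<open>k\<close> will be the value of a cutoff at \<open>q\<close>, so that
  the truncated partial derivatives in \<open>frame\<close> are covered directly.\<close>

lemma coord_deriv_tangent:
  assumes c: "(U, \<phi>) \<in> A" and q: "q \<in> U"
  shows "(\<lambda>f. if f \<in> cinf A then k * coord_deriv U \<phi> b f (\<phi> q) else 0) \<in> tangent_space A q"
proof (rule tangentI)
  let ?j = "inv_into U \<phi>" and ?y = "\<phi> q"
  have der: "((\<lambda>y. f (?j y)) has_derivative frechet_derivative (f \<circ> ?j) (at ?y)) (at ?y)"
    if "f \<in> cinf A" for f
    using smooth_on_has_derivative[of "\<phi> ` U" "f \<circ> ?j" ?y] that c q by (auto simp: cinf_def o_def)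
  have fd: "coord_deriv U \<phi> b f ?y = D b" if "((\<lambda>y. f (?j y)) has_derivative D) (at ?y)" for f D
    using frechet_derivative_at[OF that] by (simp add: coord_deriv_def o_def)
  fix f assume f: "f \<in> cinf A"
  show "(if (\<lambda>x. c' * f x) \<in> cinf A then k * coord_deriv U \<phi> b (\<lambda>x. c' * f x) ?y else 0) =
      c' * (if f \<in> cinf A then k * coord_deriv U \<phi> b f ?y else 0)" for c'
    using fd[OF has_derivative_mult_right[OF der[OF f], of c']] f
    by (simp add: cinf_mult coord_deriv_def)
  fix g assume g: "g \<in> cinf A"
  show "(if (\<lambda>x. f x + g x) \<in> cinf A then k * coord_deriv U \<phi> b (\<lambda>x. f x + g x) ?y else 0) =
      (if f \<in> cinf A then k * coord_deriv U \<phi> b f ?y else 0) +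
      (if g \<in> cinf A then k * coord_deriv U \<phi> b g ?y else 0)"
    using fd[OF has_derivative_add[OF der[OF f] der[OF g]]] f g
    by (simp add: cinf_add coord_deriv_def algebra_simps)
  show "(if (\<lambda>x. f x * g x) \<in> cinf A then k * coord_deriv U \<phi> b (\<lambda>x. f x * g x) ?y else 0) =
      (if f \<in> cinf A then k * coord_deriv U \<phi> b f ?y else 0) * g q +
      f q * (if g \<in> cinf A then k * coord_deriv U \<phi> b g ?y else 0)"
    using fd[OF has_derivative_mult[OF der[OF f] der[OF g]]] f g chart_inv[OF c q]
    by (simp add: cinf_mult coord_deriv_def algebra_simps)
qed simp

text \<open>Hadamard's lemma writes f - f(q) near \<open>q\<close> as a sum of products whose first
  factors x_b - x_b(q) vanish at \<open>q\<close>, so the product rule leaves v(x_b) times a partial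
  derivative. Since \<open>v\<close> accepts global smooth functions only, a cutoff first makes the
  expansion global.\<close>

lemma tangent_coord:
  assumes c: "(U, \<phi>) \<in> A" and K: "K \<subseteq> \<phi> ` U"
    and x: "\<And>b q. b \<in> Basis \<Longrightarrow> q \<in> U \<Longrightarrow> \<phi> q \<in> K \<Longrightarrow> x b q = \<phi> q \<bullet> b"
    and xc: "\<And>b. b \<in> Basis \<Longrightarrow> x b \<in> cinf A"
    and q: "q \<in> U" "\<phi> q \<in> interior K" and v: "v \<in> tangent_space A q" and f: "f \<in> cinf A"
  shows "v f = (\<Sum>b\<in>Basis. v (x b) * coord_deriv U \<phi> b f (\<phi> q))"
proof -
  let ?y = "\<phi> q" and ?F = "f \<circ> inv_into U \<phi>"
  obtain s where s: "s > 0" "ball ?y s \<subseteq> K"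
    using q(2) by (meson mem_interior)
  have sF: "smooth_on (ball ?y s) ?F"
    by (rule smooth_on_subset[OF cinf_chart[OF f c]]) (use s K in blast)
  have y_ball: "?y \<in> ball ?y s" using s(1) by simp
  obtain h where h: "\<And>b. b \<in> Basis \<Longrightarrow> smooth_on (ball ?y s) (h b)"
    "\<And>b. b \<in> Basis \<Longrightarrow> h b ?y = frechet_derivative ?F (at ?y) b"
    "\<And>y. y \<in> ball ?y s \<Longrightarrow> ?F y = ?F ?y + (\<Sum>b\<in>Basis. ((y - ?y) \<bullet> b) * h b y)"
    by (rule Hadamard[OF open_ball convex_ball y_ball sF]) (rule that)
  have quarter: "0 < s / 4" "s / 4 < s / 2"
    using s(1) by simp_all
  obtain t :: "real ^ 'n \<Rightarrow> real" where t: "smooth_on UNIV t" "\<And>z. z \<in> cball ?y (s / 4) \<Longrightarrow> t z = 1"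
    "\<And>z. z \<notin> ball ?y (s / 2) \<Longrightarrow> t z = 0"
    by (rule smooth_bump_exists[OF quarter, of ?y]) (rule that)
  let ?L = "cball ?y (s / 2)"
  define \<theta> where "\<theta> = transplant U \<phi> ?L t"
  define k where "k b = transplant U \<phi> ?L (\<lambda>y. t y * h b y)" for b
  have L: "?L \<subseteq> ball ?y s" "ball ?y s \<subseteq> \<phi> ` U"
    using s K by auto
  have tL: "t y = 0" if "y \<in> ball ?y s - ?L" for y
    using t(3)[of y] that by auto
  have st: "smooth_on (ball ?y s) t"
    using t(1) smooth_on_subset by blast
  have \<theta>: "\<theta> \<in> cinf A"
    unfolding \<theta>_def by (rule transplant_cinf[OF c _ L(1) _ L(2) st tL]) auto
  have k: "k b \<in> cinf A" if "b \<in> Basis" for b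
    unfolding k_def
    by (rule transplant_cinf[OF c _ L(1) _ L(2) smooth_on_mult[OF _ st h(1)[OF that]]]) (use tL in auto)
  have \<theta>q: "\<theta> q = 1" using q s t(2) by (simp add: \<theta>_def transplant_def)
  have kq: "k b q = coord_deriv U \<phi> b f ?y" if "b \<in> Basis" for b
    using q s t(2)[of ?y] h(2)[OF that] by (simp add: k_def transplant_def coord_deriv_def)
  have xq: "x b q = ?y \<bullet> b" if "b \<in> Basis" for b
    using x[OF that q(1)] q(2) interior_subset by blast
  let ?g = "\<lambda>b r. \<theta> r * (x b r - x b q)"
  have gc: "?g b \<in> cinf A" if "b \<in> Basis" for b
    by (intro cinf_intros \<theta> xc that)
  \<comment> \<open>\<open>?g b\<close> and \<open>k b\<close> carry one factor
    \<open>\<theta>\<close> each, hence the square. Outside the support both sides vanish, so the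
    identity holds at every point.\<close>
  have eq: "(\<theta> r * \<theta> r) * (f r - f q) = (\<Sum>b\<in>Basis. ?g b r * k b r)" for r
  proof (cases "r \<in> U \<and> \<phi> r \<in> ?L")
    case True
    then have r: "\<phi> r \<in> ball ?y s" "\<phi> r \<in> K" using L s by auto
    have "f r - f q = (\<Sum>b\<in>Basis. ((\<phi> r - ?y) \<bullet> b) * h b (\<phi> r))"
      using h(3)[OF r(1)] True q(1) by (simp add: chart_inv[OF c])
    also have "\<dots> = (\<Sum>b\<in>Basis. (x b r - x b q) * h b (\<phi> r))"
      using True r by (intro sum.cong) (auto simp: x xq inner_diff_left)
    finally show ?thesis
      using True by (simp add: \<theta>_def k_def transplant_def sum_distrib_left algebra_simps)
  qed (auto simp: \<theta>_def transplant_def)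
  \<comment> \<open>The factor f - f(q) vanishes at \<open>q\<close> and \<open>\<theta>\<close> is
    1 there, so the derivative of the cutoff drops out.\<close>
  have 1: "v (\<lambda>r. (\<theta> r * \<theta> r) * (f r - f q)) = v f"
    using tangent_mult[OF v cinf_mult[OF \<theta> \<theta>] cinf_diff[OF f cinf_const[of "f q"]]]
    by (simp add: \<theta>q tangent_diff[OF v f cinf_const] tangent_const[OF v])
  have 2: "v (?g b) = v (x b)" if "b \<in> Basis" for b
    using tangent_mult[OF v \<theta> cinf_diff[OF xc[OF that] cinf_const[of "x b q"]]]
    by (simp add: \<theta>q tangent_diff[OF v xc[OF that] cinf_const] tangent_const[OF v])
  have "v (\<lambda>r. \<Sum>b\<in>Basis. ?g b r * k b r) = (\<Sum>b\<in>Basis. v (\<lambda>r. ?g b r * k b r))"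
    by (rule tangent_sum[OF v]) (intro cinf_mult gc k)
  also have "\<dots> = (\<Sum>b\<in>Basis. v (x b) * coord_deriv U \<phi> b f ?y)"
    by (rule sum.cong) (use 2 in \<open>auto simp: tangent_mult[OF v gc k] kq\<close>)
  finally show ?thesis using 1 eq by simp
qed

text \<open>Two nested cutoffs: \<open>\<psi>\<close> turns the chart coordinates into global
  functions that are still coordinates on the ball of radius R/2, and \<open>\<rho>\<close>, which
  vanishes outside that ball, truncates the coordinate vector fields. Inside the ball the expansion
  of \<open>tangent_coord\<close> applies, elsewhere both sides are 0. Thus the last property holds
  at every \<open>q\<close>, with \<open>\<eta>\<close> recording the truncation.\<close>

lemma frame:
  obtains I :: "(real ^ 'n) set" and W \<eta> x e
  where "finite I" "open W" "p \<in> W" "\<eta> \<in> cinf A" "\<And>q. q \<in> W \<Longrightarrow> \<eta> q = 1"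
    "\<And>i. i \<in> I \<Longrightarrow> x i \<in> cinf A" "\<And>i. i \<in> I \<Longrightarrow> e i \<in> vfields A"
    "\<And>q v f. v \<in> tangent_space A q \<Longrightarrow> f \<in> cinf A \<Longrightarrow> \<eta> q * v f = (\<Sum>i\<in>I. v (x i) * e i q f)"
proof -
  obtain U \<phi> where c: "(U, \<phi>) \<in> A" and p: "p \<in> U" by (rule chart_at)
  let ?y = "\<phi> p"
  obtain R where R: "R > 0" "cball ?y R \<subseteq> \<phi> ` U"
    using chart(2)[OF c] p by (metis image_eqI open_contains_cball)
  have half: "0 < R / 2" "R / 2 < R" and quarter: "0 < R / 4" "R / 4 < R / 2"
    using R(1) by simp_all
  obtain \<psi> :: "real ^ 'n \<Rightarrow> real" where \<psi>: "smooth_on UNIV \<psi>" "\<And>z. z \<in> cball ?y (R / 2) \<Longrightarrow> \<psi> z = 1"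
    "\<And>z. z \<notin> ball ?y R \<Longrightarrow> \<psi> z = 0"
    by (rule smooth_bump_exists[OF half, of ?y]) (rule that)
  obtain \<rho> :: "real ^ 'n \<Rightarrow> real" where \<rho>: "smooth_on UNIV \<rho>" "\<And>z. z \<in> cball ?y (R / 4) \<Longrightarrow> \<rho> z = 1"
    "\<And>z. z \<notin> ball ?y (R / 2) \<Longrightarrow> \<rho> z = 0"
    by (rule smooth_bump_exists[OF quarter, of ?y]) (rule that)
  define x where "x b = transplant U \<phi> (cball ?y R) (\<lambda>y. \<psi> y * (y \<bullet> b))" for b
  define \<eta> where "\<eta> = transplant U \<phi> (cball ?y R) \<rho>"
  define e :: "real ^ 'n \<Rightarrow> 'a vfield" where
    "e b q f = (if f \<in> cinf A then transplant U \<phi> (cball ?y R) (\<lambda>y. \<rho> y * coord_deriv U \<phi> b f y) q else 0)"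
    for b q f
  have T: "transplant U \<phi> (cball ?y R) H \<in> cinf A"
    if "smooth_on (\<phi> ` U) H" "\<And>y. y \<notin> ball ?y R \<Longrightarrow> H y = 0" for H
    by (rule transplant_cinf[OF c compact_cball R(2) chart(2)[OF c] order_refl that(1)]) (use that(2) in auto)
  have xc: "x b \<in> cinf A" for b
    unfolding x_def
    by (intro T smooth_on_mult chart(2)[OF c] smooth_on_subset[OF \<psi>(1)]
      smooth_on_bounded_linear[OF _ bounded_linear_inner_left]) (auto simp: \<psi>(3))
  have \<rho>0: "\<rho> y = 0" if "y \<notin> ball ?y R" for y
    using \<rho>(3)[of y] that R(1) by auto
  have \<eta>c: "\<eta> \<in> cinf A"
    unfolding \<eta>_def by (intro T smooth_on_subset[OF \<rho>(1)]) (auto simp: \<rho>0)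
  let ?W = "{q \<in> U. \<phi> q \<in> ball ?y (R / 4)}"
  have oW: "open ?W"
    using continuous_open_preimage[OF chart_continuous_on[OF c] chart(1)[OF c] open_ball[of ?y "R / 4"]]
    by (simp add: vimage_def Int_def)
  have pW: "p \<in> ?W" using p R by simp
  have \<eta>1: "\<eta> q = 1" if "q \<in> ?W" for q
    using that \<rho>(2)[of "\<phi> q"] R(1) by (auto simp: \<eta>_def transplant_def)
  have et: "e b q \<in> tangent_space A q" for b q
  proof (cases "q \<in> U \<and> \<phi> q \<in> cball ?y R")
    case True
    then have "e b q = (\<lambda>f. if f \<in> cinf A then \<rho> (\<phi> q) * coord_deriv U \<phi> b f (\<phi> q) else 0)"
      by (auto simp: e_def transplant_def fun_eq_iff)
    then show ?thesis using coord_deriv_tangent[OF c, of q] True by simp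
  next
    case False
    then have "e b q = (\<lambda>f. 0)"
      by (auto simp: e_def transplant_def fun_eq_iff)
    then show ?thesis by (auto intro: tangentI)
  qed
  have ev: "e b \<in> vfields A" for b
  proof -
    have "(\<lambda>q. e b q f) \<in> cinf A" if f: "f \<in> cinf A" for f
    proof -
      have "smooth_on (\<phi> ` U) (coord_deriv U \<phi> b f)"
        unfolding coord_deriv_def by (rule smooth_on_frechet_derivative[OF cinf_chart[OF f c]])
      then have "transplant U \<phi> (cball ?y R) (\<lambda>y. \<rho> y * coord_deriv U \<phi> b f y) \<in> cinf A"
        by (intro T smooth_on_mult chart(2)[OF c] smooth_on_subset[OF \<rho>(1)]) (auto simp: \<rho>0)
      then show ?thesis using f by (simp add: e_def)
    qed
    then show ?thesis using et by (simp add: vfields_def)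
  qed
  have rep: "\<eta> q * v f = (\<Sum>b\<in>Basis. v (x b) * e b q f)"
    if v: "v \<in> tangent_space A q" and f: "f \<in> cinf A" for q v f
  proof (cases "q \<in> U \<and> \<phi> q \<in> ball ?y (R / 2)")
    case True
    then have in_R: "\<phi> q \<in> cball ?y R" using R(1) by auto
    have "v f = (\<Sum>b\<in>Basis. v (x b) * coord_deriv U \<phi> b f (\<phi> q))"
    proof (rule tangent_coord[OF c _ _ _ _ _ v f])
      show "cball ?y (R / 2) \<subseteq> \<phi> ` U" using R by auto
      show "x b q = \<phi> q \<bullet> b" if "q \<in> U" "\<phi> q \<in> cball ?y (R / 2)" for b q
        using that \<psi>(2)[of "\<phi> q"] R(1) by (auto simp: x_def transplant_def)
      show "\<phi> q \<in> interior (cball ?y (R / 2))" using True by simp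
    qed (use True xc in auto)
    then show ?thesis
      using True in_R f by (simp add: \<eta>_def e_def transplant_def sum_distrib_left algebra_simps)
  next
    case False
    then have "transplant U \<phi> (cball ?y R) (\<lambda>y. \<rho> y * H y) q = 0" for H
      using \<rho>(3)[of "\<phi> q"] by (cases "q \<in> U") (simp_all add: transplant_def)
    from this[of "\<lambda>_. 1"] this show ?thesis by (auto simp: \<eta>_def e_def intro!: sum.neutral)
  qed
  show ?thesis
    by (rule that[OF finite_Basis oW pW \<eta>c \<eta>1 xc ev rep])
qed

end

section \<open>Tensorial maps and differential forms\<close>

lemma sum_fun_apply: "(\<Sum>i\<in>I. F i) x = (\<Sum>i\<in>I. F i x)"
  by (induction I rule: infinite_finite_induct) auto

lemma lin_on_add: "lin_on V L \<Longrightarrow> u \<in> V \<Longrightarrow> v \<in> V \<Longrightarrow> L (u + v) = L u + L v"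
  by (simp add: lin_on_def)

lemma lin_on_cmult: "lin_on V L \<Longrightarrow> v \<in> V \<Longrightarrow> L (\<lambda>x. c * v x) = c * L v"
  by (simp add: lin_on_def)

lemma lin_on_outside: "lin_on V L \<Longrightarrow> v \<notin> V \<Longrightarrow> L v = 0"
  by (simp add: lin_on_def)

lemma lin_onI:
  assumes "\<And>u v. u \<in> V \<Longrightarrow> v \<in> V \<Longrightarrow> L (u + v) = L u + L v"
    "\<And>c v. v \<in> V \<Longrightarrow> L (\<lambda>x. c * v x) = c * L v"
    "\<And>v. v \<notin> V \<Longrightarrow> L v = 0"
  shows "lin_on V L"
  using assms by (simp add: lin_on_def)

lemma lin_on_plus: "lin_on V L \<Longrightarrow> lin_on V L' \<Longrightarrow> lin_on V (\<lambda>v. L v + L' v)"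
  by (simp add: lin_on_def algebra_simps)

lemma lin_on_scale: "lin_on V L \<Longrightarrow> lin_on V (\<lambda>v. c * L v)"
  by (simp add: lin_on_def algebra_simps)

lemma lin_on_zero: "lin_on V (\<lambda>v. 0)"
  by (simp add: lin_on_def)

text \<open>General enough for vector fields and 1-forms alike, so that \<open>tensorial\<close> is
  defined once for both; on 1-forms it is \<open>scale1\<close>.\<close>

definition fscale :: "('a \<Rightarrow> real) \<Rightarrow> ('a \<Rightarrow> 'b \<Rightarrow> real) \<Rightarrow> 'a \<Rightarrow> 'b \<Rightarrow> real" where
  "fscale f s = (\<lambda>p v. f p * s p v)"

lemma fscale_apply: "fscale f s p = (\<lambda>v. f p * s p v)"
  by (simp add: fscale_def)

lemma scale1_eq_fscale: "scale1 = fscale"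
  by (simp add: scale1_def fscale_def fun_eq_iff)

context smooth_manifold
begin

lemma tangent_space_add:
  assumes "u \<in> tangent_space A p" "v \<in> tangent_space A p"
  shows "u + v \<in> tangent_space A p"
  by (rule tangentI)
    (use assms in \<open>simp_all add: tangent_add tangent_cmult tangent_mult tangent_outside algebra_simps\<close>)

lemma tangent_space_cmult:
  assumes "v \<in> tangent_space A p"
  shows "(\<lambda>f. c * v f) \<in> tangent_space A p"
  by (rule tangentI)
    (use assms in \<open>simp_all add: tangent_add tangent_cmult tangent_mult tangent_outside algebra_simps\<close>)

lemma tangent_space_zero: "0 \<in> tangent_space A p"
  by (rule tangentI) simp_all

lemma tangent_space_sum:
  "(\<And>i. i \<in> I \<Longrightarrow> V i \<in> tangent_space A p) \<Longrightarrow> (\<Sum>i\<in>I. V i) \<in> tangent_space A p"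
  by (induction I rule: infinite_finite_induct) (simp_all add: tangent_space_zero tangent_space_add)

lemma tangent_eqI:
  assumes "u \<in> tangent_space A p" "v \<in> tangent_space A p" "\<And>f. f \<in> cinf A \<Longrightarrow> u f = v f"
  shows "u = v"
proof
  show "u f = v f" for f
    using assms by (cases "f \<in> cinf A") (simp_all add: tangent_outside)
qed

lemma cotangent_space_add:
  "a \<in> cotangent_space A p \<Longrightarrow> b \<in> cotangent_space A p \<Longrightarrow> a + b \<in> cotangent_space A p"
  using lin_on_plus by (fastforce simp: cotangent_space_def func_plus)

lemma cotangent_space_cmult: "a \<in> cotangent_space A p \<Longrightarrow> (\<lambda>v. c * a v) \<in> cotangent_space A p"
  by (simp add: cotangent_space_def lin_on_scale)

lemma cotangent_sum:
  assumes a: "a \<in> cotangent_space A p" and V: "\<And>i. i \<in> I \<Longrightarrow> V i \<in> tangent_space A p"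
  shows "a (\<Sum>i\<in>I. V i) = (\<Sum>i\<in>I. a (V i))"
proof -
  have l: "lin_on (tangent_space A p) a" using a by (simp add: cotangent_space_def)
  have z: "a 0 = 0"
    using lin_on_cmult[OF l tangent_space_zero, of 0] by (simp add: zero_fun_def)
  show ?thesis
    using V
    by (induction I rule: infinite_finite_induct)
      (simp_all add: z lin_on_add[OF l] tangent_space_sum)
qed

lemma vfield_tangent: "X \<in> vfields A \<Longrightarrow> X p \<in> tangent_space A p"
  by (simp add: vfields_def)

lemma vfield_cinf: "X \<in> vfields A \<Longrightarrow> f \<in> cinf A \<Longrightarrow> (\<lambda>p. X p f) \<in> cinf A"
  by (simp add: vfields_def)

lemma vfieldsI:
  "(\<And>p. X p \<in> tangent_space A p) \<Longrightarrow> (\<And>f. f \<in> cinf A \<Longrightarrow> (\<lambda>p. X p f) \<in> cinf A) \<Longrightarrow> X \<in> vfields A"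
  by (simp add: vfields_def)

lemma vfields_eqI:
  assumes "X \<in> vfields A" "Y \<in> vfields A" "\<And>p f. f \<in> cinf A \<Longrightarrow> X p f = Y p f"
  shows "X = Y"
proof
  show "X p = Y p" for p
    by (rule tangent_eqI[OF vfield_tangent[OF assms(1)] vfield_tangent[OF assms(2)] assms(3)])
qed

lemma vfields_add: "X \<in> vfields A \<Longrightarrow> Y \<in> vfields A \<Longrightarrow> X + Y \<in> vfields A"
  by (rule vfieldsI) (simp_all add: tangent_space_add vfield_tangent cinf_add vfield_cinf)

lemma vfields_scale: "f \<in> cinf A \<Longrightarrow> X \<in> vfields A \<Longrightarrow> fscale f X \<in> vfields A"
  by (rule vfieldsI) (simp_all add: fscale_apply tangent_space_cmult vfield_tangent cinf_mult vfield_cinf)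

lemma vfields_zero: "0 \<in> vfields A"
  by (rule vfieldsI) (simp_all add: tangent_space_zero)

lemma vfields_sum: "(\<And>i. i \<in> I \<Longrightarrow> X i \<in> vfields A) \<Longrightarrow> (\<Sum>i\<in>I. X i) \<in> vfields A"
  by (induction I rule: infinite_finite_induct) (simp_all add: vfields_zero vfields_add)

lemma form1_cotangent: "\<alpha> \<in> forms1 A \<Longrightarrow> \<alpha> p \<in> cotangent_space A p"
  by (simp add: forms1_def)

lemma form1_lin_on: "\<alpha> \<in> forms1 A \<Longrightarrow> lin_on (tangent_space A p) (\<alpha> p)"
  by (simp add: forms1_def cotangent_space_def)

lemma form1_cinf: "\<alpha> \<in> forms1 A \<Longrightarrow> X \<in> vfields A \<Longrightarrow> (\<lambda>p. \<alpha> p (X p)) \<in> cinf A"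
  by (simp add: forms1_def)

lemma forms1I:
  "(\<And>p. lin_on (tangent_space A p) (\<alpha> p)) \<Longrightarrow> (\<And>X. X \<in> vfields A \<Longrightarrow> (\<lambda>p. \<alpha> p (X p)) \<in> cinf A)
    \<Longrightarrow> \<alpha> \<in> forms1 A"
  by (simp add: forms1_def cotangent_space_def)

lemmas form1_add = lin_on_add[OF form1_lin_on]
lemmas form1_cmult = lin_on_cmult[OF form1_lin_on]
lemmas form1_outside = lin_on_outside[OF form1_lin_on]

lemma forms1_add: "\<alpha> \<in> forms1 A \<Longrightarrow> \<beta> \<in> forms1 A \<Longrightarrow> \<alpha> + \<beta> \<in> forms1 A"
proof (rule forms1I)
  fix p assume "\<alpha> \<in> forms1 A" "\<beta> \<in> forms1 A"
  then show "lin_on (tangent_space A p) ((\<alpha> + \<beta>) p)"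
    using lin_on_plus[OF form1_lin_on form1_lin_on] by (simp add: func_plus)
qed (simp add: cinf_add form1_cinf)

lemma forms1_scale: "f \<in> cinf A \<Longrightarrow> \<alpha> \<in> forms1 A \<Longrightarrow> scale1 f \<alpha> \<in> forms1 A"
  by (rule forms1I) (simp_all add: scale1_def lin_on_scale form1_lin_on cinf_mult form1_cinf)

lemma forms1_zero: "0 \<in> forms1 A"
  by (rule forms1I) (simp_all add: zero_fun_def lin_on_zero)

lemma forms1_minus: "\<alpha> \<in> forms1 A \<Longrightarrow> - \<alpha> \<in> forms1 A"
  using forms1_scale[OF cinf_const, of \<alpha> "-1"] by (simp add: scale1_def fun_Compl_def)

lemma d0_tangent: "v \<in> tangent_space A p \<Longrightarrow> d0 A f p v = v f"
  by (simp add: d0_def)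

lemma d0_form1: "f \<in> cinf A \<Longrightarrow> d0 A f \<in> forms1 A"
proof (rule forms1I)
  fix p
  show "lin_on (tangent_space A p) (d0 A f p)"
    by (rule lin_onI) (simp_all add: d0_def tangent_space_add tangent_space_cmult)
next
  fix X assume "f \<in> cinf A" "X \<in> vfields A"
  then show "(\<lambda>p. d0 A f p (X p)) \<in> cinf A"
    by (simp add: d0_tangent vfield_tangent vfield_cinf)
qed

lemma d0_vfield: "X \<in> vfields A \<Longrightarrow> d0 A f p (X p) = X p f"
  by (simp add: d0_tangent vfield_tangent)

lemma d0_add: "f \<in> cinf A \<Longrightarrow> g \<in> cinf A \<Longrightarrow> d0 A (\<lambda>p. f p + g p) = d0 A f + d0 A g"
  by (auto simp: fun_eq_iff d0_def tangent_add)

lemma d0_cmult: "f \<in> cinf A \<Longrightarrow> d0 A (\<lambda>p. c * f p) = scale1 (\<lambda>_. c) (d0 A f)"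
  by (auto simp: fun_eq_iff d0_def tangent_cmult scale1_def)

lemma d0_mult: "f \<in> cinf A \<Longrightarrow> g \<in> cinf A \<Longrightarrow>
    d0 A (\<lambda>p. f p * g p) = scale1 f (d0 A g) + scale1 g (d0 A f)"
  by (auto simp: fun_eq_iff d0_def tangent_mult scale1_def)

lemma d0_const: "d0 A (\<lambda>p. c) = 0"
  by (auto simp: fun_eq_iff d0_def tangent_const)


section \<open>Functionals linear over smooth functions, and extension from a point\<close>

definition tensorial :: "('a \<Rightarrow> 'b \<Rightarrow> real) set \<Rightarrow> 'a \<Rightarrow> (('a \<Rightarrow> 'b \<Rightarrow> real) \<Rightarrow> real) \<Rightarrow> bool" where
  "tensorial S p \<Phi> \<longleftrightarrow> (\<forall>s\<in>S. \<forall>t\<in>S. \<Phi> (s + t) = \<Phi> s + \<Phi> t) \<and>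
     (\<forall>f\<in>cinf A. \<forall>s\<in>S. \<Phi> (fscale f s) = f p * \<Phi> s)"

lemma tensorialI:
  "(\<And>s t. s \<in> S \<Longrightarrow> t \<in> S \<Longrightarrow> \<Phi> (s + t) = \<Phi> s + \<Phi> t) \<Longrightarrow>
    (\<And>f s. f \<in> cinf A \<Longrightarrow> s \<in> S \<Longrightarrow> \<Phi> (fscale f s) = f p * \<Phi> s) \<Longrightarrow> tensorial S p \<Phi>"
  by (simp add: tensorial_def)

lemma tensorialD:
  assumes "tensorial S p \<Phi>" "s \<in> S"
  shows "t \<in> S \<Longrightarrow> \<Phi> (s + t) = \<Phi> s + \<Phi> t" "f \<in> cinf A \<Longrightarrow> \<Phi> (fscale f s) = f p * \<Phi> s"
  using assms by (simp_all add: tensorial_def)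

text \<open>
  Multiplying by a bump function \<open>\<eta>\<close> turns the local expansion of a section \<open>r\<close> in a frame
  into a global identity, so that tensoriality can be exploited without germs.
\<close>
lemma tensorial_eqI:
  assumes \<Phi>: "tensorial S p \<Phi>"
    and S: "0 \<in> S" "\<And>s t. s \<in> S \<Longrightarrow> t \<in> S \<Longrightarrow> s + t \<in> S" "\<And>f s. f \<in> cinf A \<Longrightarrow> s \<in> S \<Longrightarrow> fscale f s \<in> S"
    and gen: "\<And>r. r \<in> S \<Longrightarrow> r p = 0 \<Longrightarrow> \<exists>(I :: (real ^ 'n) set) c g \<eta>. finite I \<and> \<eta> \<in> cinf A \<and> \<eta> p = 1 \<and>
      (\<forall>i\<in>I. c i \<in> cinf A \<and> g i \<in> S \<and> c i p = 0) \<and> fscale \<eta> r = (\<Sum>i\<in>I. fscale (c i) (g i))"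
    and s: "s \<in> S" and t: "t \<in> S" and eq: "s p = t p"
  shows "\<Phi> s = \<Phi> t"
proof -
  define r where "r = s + fscale (\<lambda>_. - 1) t"
  have t': "fscale (\<lambda>_. - 1) t \<in> S" by (rule S(3)[OF cinf_const t])
  have r: "r \<in> S" "r p = 0"
    using S(2)[OF s t'] eq by (auto simp: r_def fscale_apply fun_eq_iff)
  obtain I :: "(real ^ 'n) set" and c g \<eta> where I: "finite I" "\<eta> \<in> cinf A" "\<eta> p = 1"
    "\<forall>i\<in>I. c i \<in> cinf A \<and> g i \<in> S \<and> c i p = 0" "fscale \<eta> r = (\<Sum>i\<in>I. fscale (c i) (g i))"
    using gen[OF r] by auto
  have z: "\<Phi> 0 = 0"
    using tensorialD(1)[OF \<Phi> S(1) S(1)] by simp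
  \<comment> \<open>Membership in \<open>S\<close> is carried through the induction because
    \<open>\<Phi>\<close> is additive on \<open>S\<close> only.\<close>
  have "(\<Sum>i\<in>J. fscale (c i) (g i)) \<in> S \<and> \<Phi> (\<Sum>i\<in>J. fscale (c i) (g i)) = 0" if "J \<subseteq> I" for J
    using finite_subset[OF that I(1)] that
  proof (induction J rule: finite_induct)
    case (insert i J)
    then have i: "c i \<in> cinf A" "g i \<in> S" "c i p = 0" using I(4) by auto
    have J: "(\<Sum>i\<in>J. fscale (c i) (g i)) \<in> S" "\<Phi> (\<Sum>i\<in>J. fscale (c i) (g i)) = 0"
      using insert by auto
    let ?r = "fscale (c i) (g i) + (\<Sum>i\<in>J. fscale (c i) (g i))"
    have "?r \<in> S" "\<Phi> ?r = 0"
      using S(2)[OF S(3)[OF i(1,2)] J(1)] tensorialD(1)[OF \<Phi> S(3)[OF i(1,2)] J(1)]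
        tensorialD(2)[OF \<Phi> i(2) i(1)] i(3) J(2) by simp_all
    moreover have "(\<Sum>i\<in>insert i J. fscale (c i) (g i)) = ?r"
      by (rule sum.insert[OF insert(1,2)])
    ultimately show ?case by (simp only: simp_thms)
  qed (simp add: z S(1))
  then have "\<Phi> (fscale \<eta> r) = 0" using I(5) by simp
  then have "\<Phi> r = 0" using tensorialD(2)[OF \<Phi> r(1) I(2)] I(3) by simp
  then show ?thesis
    using tensorialD(1)[OF \<Phi> s t'] tensorialD(2)[OF \<Phi> t cinf_const] by (simp add: r_def)
qed

text \<open>The frame expands \<open>\<eta>\<close> times a vector field Z with the coefficients
  Z(x_i), and these vanish at \<open>p\<close> together with Z.\<close>

lemma tensorial_vfields_eqI:
  assumes \<Phi>: "tensorial (vfields A) p \<Phi>" and XY: "X \<in> vfields A" "Y \<in> vfields A" "X p = Y p"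
  shows "\<Phi> X = \<Phi> Y"
proof (rule tensorial_eqI[OF \<Phi> vfields_zero vfields_add vfields_scale _ XY])
  fix Z assume Z: "Z \<in> vfields A" "Z p = 0"
  obtain I :: "(real ^ 'n) set" and W \<eta> x e where fr: "finite I" "open W" "p \<in> W" "\<eta> \<in> cinf A"
    "\<And>q. q \<in> W \<Longrightarrow> \<eta> q = 1" "\<And>i. i \<in> I \<Longrightarrow> x i \<in> cinf A" "\<And>i. i \<in> I \<Longrightarrow> e i \<in> vfields A"
    "\<And>q v f. v \<in> tangent_space A q \<Longrightarrow> f \<in> cinf A \<Longrightarrow> \<eta> q * v f = (\<Sum>i\<in>I. v (x i) * e i q f)"
    by (rule frame[of p]) (rule that)
  have "fscale \<eta> Z = (\<Sum>i\<in>I. fscale (\<lambda>q. Z q (x i)) (e i))"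
    by (rule vfields_eqI)
      (use fr Z vfield_cinf vfield_tangent in
        \<open>auto intro!: vfields_scale vfields_sum simp: sum_fun_apply fscale_apply\<close>)
  then show "\<exists>(I :: (real ^ 'n) set) c g \<eta>. finite I \<and> \<eta> \<in> cinf A \<and> \<eta> p = 1 \<and>
      (\<forall>i\<in>I. c i \<in> cinf A \<and> g i \<in> vfields A \<and> c i p = 0) \<and> fscale \<eta> Z = (\<Sum>i\<in>I. fscale (c i) (g i))"
    using fr Z vfield_cinf
    by (intro exI[of _ I] exI[of _ "\<lambda>i q. Z q (x i)"] exI[of _ e] exI[of _ \<eta>]) auto
qed

text \<open>The dual of the expansion in \<open>frame\<close>, obtained by applying \<open>a\<close>
  to it. For \<open>v\<close> outside the tangent space both sides are 0 by the conventions of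
  \<open>lin_on\<close> and \<open>d0\<close>, so the identity is one of functions of
  \<open>v\<close>.\<close>

lemma form1_frame:
  assumes fr: "\<And>i. i \<in> I \<Longrightarrow> e i \<in> vfields A"
    "\<And>q v f. v \<in> tangent_space A q \<Longrightarrow> f \<in> cinf A \<Longrightarrow> \<eta> q * v f = (\<Sum>i\<in>I. v (x i) * e i q f)"
    and a: "a \<in> cotangent_space A q"
  shows "\<eta> q * a v = (\<Sum>i\<in>I. a (e i q) * d0 A (x i) q v)"
proof (cases "v \<in> tangent_space A q")
  case True
  have l: "lin_on (tangent_space A q) a" using a by (simp add: cotangent_space_def)
  have e: "(\<lambda>f. c * e i q f) \<in> tangent_space A q" if "i \<in> I" for i c
    by (rule tangent_space_cmult[OF vfield_tangent[OF fr(1)[OF that]]])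
  have "(\<lambda>f. \<eta> q * v f) = (\<Sum>i\<in>I. (\<lambda>f. v (x i) * e i q f))"
    by (rule tangent_eqI[of _ q])
      (use fr True e in \<open>auto intro!: tangent_space_cmult[OF True] tangent_space_sum simp: sum_fun_apply\<close>)
  then have "a (\<lambda>f. \<eta> q * v f) = (\<Sum>i\<in>I. a (\<lambda>f. v (x i) * e i q f))"
    using cotangent_sum[OF a e, of I] by simp
  also have "\<dots> = (\<Sum>i\<in>I. v (x i) * a (e i q))"
    by (rule sum.cong) (auto simp: lin_on_cmult[OF l] vfield_tangent fr)
  finally show ?thesis
    using True by (simp add: lin_on_cmult[OF l] d0_tangent mult.commute)
next
  case False
  then show ?thesis using a by (simp add: cotangent_space_def lin_on_outside d0_def)
qed

lemma tensorial_forms1_eqI: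
  assumes \<Phi>: "tensorial (forms1 A) p \<Phi>" and \<alpha>\<beta>: "\<alpha> \<in> forms1 A" "\<beta> \<in> forms1 A" "\<alpha> p = \<beta> p"
  shows "\<Phi> \<alpha> = \<Phi> \<beta>"
proof (rule tensorial_eqI[OF \<Phi> forms1_zero forms1_add forms1_scale[unfolded scale1_eq_fscale] _ \<alpha>\<beta>])
  fix \<gamma> assume \<gamma>: "\<gamma> \<in> forms1 A" "\<gamma> p = 0"
  obtain I :: "(real ^ 'n) set" and W \<eta> x e where fr: "finite I" "open W" "p \<in> W" "\<eta> \<in> cinf A"
    "\<And>q. q \<in> W \<Longrightarrow> \<eta> q = 1" "\<And>i. i \<in> I \<Longrightarrow> x i \<in> cinf A" "\<And>i. i \<in> I \<Longrightarrow> e i \<in> vfields A"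
    "\<And>q v f. v \<in> tangent_space A q \<Longrightarrow> f \<in> cinf A \<Longrightarrow> \<eta> q * v f = (\<Sum>i\<in>I. v (x i) * e i q f)"
    by (rule frame[of p]) (rule that)
  have "fscale \<eta> \<gamma> = (\<Sum>i\<in>I. fscale (\<lambda>q. \<gamma> q (e i q)) (d0 A (x i)))"
    by (intro ext) (simp add: sum_fun_apply fscale_apply form1_frame[OF fr(7,8) form1_cotangent[OF \<gamma>(1)]])
  then show "\<exists>(I :: (real ^ 'n) set) c g \<eta>. finite I \<and> \<eta> \<in> cinf A \<and> \<eta> p = 1 \<and>
      (\<forall>i\<in>I. c i \<in> cinf A \<and> g i \<in> forms1 A \<and> c i p = 0) \<and> fscale \<eta> \<gamma> = (\<Sum>i\<in>I. fscale (c i) (g i))"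
    using fr \<gamma> form1_cinf d0_form1
    by (intro exI[of _ I] exI[of _ "\<lambda>i q. \<gamma> q (e i q)"] exI[of _ "\<lambda>i. d0 A (x i)"] exI[of _ \<eta>]) auto
qed

text \<open>At \<open>p\<close>, where \<open>\<eta>\<close> is 1, the frame recovers
  \<open>v\<close> from the constant coefficients v(x_i).\<close>

lemma vfield_extension:
  assumes v: "v \<in> tangent_space A p"
  obtains X where "X \<in> vfields A" "X p = v"
proof -
  obtain I :: "(real ^ 'n) set" and W \<eta> x e where fr: "finite I" "open W" "p \<in> W" "\<eta> \<in> cinf A"
    "\<And>q. q \<in> W \<Longrightarrow> \<eta> q = 1" "\<And>i. i \<in> I \<Longrightarrow> x i \<in> cinf A" "\<And>i. i \<in> I \<Longrightarrow> e i \<in> vfields A"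
    "\<And>q v f. v \<in> tangent_space A q \<Longrightarrow> f \<in> cinf A \<Longrightarrow> \<eta> q * v f = (\<Sum>i\<in>I. v (x i) * e i q f)"
    by (rule frame[of p]) (rule that)
  let ?X = "\<Sum>i\<in>I. fscale (\<lambda>_. v (x i)) (e i)"
  have X: "?X \<in> vfields A"
    by (intro vfields_sum vfields_scale cinf_const fr)
  have "?X p = v"
    by (rule tangent_eqI[OF vfield_tangent[OF X] v])
      (use fr(3,5) fr(8)[OF v] in \<open>simp add: sum_fun_apply fscale_apply\<close>)
  then show ?thesis using that X by blast
qed

text \<open>The witness combines the coordinate functions with the constant coefficients a(e_i);
  \<open>form1_frame\<close> at \<open>p\<close> identifies its differential.\<close>

lemma covector_exact:
  assumes a: "a \<in> cotangent_space A p"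
  obtains f where "f \<in> cinf A" "d0 A f p = a"
proof -
  obtain I :: "(real ^ 'n) set" and W \<eta> x e where fr: "finite I" "open W" "p \<in> W" "\<eta> \<in> cinf A"
    "\<And>q. q \<in> W \<Longrightarrow> \<eta> q = 1" "\<And>i. i \<in> I \<Longrightarrow> x i \<in> cinf A" "\<And>i. i \<in> I \<Longrightarrow> e i \<in> vfields A"
    "\<And>q v f. v \<in> tangent_space A q \<Longrightarrow> f \<in> cinf A \<Longrightarrow> \<eta> q * v f = (\<Sum>i\<in>I. v (x i) * e i q f)"
    by (rule frame[of p]) (rule that)
  let ?f = "\<lambda>q. \<Sum>i\<in>I. a (e i p) * x i q"
  have f: "?f \<in> cinf A" by (intro cinf_intros fr)
  have "d0 A ?f p v = a v" for v
  proof (cases "v \<in> tangent_space A p")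
    case True
    have "v ?f = (\<Sum>i\<in>I. a (e i p) * v (x i))"
      using tangent_sum[OF True, of I "\<lambda>i q. a (e i p) * x i q"] fr(6)
      by (simp add: tangent_cmult[OF True] cinf_mult)
    moreover have "1 * a v = (\<Sum>i\<in>I. a (e i p) * v (x i))"
      using form1_frame[OF fr(7,8) a, where v = v] unfolding fr(5)[OF fr(3)] d0_tangent[OF True] .
    ultimately show ?thesis unfolding d0_tangent[OF True] by (simp only: mult_1)
  next
    case False
    then show ?thesis using a by (simp add: cotangent_space_def lin_on_outside d0_def)
  qed
  then show ?thesis using that f by blast
qed

text \<open>At \<open>p\<close> every 1-form agrees with an exact one, and a tensorial functional
  sees no more than that value.\<close>

lemma tensorial_forms1_zeroI:
  assumes \<Phi>: "tensorial (forms1 A) p \<Phi>" and \<alpha>: "\<alpha> \<in> forms1 A"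
    and exact: "\<And>f. f \<in> cinf A \<Longrightarrow> \<Phi> (d0 A f) = 0"
  shows "\<Phi> \<alpha> = 0"
proof -
  obtain f where f: "f \<in> cinf A" "d0 A f p = \<alpha> p"
    by (rule covector_exact[OF form1_cotangent[OF \<alpha>]])
  show ?thesis
    using tensorial_forms1_eqI[OF \<Phi> \<alpha> d0_form1[OF f(1)]] f exact by simp
qed

lemma forms1_eqI:
  assumes "\<alpha> \<in> forms1 A" "\<beta> \<in> forms1 A" "\<And>X p. X \<in> vfields A \<Longrightarrow> \<alpha> p (X p) = \<beta> p (X p)"
  shows "\<alpha> = \<beta>"
proof (intro ext)
  fix p v
  show "\<alpha> p v = \<beta> p v"
  proof (cases "v \<in> tangent_space A p")
    case True
    then obtain X where "X \<in> vfields A" "X p = v" by (rule vfield_extension)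
    then show ?thesis using assms(3)[of X p] by simp
  qed (use assms in \<open>simp add: form1_outside\<close>)
qed

text \<open>The covector at \<open>p\<close> is evaluated on \<open>v\<close> by extending
  \<open>v\<close> to a vector field \<open>E p v\<close>; tensoriality makes the result independent
  of the extension. Outside the tangent space the value is 0, as \<open>lin_on\<close>
  demands.\<close>

lemma form1_construct:
  fixes \<Phi> :: "'a vfield \<Rightarrow> 'a \<Rightarrow> real"
  assumes \<Phi>: "\<And>X. X \<in> vfields A \<Longrightarrow> \<Phi> X \<in> cinf A" "\<And>p. tensorial (vfields A) p (\<lambda>X. \<Phi> X p)"
  shows "\<exists>\<alpha>. \<alpha> \<in> forms1 A \<and> (\<forall>X\<in>vfields A. \<forall>p. \<alpha> p (X p) = \<Phi> X p)"
proof -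
  define E where "E p v = (SOME X. X \<in> vfields A \<and> X p = v)" for p v
  have "E p v \<in> vfields A \<and> E p v p = v" if v: "v \<in> tangent_space A p" for p v
  proof -
    have "\<exists>X. X \<in> vfields A \<and> X p = v" by (rule vfield_extension[OF v]) blast
    then show ?thesis unfolding E_def by (rule someI_ex)
  qed
  then have E: "E p v \<in> vfields A" "E p v p = v" if "v \<in> tangent_space A p" for p v
    using that by simp_all
  define \<alpha> where "\<alpha> p v = (if v \<in> tangent_space A p then \<Phi> (E p v) p else 0)" for p v
  have ap: "\<alpha> p (X p) = \<Phi> X p" if "X \<in> vfields A" for X p
    unfolding \<alpha>_def
    using tensorial_vfields_eqI[OF \<Phi>(2)[of p] E(1) that] vfield_tangent[OF that] E(2) by simp
  have "\<alpha> \<in> forms1 A"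
  proof (rule forms1I)
    fix p
    show "lin_on (tangent_space A p) (\<alpha> p)"
    proof (rule lin_onI)
      fix u v assume u: "u \<in> tangent_space A p" and v: "v \<in> tangent_space A p"
      have XY: "E p u \<in> vfields A" "E p u p = u" "E p v \<in> vfields A" "E p v p = v"
        by (rule E[OF u] E[OF v])+
      show "\<alpha> p (u + v) = \<alpha> p u + \<alpha> p v"
        using ap[OF vfields_add[OF XY(1,3)], of p] ap[OF XY(1), of p] ap[OF XY(3), of p]
          tensorialD(1)[OF \<Phi>(2) XY(1,3), of p] XY(2,4) by simp
    next
      fix c v assume "v \<in> tangent_space A p"
      then obtain X where X: "X \<in> vfields A" "X p = v" by (rule vfield_extension)
      show "\<alpha> p (\<lambda>f. c * v f) = c * \<alpha> p v"
        using ap[OF vfields_scale[OF cinf_const X(1)], of p c] ap[OF X(1), of p]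
          tensorialD(2)[OF \<Phi>(2) X(1) cinf_const, of c p] X(2) by (simp add: fscale_apply)
    qed (simp add: \<alpha>_def)
  qed (simp add: ap \<Phi>(1))
  then show ?thesis by (intro exI[of _ \<alpha>] conjI ballI allI ap)
qed

section \<open>2-forms and the exterior derivative\<close>

lemma form2_lin_on:
  assumes "\<sigma> \<in> forms2 A"
  shows "lin_on (tangent_space A p) (\<sigma> p v)" "lin_on (tangent_space A p) (\<lambda>v. \<sigma> p v w)"
  using assms[unfolded forms2_def mem_Collect_eq, THEN conjunct1]
    assms[unfolded forms2_def mem_Collect_eq, THEN conjunct2, THEN conjunct1] by simp_all

lemma form2_antisym: "\<sigma> \<in> forms2 A \<Longrightarrow> \<sigma> p v w = - \<sigma> p w v"
  unfolding forms2_def mem_Collect_eq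
  by (drule conjunct2, drule conjunct2, drule conjunct1) (erule allE)+

lemma form2_cinf: "\<sigma> \<in> forms2 A \<Longrightarrow> X \<in> vfields A \<Longrightarrow> Y \<in> vfields A \<Longrightarrow> (\<lambda>p. \<sigma> p (X p) (Y p)) \<in> cinf A"
  unfolding forms2_def mem_Collect_eq by (drule conjunct2, drule conjunct2, drule conjunct2) simp

text \<open>Antisymmetry transfers linearity from the second slot to the first.\<close>

lemma forms2I:
  assumes "\<And>p v. lin_on (tangent_space A p) (\<sigma> p v)" "\<And>p v w. \<sigma> p v w = - \<sigma> p w v"
    "\<And>X Y. X \<in> vfields A \<Longrightarrow> Y \<in> vfields A \<Longrightarrow> (\<lambda>p. \<sigma> p (X p) (Y p)) \<in> cinf A"
  shows "\<sigma> \<in> forms2 A"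
proof -
  have "(\<lambda>v. \<sigma> p v w) = (\<lambda>v. - 1 * \<sigma> p w v)" for p w
    by (rule ext, subst assms(2)) simp
  then have "lin_on (tangent_space A p) (\<lambda>v. \<sigma> p v w)" for p w
    using lin_on_scale[OF assms(1), of p "-1" w] by simp
  then show ?thesis
    unfolding forms2_def mem_Collect_eq by (intro conjI allI ballI assms)
qed

lemma form2_add:
  assumes "\<sigma> \<in> forms2 A" "u \<in> tangent_space A p" "v \<in> tangent_space A p"
  shows "\<sigma> p (u + v) w = \<sigma> p u w + \<sigma> p v w" "\<sigma> p w (u + v) = \<sigma> p w u + \<sigma> p w v"
  by (rule lin_on_add[OF form2_lin_on(2)[OF assms(1)] assms(2,3)],
      rule lin_on_add[OF form2_lin_on(1)[OF assms(1)] assms(2,3)])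

lemma form2_cmult:
  assumes "\<sigma> \<in> forms2 A" "v \<in> tangent_space A p"
  shows "\<sigma> p (\<lambda>f. c * v f) w = c * \<sigma> p v w" "\<sigma> p w (\<lambda>f. c * v f) = c * \<sigma> p w v"
  by (rule lin_on_cmult[OF form2_lin_on(2)[OF assms(1)] assms(2)],
      rule lin_on_cmult[OF form2_lin_on(1)[OF assms(1)] assms(2)])

lemma form2_outside:
  assumes "\<sigma> \<in> forms2 A" "v \<notin> tangent_space A p"
  shows "\<sigma> p v w = 0" "\<sigma> p w v = 0"
  by (rule lin_on_outside[OF form2_lin_on(2)[OF assms(1)] assms(2)],
      rule lin_on_outside[OF form2_lin_on(1)[OF assms(1)] assms(2)])

lemma forms2_add:
  assumes "\<sigma> \<in> forms2 A" "\<tau> \<in> forms2 A"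
  shows "\<sigma> + \<tau> \<in> forms2 A"
proof (rule forms2I)
  show "lin_on (tangent_space A p) ((\<sigma> + \<tau>) p v)" for p v
    using lin_on_plus[OF form2_lin_on(1)[OF assms(1)] form2_lin_on(1)[OF assms(2)]] by (simp add: func_plus)
  show "(\<sigma> + \<tau>) p v w = - (\<sigma> + \<tau>) p w v" for p v w
    using form2_antisym[OF assms(1), of p v w] form2_antisym[OF assms(2), of p v w] by simp
qed (use assms in \<open>simp add: cinf_add form2_cinf\<close>)

lemma forms2_scale:
  assumes "f \<in> cinf A" "\<sigma> \<in> forms2 A"
  shows "scale2 f \<sigma> \<in> forms2 A"
proof (rule forms2I)
  show "lin_on (tangent_space A p) (scale2 f \<sigma> p v)" for p v
    by (simp add: scale2_def lin_on_scale form2_lin_on(1)[OF assms(2)])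
  show "scale2 f \<sigma> p v w = - scale2 f \<sigma> p w v" for p v w
    using form2_antisym[OF assms(2), of p v w] by (simp add: scale2_def)
qed (use assms in \<open>simp add: scale2_def cinf_mult form2_cinf\<close>)

lemma forms2_diff:
  assumes "\<sigma> \<in> forms2 A" "\<tau> \<in> forms2 A"
  shows "\<sigma> - \<tau> \<in> forms2 A"
proof -
  have "\<sigma> - \<tau> = \<sigma> + scale2 (\<lambda>_. - 1) \<tau>" by (simp add: fun_eq_iff scale2_def)
  then show ?thesis by (simp only: forms2_add[OF assms(1) forms2_scale[OF cinf_const assms(2)]])
qed

lemma forms2_zero: "0 \<in> forms2 A"
  by (rule forms2I) (simp_all add: zero_fun_def lin_on_zero)

lemma wedge_form2:
  assumes "\<alpha> \<in> forms1 A" "\<beta> \<in> forms1 A"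
  shows "wedge \<alpha> \<beta> \<in> forms2 A"
proof (rule forms2I)
  show "lin_on (tangent_space A p) (wedge \<alpha> \<beta> p v)" for p v
    by (rule lin_onI)
      (simp_all add: wedge_def assms[THEN form1_add] assms[THEN form1_cmult] assms[THEN form1_outside]
        algebra_simps)
  show "(\<lambda>p. wedge \<alpha> \<beta> p (X p) (Y p)) \<in> cinf A" if "X \<in> vfields A" "Y \<in> vfields A" for X Y
    unfolding wedge_def by (intro cinf_diff cinf_mult assms[THEN form1_cinf] that)
qed (simp add: wedge_def)

lemma forms2_eqI:
  assumes "\<sigma> \<in> forms2 A" "\<tau> \<in> forms2 A"
    "\<And>X Y p. X \<in> vfields A \<Longrightarrow> Y \<in> vfields A \<Longrightarrow> \<sigma> p (X p) (Y p) = \<tau> p (X p) (Y p)"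
  shows "\<sigma> = \<tau>"
proof (intro ext)
  fix p v w
  show "\<sigma> p v w = \<tau> p v w"
  proof (cases "v \<in> tangent_space A p \<and> w \<in> tangent_space A p")
    case True
    then have v: "v \<in> tangent_space A p" and w: "w \<in> tangent_space A p" by auto
    obtain X where "X \<in> vfields A" "X p = v" by (rule vfield_extension[OF v])
    moreover obtain Y where "Y \<in> vfields A" "Y p = w" by (rule vfield_extension[OF w])
    ultimately show ?thesis using assms(3)[of X Y p] by simp
  qed (use form2_outside[OF assms(1), of _ p] form2_outside[OF assms(2), of _ p] in auto)
qed

text \<open>Tensoriality is assumed in the second slot and reaches the first through
  \<open>anti\<close>. The conclusion includes uniqueness because \<open>d1\<close> and
  \<open>conn_form2\<close> are definite descriptions.\<close>

lemma form2_construct: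
  fixes \<Phi> :: "'a vfield \<Rightarrow> 'a vfield \<Rightarrow> 'a \<Rightarrow> real"
  assumes \<Phi>: "\<And>X Y. X \<in> vfields A \<Longrightarrow> Y \<in> vfields A \<Longrightarrow> \<Phi> X Y \<in> cinf A"
    "\<And>X p. X \<in> vfields A \<Longrightarrow> tensorial (vfields A) p (\<lambda>Y. \<Phi> X Y p)"
    and anti: "\<And>X Y p. X \<in> vfields A \<Longrightarrow> Y \<in> vfields A \<Longrightarrow> \<Phi> X Y p = - \<Phi> Y X p"
  shows "\<exists>!\<sigma>. \<sigma> \<in> forms2 A \<and> (\<forall>X\<in>vfields A. \<forall>Y\<in>vfields A. \<forall>p. \<sigma> p (X p) (Y p) = \<Phi> X Y p)"
proof -
  define E where "E p v = (SOME X. X \<in> vfields A \<and> X p = v)" for p v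
  have "E p v \<in> vfields A \<and> E p v p = v" if v: "v \<in> tangent_space A p" for p v
  proof -
    have "\<exists>X. X \<in> vfields A \<and> X p = v" by (rule vfield_extension[OF v]) blast
    then show ?thesis unfolding E_def by (rule someI_ex)
  qed
  then have E: "E p v \<in> vfields A" "E p v p = v" if "v \<in> tangent_space A p" for p v
    using that by simp_all
  define \<sigma> where "\<sigma> p v w = (if v \<in> tangent_space A p \<and> w \<in> tangent_space A p
      then \<Phi> (E p v) (E p w) p else 0)" for p v w
  have \<sigma>: "\<sigma> p (X p) (Y p) = \<Phi> X Y p" if XY: "X \<in> vfields A" "Y \<in> vfields A" for X Y p
  proof -
    let ?X = "E p (X p)" and ?Y = "E p (Y p)"
    have E': "?X \<in> vfields A" "?X p = X p" "?Y \<in> vfields A" "?Y p = Y p"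
      using E vfield_tangent[OF XY(1)] vfield_tangent[OF XY(2)] by blast+
    have "\<Phi> ?X ?Y p = \<Phi> ?X Y p"
      by (rule tensorial_vfields_eqI[OF \<Phi>(2)[OF E'(1)] E'(3) XY(2) E'(4)])
    also have "\<dots> = - \<Phi> Y ?X p"
      by (rule anti[OF E'(1) XY(2)])
    also have "\<Phi> Y ?X p = \<Phi> Y X p"
      by (rule tensorial_vfields_eqI[OF \<Phi>(2)[OF XY(2)] E'(1) XY(1) E'(2)])
    also have "- \<dots> = \<Phi> X Y p"
      using anti[OF XY] by simp
    finally show ?thesis by (simp add: \<sigma>_def vfield_tangent XY)
  qed
  have \<sigma>2: "\<sigma> \<in> forms2 A"
  proof (rule forms2I)
    fix p v
    show "lin_on (tangent_space A p) (\<sigma> p v)"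
    proof (cases "v \<in> tangent_space A p")
      case True
      then obtain X where X: "X \<in> vfields A" "X p = v" by (rule vfield_extension)
      show ?thesis
      proof (rule lin_onI)
        fix u w assume u: "u \<in> tangent_space A p" and w: "w \<in> tangent_space A p"
        have YZ: "E p u \<in> vfields A" "E p u p = u" "E p w \<in> vfields A" "E p w p = w"
          by (rule E[OF u] E[OF w])+
        show "\<sigma> p v (u + w) = \<sigma> p v u + \<sigma> p v w"
          using \<sigma>[OF X(1) vfields_add[OF YZ(1,3)], of p] \<sigma>[OF X(1) YZ(1), of p] \<sigma>[OF X(1) YZ(3), of p]
            tensorialD(1)[OF \<Phi>(2)[OF X(1)] YZ(1,3), of p] YZ(2,4) X(2) by simp
      next
        fix c w assume "w \<in> tangent_space A p"
        then obtain Y where Y: "Y \<in> vfields A" "Y p = w" by (rule vfield_extension)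
        show "\<sigma> p v (\<lambda>f. c * w f) = c * \<sigma> p v w"
          using \<sigma>[OF X(1) vfields_scale[OF cinf_const Y(1)], of p c] \<sigma>[OF X(1) Y(1), of p]
            tensorialD(2)[OF \<Phi>(2)[OF X(1)] Y(1) cinf_const, of c p] Y(2) X(2) by (simp add: fscale_apply)
      qed (simp add: \<sigma>_def)
    qed (simp add: \<sigma>_def lin_on_def)
    fix w
    show "\<sigma> p v w = - \<sigma> p w v"
    proof (cases "v \<in> tangent_space A p \<and> w \<in> tangent_space A p")
      case True
      then have v: "v \<in> tangent_space A p" and w: "w \<in> tangent_space A p" by auto
      show ?thesis
        using anti[OF E(1)[OF v] E(1)[OF w], of p] v w by (simp add: \<sigma>_def)
    qed (auto simp: \<sigma>_def)
  qed (simp add: \<sigma> \<Phi>(1))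
  show ?thesis
  proof (rule ex1I[of _ \<sigma>])
    fix \<tau> assume \<tau>: "\<tau> \<in> forms2 A \<and> (\<forall>X\<in>vfields A. \<forall>Y\<in>vfields A. \<forall>p. \<tau> p (X p) (Y p) = \<Phi> X Y p)"
    show "\<tau> = \<sigma>"
      by (rule forms2_eqI) (use \<tau> \<sigma>2 \<sigma> in simp_all)
  qed (simp add: \<sigma>2 \<sigma>)
qed


lemma lie_bracket_vfield:
  assumes X: "X \<in> vfields A" and Y: "Y \<in> vfields A"
  shows "lie_bracket X Y \<in> vfields A"
proof (rule vfieldsI)
  note t = vfield_tangent[OF X] vfield_tangent[OF Y]
  note c = vfield_cinf[OF X] vfield_cinf[OF Y]
  show "lie_bracket X Y p \<in> tangent_space A p" for p
    by (rule tangentI)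
      (simp_all add: lie_bracket_def t[THEN tangent_add] t[THEN tangent_mult] t[THEN tangent_cmult]
        t[THEN tangent_outside] t[THEN tangent_const] c cinf_mult cinf_add algebra_simps)
  show "(\<lambda>p. lie_bracket X Y p f) \<in> cinf A" if "f \<in> cinf A" for f
    unfolding lie_bracket_def by (intro cinf_diff c that)
qed

lemma lie_bracket_add:
  assumes "X \<in> vfields A" "Y \<in> vfields A" "Z \<in> vfields A"
  shows "lie_bracket X (Y + Z) = lie_bracket X Y + lie_bracket X Z"
proof (rule vfields_eqI)
  fix p f assume f: "f \<in> cinf A"
  show "lie_bracket X (Y + Z) p f = (lie_bracket X Y + lie_bracket X Z) p f"
    using tangent_add[OF vfield_tangent[OF assms(1)] vfield_cinf[OF assms(2) f] vfield_cinf[OF assms(3) f]]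
    by (simp add: lie_bracket_def)
qed (intro vfields_add lie_bracket_vfield assms)+

lemma lie_bracket_scale:
  assumes "X \<in> vfields A" "Y \<in> vfields A" "h \<in> cinf A"
  shows "lie_bracket X (fscale h Y) = fscale h (lie_bracket X Y) + fscale (\<lambda>p. X p h) Y"
proof (rule vfields_eqI)
  fix p f assume f: "f \<in> cinf A"
  show "lie_bracket X (fscale h Y) p f = (fscale h (lie_bracket X Y) + fscale (\<lambda>p. X p h) Y) p f"
    using tangent_mult[OF vfield_tangent[OF assms(1)] assms(3) vfield_cinf[OF assms(2) f]]
    by (simp add: lie_bracket_def fscale_def algebra_simps)
qed (intro vfields_add vfields_scale lie_bracket_vfield vfield_cinf[OF assms(1)] assms)+

lemma form1_vadd: "\<alpha> \<in> forms1 A \<Longrightarrow> X \<in> vfields A \<Longrightarrow> Y \<in> vfields A \<Longrightarrow>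
    \<alpha> p ((X + Y) p) = \<alpha> p (X p) + \<alpha> p (Y p)"
  by (simp add: form1_add vfield_tangent)

lemma form1_vscale: "\<alpha> \<in> forms1 A \<Longrightarrow> X \<in> vfields A \<Longrightarrow> \<alpha> p (fscale f X p) = f p * \<alpha> p (X p)"
  by (simp add: form1_cmult vfield_tangent fscale_apply)

text \<open>The defining expression is linear over functions in Y: X(f \<alpha>(Y)) contributes X(f)
  \<alpha>(Y), and \<alpha>([X, f Y]), which is subtracted, contributes the same term.\<close>

lemma d1_unique:
  assumes \<alpha>: "\<alpha> \<in> forms1 A"
  shows "\<exists>!\<sigma>. \<sigma> \<in> forms2 A \<and> (\<forall>X\<in>vfields A. \<forall>Y\<in>vfields A. \<forall>p. \<sigma> p (X p) (Y p) =
    X p (\<lambda>q. \<alpha> q (Y q)) - Y p (\<lambda>q. \<alpha> q (X q)) - \<alpha> p (lie_bracket X Y p))"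
proof (rule form2_construct)
  fix X Y assume X: "X \<in> vfields A" and Y: "Y \<in> vfields A"
  show "(\<lambda>p. X p (\<lambda>q. \<alpha> q (Y q)) - Y p (\<lambda>q. \<alpha> q (X q)) - \<alpha> p (lie_bracket X Y p)) \<in> cinf A"
    by (intro cinf_diff vfield_cinf[OF X] vfield_cinf[OF Y] form1_cinf[OF \<alpha>] lie_bracket_vfield X Y)
  fix p
  have "lie_bracket X Y p = (\<lambda>f. - 1 * lie_bracket Y X p f)"
    by (simp add: lie_bracket_def)
  then show "X p (\<lambda>q. \<alpha> q (Y q)) - Y p (\<lambda>q. \<alpha> q (X q)) - \<alpha> p (lie_bracket X Y p) =
    - (Y p (\<lambda>q. \<alpha> q (X q)) - X p (\<lambda>q. \<alpha> q (Y q)) - \<alpha> p (lie_bracket Y X p))"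
    using form1_cmult[OF \<alpha> vfield_tangent[OF lie_bracket_vfield[OF Y X]], of p "-1"] by simp
next
  fix X p assume X: "X \<in> vfields A"
  show "tensorial (vfields A) p (\<lambda>Y. X p (\<lambda>q. \<alpha> q (Y q)) - Y p (\<lambda>q. \<alpha> q (X q)) - \<alpha> p (lie_bracket X Y p))"
  proof (rule tensorialI)
    fix Y Z assume Y: "Y \<in> vfields A" and Z: "Z \<in> vfields A"
    show "X p (\<lambda>q. \<alpha> q ((Y + Z) q)) - (Y + Z) p (\<lambda>q. \<alpha> q (X q)) - \<alpha> p (lie_bracket X (Y + Z) p) =
      X p (\<lambda>q. \<alpha> q (Y q)) - Y p (\<lambda>q. \<alpha> q (X q)) - \<alpha> p (lie_bracket X Y p) +
      (X p (\<lambda>q. \<alpha> q (Z q)) - Z p (\<lambda>q. \<alpha> q (X q)) - \<alpha> p (lie_bracket X Z p))"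
      using tangent_add[OF vfield_tangent[OF X] form1_cinf[OF \<alpha> Y] form1_cinf[OF \<alpha> Z]]
      by (simp add: form1_vadd[OF \<alpha> Y Z] form1_vadd[OF \<alpha>] lie_bracket_add[OF X Y Z] lie_bracket_vfield X Y Z
          form1_add[OF \<alpha>] vfield_tangent)
  next
    fix f Y assume f: "f \<in> cinf A" and Y: "Y \<in> vfields A"
    have "\<alpha> p (lie_bracket X (fscale f Y) p) = f p * \<alpha> p (lie_bracket X Y p) + X p f * \<alpha> p (Y p)"
      unfolding lie_bracket_scale[OF X Y f]
      by (simp only: form1_vadd[OF \<alpha> vfields_scale[OF f lie_bracket_vfield[OF X Y]]
            vfields_scale[OF vfield_cinf[OF X f] Y]]
          form1_vscale[OF \<alpha> lie_bracket_vfield[OF X Y]] form1_vscale[OF \<alpha> Y])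
    then show "X p (\<lambda>q. \<alpha> q (fscale f Y q)) - fscale f Y p (\<lambda>q. \<alpha> q (X q)) - \<alpha> p (lie_bracket X (fscale f Y) p) =
      f p * (X p (\<lambda>q. \<alpha> q (Y q)) - Y p (\<lambda>q. \<alpha> q (X q)) - \<alpha> p (lie_bracket X Y p))"
      using tangent_mult[OF vfield_tangent[OF X] f form1_cinf[OF \<alpha> Y]]
      by (simp add: form1_vscale[OF \<alpha> Y]) (simp add: fscale_apply algebra_simps)
  qed
qed

lemma d1_form2: "\<alpha> \<in> forms1 A \<Longrightarrow> d1 A \<alpha> \<in> forms2 A"
  unfolding d1_def by (rule theI'[OF d1_unique, THEN conjunct1])

lemma d1_apply:
  assumes "\<alpha> \<in> forms1 A" "X \<in> vfields A" "Y \<in> vfields A"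
  shows "d1 A \<alpha> p (X p) (Y p) = X p (\<lambda>q. \<alpha> q (Y q)) - Y p (\<lambda>q. \<alpha> q (X q)) - \<alpha> p (lie_bracket X Y p)"
  unfolding d1_def by (rule theI'[OF d1_unique[OF assms(1)], THEN conjunct2, rule_format, OF assms(2,3)])

lemma d1_add:
  assumes "\<alpha> \<in> forms1 A" "\<beta> \<in> forms1 A"
  shows "d1 A (\<alpha> + \<beta>) = d1 A \<alpha> + d1 A \<beta>"
proof (rule forms2_eqI)
  fix X Y p assume XY: "X \<in> vfields A" "Y \<in> vfields A"
  show "d1 A (\<alpha> + \<beta>) p (X p) (Y p) = (d1 A \<alpha> + d1 A \<beta>) p (X p) (Y p)"
    using tangent_add[OF vfield_tangent[OF XY(1)] form1_cinf[OF assms(1) XY(2)] form1_cinf[OF assms(2) XY(2)]]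
      tangent_add[OF vfield_tangent[OF XY(2)] form1_cinf[OF assms(1) XY(1)] form1_cinf[OF assms(2) XY(1)]]
    by (simp add: d1_apply[OF _ XY] assms forms1_add)
qed (intro forms2_add d1_form2 forms1_add assms)+

lemma d1_scale:
  assumes "f \<in> cinf A" "\<alpha> \<in> forms1 A"
  shows "d1 A (scale1 f \<alpha>) = scale2 f (d1 A \<alpha>) + wedge (d0 A f) \<alpha>"
proof (rule forms2_eqI)
  fix X Y p assume XY: "X \<in> vfields A" "Y \<in> vfields A"
  show "d1 A (scale1 f \<alpha>) p (X p) (Y p) = (scale2 f (d1 A \<alpha>) + wedge (d0 A f) \<alpha>) p (X p) (Y p)"
    using tangent_mult[OF vfield_tangent[OF XY(1)] assms(1) form1_cinf[OF assms(2) XY(2)]]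
      tangent_mult[OF vfield_tangent[OF XY(2)] assms(1) form1_cinf[OF assms(2) XY(1)]]
    by (simp add: d1_apply[OF _ XY] assms forms1_scale wedge_def d0_vfield XY)
      (simp add: scale1_def scale2_def d1_apply[OF _ XY] assms algebra_simps)
qed (intro forms2_add forms2_scale wedge_form2 d1_form2 forms1_scale d0_form1 assms)+

lemma d1_d0:
  assumes f: "f \<in> cinf A"
  shows "d1 A (d0 A f) = 0"
proof (rule forms2_eqI)
  fix X Y p assume XY: "X \<in> vfields A" "Y \<in> vfields A"
  show "d1 A (d0 A f) p (X p) (Y p) = 0 p (X p) (Y p)"
    using XY lie_bracket_vfield[OF XY]
    by (simp add: d1_apply[OF d0_form1[OF f] XY] d0_vfield) (simp add: lie_bracket_def)
qed (intro d1_form2 d0_form1 forms2_zero f)+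

end

context smooth_manifold
begin

text \<open>Meant for the difference of two operations that are not tensorial themselves but have
  the same Leibniz defect. Antisymmetry makes tensoriality in one slot enough: reduce the second
  argument to an exact form, swap, and reduce again.\<close>

lemma tensorial2_zeroI:
  assumes tens: "\<And>\<alpha>. \<alpha> \<in> forms1 A \<Longrightarrow> tensorial (forms1 A) p (\<Psi> \<alpha>)"
    and anti: "\<And>\<alpha> \<beta>. \<alpha> \<in> forms1 A \<Longrightarrow> \<beta> \<in> forms1 A \<Longrightarrow> \<Psi> \<alpha> \<beta> = - \<Psi> \<beta> \<alpha>"
    and exact: "\<And>f g. f \<in> cinf A \<Longrightarrow> g \<in> cinf A \<Longrightarrow> \<Psi> (d0 A f) (d0 A g) = 0"
    and \<alpha>: "\<alpha> \<in> forms1 A" and \<beta>: "\<beta> \<in> forms1 A"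
  shows "\<Psi> \<alpha> \<beta> = 0"
proof (rule tensorial_forms1_zeroI[OF tens[OF \<alpha>] \<beta>])
  fix g assume g: "g \<in> cinf A"
  have "\<Psi> (d0 A g) \<alpha> = 0"
    by (rule tensorial_forms1_zeroI[OF tens[OF d0_form1[OF g]] \<alpha>]) (rule exact[OF g])
  then show "\<Psi> \<alpha> (d0 A g) = 0"
    using anti[OF \<alpha> d0_form1[OF g]] by linarith
qed

end

section \<open>The Koszul bracket\<close>

locale poisson =
  fixes A :: "('a::{t2_space,second_countable_topology}, 'n::finite) chart set"
    and \<pi> :: "'a bivector"
  assumes poisson: "poisson_manifold A \<pi>"

sublocale poisson \<subseteq> smooth_manifold A
  using poisson by unfold_locales (simp add: poisson_manifold_def)

context poisson
begin

lemma \<pi>_lin_on: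
  "lin_on (cotangent_space A p) (\<pi> p a)" "lin_on (cotangent_space A p) (\<lambda>a. \<pi> p a b)"
proof -
  have "\<pi> \<in> bivectors A" using poisson by (simp add: poisson_manifold_def)
  note * = this[unfolded bivectors_def mem_Collect_eq]
  show "lin_on (cotangent_space A p) (\<pi> p a)" "lin_on (cotangent_space A p) (\<lambda>a. \<pi> p a b)"
    using *[THEN conjunct1] *[THEN conjunct2, THEN conjunct1] by simp_all
qed

lemma \<pi>_antisym: "\<pi> p a b = - \<pi> p b a"
proof -
  have "\<pi> \<in> bivectors A" using poisson by (simp add: poisson_manifold_def)
  note * = this[unfolded bivectors_def mem_Collect_eq]
  show ?thesis by (rule *[THEN conjunct2, THEN conjunct2, THEN conjunct1, rule_format])
qed

lemma \<pi>_cinf: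
  assumes "\<alpha> \<in> forms1 A" "\<beta> \<in> forms1 A"
  shows "(\<lambda>p. \<pi> p (\<alpha> p) (\<beta> p)) \<in> cinf A"
proof -
  have "\<pi> \<in> bivectors A" using poisson by (simp add: poisson_manifold_def)
  note * = this[unfolded bivectors_def mem_Collect_eq]
  show ?thesis by (rule *[THEN conjunct2, THEN conjunct2, THEN conjunct2, rule_format, OF assms])
qed

abbreviation "sharp \<equiv> anchor A \<pi>"
abbreviation "pb \<equiv> poisson_bracket A \<pi>"

lemma jacobi:
  assumes "f \<in> cinf A" "g \<in> cinf A" "h \<in> cinf A"
  shows "pb f (pb g h) p + pb g (pb h f) p + pb h (pb f g) p = 0"
proof -
  have "\<forall>f\<in>cinf A. \<forall>g\<in>cinf A. \<forall>h\<in>cinf A. pb f (pb g h) + pb g (pb h f) + pb h (pb f g) = 0"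
    using poisson[unfolded poisson_manifold_def] by (elim conjE)
  then have "(pb f (pb g h) + pb g (pb h f) + pb h (pb f g)) p = 0 p"
    using assms by (metis (no_types))
  then show ?thesis by simp
qed

lemma pb_cinf: "f \<in> cinf A \<Longrightarrow> g \<in> cinf A \<Longrightarrow> pb f g \<in> cinf A"
  unfolding poisson_bracket_def by (rule \<pi>_cinf[OF d0_form1 d0_form1])

lemma pb_antisym: "pb f g p = - pb g f p"
  unfolding poisson_bracket_def by (rule \<pi>_antisym)

lemma sharp_apply: "f \<in> cinf A \<Longrightarrow> sharp \<alpha> p f = \<pi> p (\<alpha> p) (d0 A f p)"
  by (simp add: anchor_def)

lemma sharp_d0: "g \<in> cinf A \<Longrightarrow> sharp (d0 A f) p g = pb f g p"
  by (simp add: anchor_def poisson_bracket_def)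

lemma d0_cotangent: "f \<in> cinf A \<Longrightarrow> d0 A f p \<in> cotangent_space A p"
  by (rule form1_cotangent[OF d0_form1])

lemma sharp_vfield:
  assumes \<alpha>: "\<alpha> \<in> forms1 A"
  shows "sharp \<alpha> \<in> vfields A"
proof (rule vfieldsI)
  fix p
  note add = lin_on_add[OF \<pi>_lin_on(1)] and cmult = lin_on_cmult[OF \<pi>_lin_on(1)]
  show "sharp \<alpha> p \<in> tangent_space A p"
  proof (rule tangentI)
    fix f assume f: "f \<in> cinf A"
    show "sharp \<alpha> p (\<lambda>x. c * f x) = c * sharp \<alpha> p f" for c
      using cmult[OF d0_cotangent[OF f], of p "\<alpha> p" c] f
      by (simp add: sharp_apply cinf_mult d0_cmult scale1_def)
    fix g assume g: "g \<in> cinf A"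
    show "sharp \<alpha> p (\<lambda>x. f x + g x) = sharp \<alpha> p f + sharp \<alpha> p g"
      using add[OF d0_cotangent[OF f] d0_cotangent[OF g]] f g
      by (simp add: sharp_apply cinf_add d0_add)
    show "sharp \<alpha> p (\<lambda>x. f x * g x) = sharp \<alpha> p f * g p + f p * sharp \<alpha> p g"
      using add[OF cotangent_space_cmult[OF d0_cotangent[OF g]] cotangent_space_cmult[OF d0_cotangent[OF f]],
          of p "\<alpha> p" "f p" "g p"]
        cmult[OF d0_cotangent[OF f], of p "\<alpha> p" "g p"] cmult[OF d0_cotangent[OF g], of p "\<alpha> p" "f p"] f g
      by (simp add: sharp_apply cinf_mult d0_mult scale1_def)
  qed (simp add: anchor_def)
next
  fix f assume f: "f \<in> cinf A"
  show "(\<lambda>p. sharp \<alpha> p f) \<in> cinf A"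
    using \<pi>_cinf[OF \<alpha> d0_form1[OF f]] f by (simp add: sharp_apply)
qed

lemma sharp_cinf: "\<alpha> \<in> forms1 A \<Longrightarrow> f \<in> cinf A \<Longrightarrow> (\<lambda>p. sharp \<alpha> p f) \<in> cinf A"
  by (rule vfield_cinf[OF sharp_vfield])

lemma sharp_add:
  assumes "\<alpha> \<in> forms1 A" "\<beta> \<in> forms1 A"
  shows "sharp (\<alpha> + \<beta>) = sharp \<alpha> + sharp \<beta>"
proof (intro ext)
  fix p f
  show "sharp (\<alpha> + \<beta>) p f = (sharp \<alpha> + sharp \<beta>) p f"
    using lin_on_add[OF \<pi>_lin_on(2) form1_cotangent[OF assms(1)] form1_cotangent[OF assms(2)], of p "d0 A f p"]
    by (simp add: anchor_def)
qed

lemma sharp_scale: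
  assumes "\<alpha> \<in> forms1 A"
  shows "sharp (scale1 f \<alpha>) = fscale f (sharp \<alpha>)"
proof (intro ext)
  fix p g
  show "sharp (scale1 f \<alpha>) p g = fscale f (sharp \<alpha>) p g"
    using lin_on_cmult[OF \<pi>_lin_on(2) form1_cotangent[OF assms], of p "f p" "d0 A g p"]
    by (simp add: anchor_def scale1_def fscale_def)
qed

text \<open>The anchor is defined by its action on functions, so \<open>\<beta>\<close> is replaced
  by a differential with the same value at \<open>p\<close>.\<close>

lemma sharp_pairing:
  assumes \<alpha>: "\<alpha> \<in> forms1 A" and \<beta>: "\<beta> \<in> forms1 A"
  shows "\<beta> p (sharp \<alpha> p) = \<pi> p (\<alpha> p) (\<beta> p)"
proof -
  obtain g where g: "g \<in> cinf A" "d0 A g p = \<beta> p"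
    by (rule covector_exact[OF form1_cotangent[OF \<beta>]])
  show ?thesis
    using d0_vfield[OF sharp_vfield[OF \<alpha>], of g p] g by (simp add: sharp_apply)
qed

text \<open>\<open>[\<alpha>, \<beta>] = L\<^sub>#\<^sub>\<alpha> \<beta> - \<iota>\<^sub>#\<^sub>\<beta> d\<alpha>\<close>; in this form the Leibniz rule in \<open>\<beta>\<close> is immediate.\<close>
definition kosz :: "'a form1 \<Rightarrow> 'a form1 \<Rightarrow> 'a form1" where
  "kosz \<alpha> \<beta> = (SOME \<gamma>. \<gamma> \<in> forms1 A \<and> (\<forall>X\<in>vfields A. \<forall>p. \<gamma> p (X p) =
     sharp \<alpha> p (\<lambda>q. \<beta> q (X q)) - \<beta> p (lie_bracket (sharp \<alpha>) X p) - d1 A \<alpha> p (sharp \<beta> p) (X p)))"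

lemma form2_vadd: "\<sigma> \<in> forms2 A \<Longrightarrow> X \<in> vfields A \<Longrightarrow> Y \<in> vfields A \<Longrightarrow>
    \<sigma> p v ((X + Y) p) = \<sigma> p v (X p) + \<sigma> p v (Y p)"
  by (simp add: form2_add vfield_tangent)

lemma form2_vscale: "\<sigma> \<in> forms2 A \<Longrightarrow> X \<in> vfields A \<Longrightarrow> \<sigma> p v (fscale f X p) = f p * \<sigma> p v (X p)"
  by (simp add: form2_cmult vfield_tangent fscale_apply)

text \<open>In the first two terms the derivative of f along the anchor of \<alpha> cancels as in
  \<open>d1_unique\<close>; the last term is pointwise in X.\<close>

lemma kosz_exists:
  assumes \<alpha>: "\<alpha> \<in> forms1 A" and \<beta>: "\<beta> \<in> forms1 A"
  shows "\<exists>\<gamma>. \<gamma> \<in> forms1 A \<and> (\<forall>X\<in>vfields A. \<forall>p. \<gamma> p (X p) =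
     sharp \<alpha> p (\<lambda>q. \<beta> q (X q)) - \<beta> p (lie_bracket (sharp \<alpha>) X p) - d1 A \<alpha> p (sharp \<beta> p) (X p))"
proof -
  note S = sharp_vfield[OF \<alpha>] sharp_vfield[OF \<beta>] and d = d1_form2[OF \<alpha>]
  let ?\<Phi> = "\<lambda>X p. sharp \<alpha> p (\<lambda>q. \<beta> q (X q)) - \<beta> p (lie_bracket (sharp \<alpha>) X p) - d1 A \<alpha> p (sharp \<beta> p) (X p)"
  have cinf: "?\<Phi> X \<in> cinf A" if X: "X \<in> vfields A" for X
    by (intro cinf_diff vfield_cinf[OF S(1)] form1_cinf[OF \<beta>] form2_cinf[OF d] lie_bracket_vfield X S)
  have tens: "tensorial (vfields A) p (\<lambda>X. ?\<Phi> X p)" for p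
  proof (rule tensorialI)
    fix X Y assume X: "X \<in> vfields A" and Y: "Y \<in> vfields A"
    show "?\<Phi> (X + Y) p = ?\<Phi> X p + ?\<Phi> Y p"
      using tangent_add[OF vfield_tangent[OF S(1)] form1_cinf[OF \<beta> X] form1_cinf[OF \<beta> Y]]
      by (simp only: form1_vadd[OF \<beta> X Y] form2_vadd[OF d X Y] lie_bracket_add[OF S(1) X Y]
          form1_vadd[OF \<beta> lie_bracket_vfield[OF S(1) X] lie_bracket_vfield[OF S(1) Y]])
  next
    fix f X assume f: "f \<in> cinf A" and X: "X \<in> vfields A"
    have "\<beta> p (lie_bracket (sharp \<alpha>) (fscale f X) p) =
        f p * \<beta> p (lie_bracket (sharp \<alpha>) X p) + sharp \<alpha> p f * \<beta> p (X p)"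
      unfolding lie_bracket_scale[OF S(1) X f]
      by (simp only: form1_vadd[OF \<beta> vfields_scale[OF f lie_bracket_vfield[OF S(1) X]]
            vfields_scale[OF vfield_cinf[OF S(1) f] X]]
          form1_vscale[OF \<beta> lie_bracket_vfield[OF S(1) X]] form1_vscale[OF \<beta> X])
    then show "?\<Phi> (fscale f X) p = f p * ?\<Phi> X p"
      using tangent_mult[OF vfield_tangent[OF S(1)] f form1_cinf[OF \<beta> X]]
      by (simp only: form1_vscale[OF \<beta> X] form2_vscale[OF d X]) (simp add: algebra_simps)
  qed
  show ?thesis
    by (rule form1_construct[OF cinf tens])
qed

lemma kosz_form1: "\<alpha> \<in> forms1 A \<Longrightarrow> \<beta> \<in> forms1 A \<Longrightarrow> kosz \<alpha> \<beta> \<in> forms1 A"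
  unfolding kosz_def by (rule someI_ex[OF kosz_exists, THEN conjunct1])

lemma kosz_apply:
  assumes "\<alpha> \<in> forms1 A" "\<beta> \<in> forms1 A" "X \<in> vfields A"
  shows "kosz \<alpha> \<beta> p (X p) = sharp \<alpha> p (\<lambda>q. \<beta> q (X q)) - \<beta> p (lie_bracket (sharp \<alpha>) X p)
     - d1 A \<alpha> p (sharp \<beta> p) (X p)"
  unfolding kosz_def
  by (rule someI_ex[OF kosz_exists[OF assms(1,2)], THEN conjunct2, rule_format, OF assms(3)])

text \<open>After d\<alpha> and d\<beta> are expanded, everything in [\<alpha>, \<beta>](X) +
  [\<beta>, \<alpha>](X) cancels except the X-derivative of \<alpha>(#\<beta>) + \<beta>(#\<alpha>),
  and this function is 0 because \<pi> is antisymmetric.\<close>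

lemma kosz_antisym:
  assumes \<alpha>: "\<alpha> \<in> forms1 A" and \<beta>: "\<beta> \<in> forms1 A"
  shows "kosz \<alpha> \<beta> = - kosz \<beta> \<alpha>"
proof (rule forms1_eqI)
  fix X p assume X: "X \<in> vfields A"
  note S = sharp_vfield[OF \<alpha>] sharp_vfield[OF \<beta>]
  have "(\<lambda>q. \<alpha> q (sharp \<beta> q)) = (\<lambda>q. - \<beta> q (sharp \<alpha> q))"
    by (simp only: sharp_pairing[OF \<alpha> \<beta>] sharp_pairing[OF \<beta> \<alpha>]) (rule ext, rule \<pi>_antisym)
  then have "X p (\<lambda>q. \<alpha> q (sharp \<beta> q)) = - X p (\<lambda>q. \<beta> q (sharp \<alpha> q))"
    using tangent_minus[OF vfield_tangent[OF X] form1_cinf[OF \<beta> S(1)]] by simp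
  then show "kosz \<alpha> \<beta> p (X p) = (- kosz \<beta> \<alpha>) p (X p)"
    by (simp add: kosz_apply[OF \<alpha> \<beta> X] kosz_apply[OF \<beta> \<alpha> X]
        d1_apply[OF \<alpha> S(2) X] d1_apply[OF \<beta> S(1) X])
qed (intro forms1_minus kosz_form1 assms)+

lemma kosz_add_right:
  assumes \<alpha>: "\<alpha> \<in> forms1 A" and \<beta>: "\<beta> \<in> forms1 A" and \<gamma>: "\<gamma> \<in> forms1 A"
  shows "kosz \<alpha> (\<beta> + \<gamma>) = kosz \<alpha> \<beta> + kosz \<alpha> \<gamma>"
proof (rule forms1_eqI)
  fix X p assume X: "X \<in> vfields A"
  note S = sharp_vfield[OF \<alpha>] sharp_vfield[OF \<beta>] sharp_vfield[OF \<gamma>]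
  show "kosz \<alpha> (\<beta> + \<gamma>) p (X p) = (kosz \<alpha> \<beta> + kosz \<alpha> \<gamma>) p (X p)"
    using tangent_add[OF vfield_tangent[OF S(1)] form1_cinf[OF \<beta> X] form1_cinf[OF \<gamma> X]]
    by (simp add: kosz_apply[OF \<alpha> _ X] forms1_add \<beta> \<gamma> sharp_add[OF \<beta> \<gamma>]
        form2_add(1)[OF d1_form2[OF \<alpha>] vfield_tangent[OF S(2)] vfield_tangent[OF S(3)]])
qed (intro forms1_add kosz_form1 assms)+

lemma kosz_scale_right:
  assumes f: "f \<in> cinf A" and \<alpha>: "\<alpha> \<in> forms1 A" and \<beta>: "\<beta> \<in> forms1 A"
  shows "kosz \<alpha> (scale1 f \<beta>) = scale1 f (kosz \<alpha> \<beta>) + scale1 (anchor_app A \<pi> \<alpha> f) \<beta>"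
proof (rule forms1_eqI)
  fix X p assume X: "X \<in> vfields A"
  note S = sharp_vfield[OF \<alpha>] sharp_vfield[OF \<beta>]
  show "kosz \<alpha> (scale1 f \<beta>) p (X p) =
      (scale1 f (kosz \<alpha> \<beta>) + scale1 (anchor_app A \<pi> \<alpha> f) \<beta>) p (X p)"
    using tangent_mult[OF vfield_tangent[OF S(1)] f form1_cinf[OF \<beta> X]]
    by (simp add: kosz_apply[OF \<alpha> _ X] forms1_scale f \<beta> sharp_scale[OF \<beta>] fscale_apply
        form2_cmult(1)[OF d1_form2[OF \<alpha>] vfield_tangent[OF S(2)]])
      (simp add: scale1_def kosz_apply[OF \<alpha> \<beta> X] algebra_simps)
qed (intro forms1_add forms1_scale kosz_form1 sharp_cinf assms)+

text \<open>As d(df) = 0, only the Lie derivative of dg along the Hamiltonian field of f remains,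
  and that is the differential of {f, g}.\<close>

lemma kosz_d0:
  assumes f: "f \<in> cinf A" and g: "g \<in> cinf A"
  shows "kosz (d0 A f) (d0 A g) = d0 A (pb f g)"
proof (rule forms1_eqI)
  fix X p assume X: "X \<in> vfields A"
  have S: "sharp (d0 A f) \<in> vfields A" by (rule sharp_vfield[OF d0_form1[OF f]])
  show "kosz (d0 A f) (d0 A g) p (X p) = d0 A (pb f g) p (X p)"
    by (simp add: kosz_apply[OF d0_form1[OF f] d0_form1[OF g] X] d1_d0[OF f] d0_vfield[OF X]
        d0_vfield[OF lie_bracket_vfield[OF S X]])
      (simp add: lie_bracket_def sharp_d0[OF g])
qed (intro kosz_form1 d0_form1 pb_cinf assms)+

lemma kosz_add_left:
  assumes "\<alpha> \<in> forms1 A" "\<beta> \<in> forms1 A" "\<gamma> \<in> forms1 A"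
  shows "kosz (\<alpha> + \<beta>) \<gamma> = kosz \<alpha> \<gamma> + kosz \<beta> \<gamma>"
  unfolding kosz_antisym[OF forms1_add[OF assms(1,2)] assms(3)] kosz_antisym[OF assms(1,3)]
    kosz_antisym[OF assms(2,3)] kosz_add_right[OF assms(3,1,2)] by simp

lemma kosz_scale_left:
  assumes f: "f \<in> cinf A" and \<alpha>: "\<alpha> \<in> forms1 A" and \<beta>: "\<beta> \<in> forms1 A"
  shows "kosz (scale1 f \<beta>) \<alpha> = scale1 f (kosz \<beta> \<alpha>) + scale1 (\<lambda>p. - sharp \<alpha> p f) \<beta>"
  unfolding kosz_antisym[OF forms1_scale[OF f \<beta>] \<alpha>] kosz_scale_right[OF f \<alpha> \<beta>] kosz_antisym[OF \<beta> \<alpha>]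
  by (simp add: scale1_def fun_eq_iff)

text \<open>Both sides obey the same Leibniz rule in \<beta>, so exact forms suffice; there the
  claim is the Jacobi identity of the Poisson bracket.\<close>

lemma sharp_hom:
  assumes \<alpha>: "\<alpha> \<in> forms1 A" and \<beta>: "\<beta> \<in> forms1 A"
  shows "sharp (kosz \<alpha> \<beta>) = lie_bracket (sharp \<alpha>) (sharp \<beta>)"
proof (rule vfields_eqI)
  fix p h assume h: "h \<in> cinf A"
  define \<Psi> where "\<Psi> \<alpha> \<beta> = sharp (kosz \<alpha> \<beta>) p h - lie_bracket (sharp \<alpha>) (sharp \<beta>) p h" for \<alpha> \<beta>
  have "\<Psi> \<alpha> \<beta> = 0"
  proof (rule tensorial2_zeroI[OF _ _ _ \<alpha> \<beta>])
    fix \<alpha> assume \<alpha>: "\<alpha> \<in> forms1 A"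
    show "tensorial (forms1 A) p (\<Psi> \<alpha>)"
    proof (rule tensorialI)
      fix \<beta> \<gamma> assume \<beta>: "\<beta> \<in> forms1 A" and \<gamma>: "\<gamma> \<in> forms1 A"
      show "\<Psi> \<alpha> (\<beta> + \<gamma>) = \<Psi> \<alpha> \<beta> + \<Psi> \<alpha> \<gamma>"
        unfolding \<Psi>_def kosz_add_right[OF \<alpha> \<beta> \<gamma>] sharp_add[OF kosz_form1[OF \<alpha> \<beta>] kosz_form1[OF \<alpha> \<gamma>]]
          sharp_add[OF \<beta> \<gamma>] lie_bracket_add[OF sharp_vfield[OF \<alpha>] sharp_vfield[OF \<beta>] sharp_vfield[OF \<gamma>]]
        by simp
    next
      fix f \<beta> assume f: "f \<in> cinf A" and \<beta>: "\<beta> \<in> forms1 A"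
      show "\<Psi> \<alpha> (fscale f \<beta>) = f p * \<Psi> \<alpha> \<beta>"
        unfolding \<Psi>_def scale1_eq_fscale[symmetric] kosz_scale_right[OF f \<alpha> \<beta>]
          sharp_add[OF forms1_scale[OF f kosz_form1[OF \<alpha> \<beta>]] forms1_scale[OF sharp_cinf[OF \<alpha> f] \<beta>]]
          sharp_scale[OF kosz_form1[OF \<alpha> \<beta>]] sharp_scale[OF \<beta>]
          lie_bracket_scale[OF sharp_vfield[OF \<alpha>] sharp_vfield[OF \<beta>] f]
        by (simp add: fscale_def algebra_simps)
    qed
  next
    fix \<alpha> \<beta> assume \<alpha>: "\<alpha> \<in> forms1 A" and \<beta>: "\<beta> \<in> forms1 A"
    have "kosz \<alpha> \<beta> = scale1 (\<lambda>_. - 1) (kosz \<beta> \<alpha>)"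
      unfolding kosz_antisym[OF \<alpha> \<beta>] by (simp add: scale1_def fun_eq_iff)
    then have "sharp (kosz \<alpha> \<beta>) p h = - sharp (kosz \<beta> \<alpha>) p h"
      using sharp_scale[OF kosz_form1[OF \<beta> \<alpha>]] by (simp add: fscale_def)
    then show "\<Psi> \<alpha> \<beta> = - \<Psi> \<beta> \<alpha>"
      unfolding \<Psi>_def by (simp add: lie_bracket_def)
  next
    fix f g assume f: "f \<in> cinf A" and g: "g \<in> cinf A"
    have "pb h (pb f g) p = - pb (pb f g) h p" by (rule pb_antisym)
    moreover have "pb h f = (\<lambda>p. - pb f h p)" by (rule ext, rule pb_antisym)
    then have "pb g (pb h f) p = - pb g (pb f h) p"
      using tangent_minus[OF vfield_tangent[OF sharp_vfield[OF d0_form1[OF g]]] pb_cinf[OF f h], of p]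
      by (simp add: sharp_d0 pb_cinf f h cinf_minus)
    ultimately show "\<Psi> (d0 A f) (d0 A g) = 0"
      using jacobi[OF f g h, of p]
      by (simp add: \<Psi>_def kosz_d0[OF f g] sharp_d0 h lie_bracket_def pb_cinf f g)
  qed
  then show "sharp (kosz \<alpha> \<beta>) p h = lie_bracket (sharp \<alpha>) (sharp \<beta>) p h"
    by (simp add: \<Psi>_def)
qed (intro sharp_vfield lie_bracket_vfield kosz_form1 assms)+

definition jacobiator :: "'a form1 \<Rightarrow> 'a form1 \<Rightarrow> 'a form1 \<Rightarrow> 'a form1" where
  "jacobiator \<alpha> \<beta> \<gamma> = kosz \<alpha> (kosz \<beta> \<gamma>) + kosz \<beta> (kosz \<gamma> \<alpha>) + kosz \<gamma> (kosz \<alpha> \<beta>)"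

lemma jacobiator_cyclic: "jacobiator \<alpha> \<beta> \<gamma> = jacobiator \<beta> \<gamma> \<alpha>"
  by (simp add: jacobiator_def add_ac)

text \<open>The terms with first derivatives of f cancel by antisymmetry of \<open>kosz\<close>. The
  second-order terms form the commutator of #\<alpha> and #\<beta> applied to f, which
  \<open>sharp_hom\<close> matches with the term #[\<alpha>, \<beta>](f) from the third
  summand.\<close>

lemma jacobiator_tensorial:
  assumes \<alpha>: "\<alpha> \<in> forms1 A" and \<beta>: "\<beta> \<in> forms1 A"
  shows "tensorial (forms1 A) p (\<lambda>\<gamma>. jacobiator \<alpha> \<beta> \<gamma> p v)"
proof (rule tensorialI)
  fix \<gamma> \<delta> assume \<gamma>: "\<gamma> \<in> forms1 A" and \<delta>: "\<delta> \<in> forms1 A"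
  show "jacobiator \<alpha> \<beta> (\<gamma> + \<delta>) p v = jacobiator \<alpha> \<beta> \<gamma> p v + jacobiator \<alpha> \<beta> \<delta> p v"
    by (simp add: jacobiator_def kosz_add_right kosz_add_left kosz_form1 \<alpha> \<beta> \<gamma> \<delta>)
next
  fix f \<gamma> assume f: "f \<in> cinf A" and \<gamma>: "\<gamma> \<in> forms1 A"
  note k = kosz_form1[OF \<alpha> \<beta>] kosz_form1[OF \<beta> \<gamma>] kosz_form1[OF \<gamma> \<alpha>]
  have a: "kosz \<alpha> (kosz \<beta> (scale1 f \<gamma>)) p v = f p * kosz \<alpha> (kosz \<beta> \<gamma>) p v
      + sharp \<alpha> p f * kosz \<beta> \<gamma> p v + sharp \<beta> p f * kosz \<alpha> \<gamma> p v + sharp \<alpha> p (\<lambda>q. sharp \<beta> q f) * \<gamma> p v"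
    unfolding kosz_scale_right[OF f \<beta> \<gamma>]
      kosz_add_right[OF \<alpha> forms1_scale[OF f k(2)] forms1_scale[OF sharp_cinf[OF \<beta> f] \<gamma>]]
      kosz_scale_right[OF f \<alpha> k(2)] kosz_scale_right[OF sharp_cinf[OF \<beta> f] \<alpha> \<gamma>]
    by (simp add: scale1_def)
  have b: "kosz \<beta> (kosz (scale1 f \<gamma>) \<alpha>) p v = f p * kosz \<beta> (kosz \<gamma> \<alpha>) p v
      + sharp \<beta> p f * kosz \<gamma> \<alpha> p v - sharp \<alpha> p f * kosz \<beta> \<gamma> p v - sharp \<beta> p (\<lambda>q. sharp \<alpha> q f) * \<gamma> p v"
    unfolding kosz_scale_left[OF f \<alpha> \<gamma>]
      kosz_add_right[OF \<beta> forms1_scale[OF f k(3)] forms1_scale[OF cinf_minus[OF sharp_cinf[OF \<alpha> f]] \<gamma>]]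
      kosz_scale_right[OF f \<beta> k(3)] kosz_scale_right[OF cinf_minus[OF sharp_cinf[OF \<alpha> f]] \<beta> \<gamma>]
    using tangent_minus[OF vfield_tangent[OF sharp_vfield[OF \<beta>]] sharp_cinf[OF \<alpha> f]]
    by (simp add: scale1_def)
  have c: "kosz (scale1 f \<gamma>) (kosz \<alpha> \<beta>) p v = f p * kosz \<gamma> (kosz \<alpha> \<beta>) p v
      - (sharp \<alpha> p (\<lambda>q. sharp \<beta> q f) - sharp \<beta> p (\<lambda>q. sharp \<alpha> q f)) * \<gamma> p v"
    unfolding kosz_scale_left[OF f k(1) \<gamma>] sharp_hom[OF \<alpha> \<beta>] lie_bracket_def
    by (simp add: scale1_def algebra_simps)
  have "kosz \<alpha> \<gamma> p v = - kosz \<gamma> \<alpha> p v"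
    unfolding kosz_antisym[OF \<alpha> \<gamma>] by simp
  then show "jacobiator \<alpha> \<beta> (fscale f \<gamma>) p v = f p * jacobiator \<alpha> \<beta> \<gamma> p v"
    unfolding scale1_eq_fscale[symmetric] jacobiator_def plus_fun_apply a b c
    by (simp add: algebra_simps)
qed

text \<open>Tensoriality is known in the last slot only. Cyclic invariance brings each argument
  there in turn, and the number of arguments assumed exact drops from three to none.\<close>

lemma kosz_jacobi:
  assumes \<alpha>: "\<alpha> \<in> forms1 A" and \<beta>: "\<beta> \<in> forms1 A" and \<gamma>: "\<gamma> \<in> forms1 A"
  shows "jacobiator \<alpha> \<beta> \<gamma> = 0"
proof (intro ext)
  fix p v
  have cyc: "jacobiator \<alpha> \<beta> \<gamma> p v = jacobiator \<beta> \<gamma> \<alpha> p v" for \<alpha> \<beta> \<gamma>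
    by (rule jacobiator_cyclic[THEN fun_cong, THEN fun_cong])
  have step: "jacobiator \<alpha> \<beta> \<gamma> p v = 0" if "\<alpha> \<in> forms1 A" "\<beta> \<in> forms1 A" "\<gamma> \<in> forms1 A"
    "\<And>h. h \<in> cinf A \<Longrightarrow> jacobiator \<alpha> \<beta> (d0 A h) p v = 0" for \<alpha> \<beta> \<gamma>
    using tensorial_forms1_zeroI[OF jacobiator_tensorial[OF that(1,2)] that(3), of p v] that(4) by simp
  have exact: "jacobiator (d0 A f) (d0 A g) (d0 A h) p v = 0"
    if f: "f \<in> cinf A" and g: "g \<in> cinf A" and h: "h \<in> cinf A" for f g h
  proof -
    have "jacobiator (d0 A f) (d0 A g) (d0 A h) =
        d0 A (\<lambda>p. pb f (pb g h) p + pb g (pb h f) p + pb h (pb f g) p)"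
      by (simp add: jacobiator_def kosz_d0 f g h pb_cinf d0_add cinf_add)
    then show ?thesis using jacobi[OF f g h] by (simp add: d0_const)
  qed
  have 1: "jacobiator (d0 A f) (d0 A g) \<gamma> p v = 0" if "f \<in> cinf A" "g \<in> cinf A" "\<gamma> \<in> forms1 A" for f g \<gamma>
    by (rule step) (use that d0_form1 exact in auto)
  have 2: "jacobiator \<gamma> (d0 A f) \<beta> p v = 0" if "f \<in> cinf A" "\<beta> \<in> forms1 A" "\<gamma> \<in> forms1 A" for f \<beta> \<gamma>
    by (rule step) (use that d0_form1 1 cyc[of \<gamma>] in auto)
  show "jacobiator \<alpha> \<beta> \<gamma> p v = 0 p v"
    unfolding zero_fun_apply
    by (rule step[OF \<alpha> \<beta> \<gamma>], subst cyc, rule 2[OF _ \<alpha> \<beta>])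
qed

lemma sharp_const: "\<alpha> \<in> forms1 A \<Longrightarrow> sharp \<alpha> p (\<lambda>_. c) = 0"
  by (rule tangent_const[OF vfield_tangent[OF sharp_vfield]])

lemma kosz_is_koszul_bracket: "is_koszul_bracket A \<pi> kosz"
  unfolding is_koszul_bracket_def bilinear_op1_def
proof (intro conjI ballI allI)
  fix c \<alpha> \<beta> assume \<alpha>: "\<alpha> \<in> forms1 A" and \<beta>: "\<beta> \<in> forms1 A"
  show "kosz (scale1 (\<lambda>_. c) \<alpha>) \<beta> = scale1 (\<lambda>_. c) (kosz \<alpha> \<beta>)"
    unfolding kosz_scale_left[OF cinf_const \<beta> \<alpha>] sharp_const[OF \<beta>] by (simp add: scale1_def fun_eq_iff)
  show "kosz \<alpha> (scale1 (\<lambda>_. c) \<beta>) = scale1 (\<lambda>_. c) (kosz \<alpha> \<beta>)"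
    unfolding kosz_scale_right[OF cinf_const \<alpha> \<beta>] sharp_const[OF \<alpha>] by (simp add: scale1_def fun_eq_iff)
  show "kosz \<alpha> \<beta> \<in> forms1 A" by (rule kosz_form1[OF \<alpha> \<beta>])
  show "kosz \<alpha> \<beta> = - kosz \<beta> \<alpha>" by (rule kosz_antisym[OF \<alpha> \<beta>])
  show "kosz \<alpha> (scale1 f \<beta>) = scale1 f (kosz \<alpha> \<beta>) + scale1 (anchor_app A \<pi> \<alpha> f) \<beta>"
    if "f \<in> cinf A" for f
    by (rule kosz_scale_right[OF that \<alpha> \<beta>])
  fix \<gamma> assume \<gamma>: "\<gamma> \<in> forms1 A"
  show "kosz (\<alpha> + \<beta>) \<gamma> = kosz \<alpha> \<gamma> + kosz \<beta> \<gamma>" by (rule kosz_add_left[OF \<alpha> \<beta> \<gamma>])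
  show "kosz \<gamma> (\<alpha> + \<beta>) = kosz \<gamma> \<alpha> + kosz \<gamma> \<beta>" by (rule kosz_add_right[OF \<gamma> \<alpha> \<beta>])
  show "kosz \<alpha> (kosz \<beta> \<gamma>) + kosz \<beta> (kosz \<gamma> \<alpha>) + kosz \<gamma> (kosz \<alpha> \<beta>) = 0"
    by (rule kosz_jacobi[OF \<alpha> \<beta> \<gamma>, unfolded jacobiator_def])
next
  fix f g assume "f \<in> cinf A" "g \<in> cinf A"
  then show "kosz (d0 A f) (d0 A g) = d0 A (pb f g)" by (rule kosz_d0)
qed

text \<open>Existence of \<open>kosz\<close> makes the chosen operation satisfy the axioms. Two such
  brackets have the same Leibniz defect and agree on exact forms, hence agree on all
  1-forms.\<close>

lemma koszul_bracket_eq: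
  assumes \<alpha>: "\<alpha> \<in> forms1 A" and \<beta>: "\<beta> \<in> forms1 A"
  shows "koszul_bracket A \<pi> \<alpha> \<beta> = kosz \<alpha> \<beta>"
proof (intro ext)
  fix p v
  let ?K = "koszul_bracket A \<pi>"
  have K: "is_koszul_bracket A \<pi> ?K"
    unfolding koszul_bracket_def by (rule someI[of "is_koszul_bracket A \<pi>", OF kosz_is_koszul_bracket])
  note K' = K[unfolded is_koszul_bracket_def bilinear_op1_def]
  note add = K'[THEN conjunct1, THEN conjunct2, THEN conjunct1, rule_format, THEN conjunct2]
    and anti = K'[THEN conjunct2, THEN conjunct1, rule_format]
    and scale = K'[THEN conjunct2, THEN conjunct2, THEN conjunct2, THEN conjunct1, rule_format]
    and exact = K'[THEN conjunct2, THEN conjunct2, THEN conjunct2, THEN conjunct2, rule_format]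
  define \<Psi> where "\<Psi> \<alpha> \<beta> = ?K \<alpha> \<beta> p v - kosz \<alpha> \<beta> p v" for \<alpha> \<beta>
  have "\<Psi> \<alpha> \<beta> = 0"
  proof (rule tensorial2_zeroI[OF _ _ _ \<alpha> \<beta>])
    fix \<alpha> assume \<alpha>: "\<alpha> \<in> forms1 A"
    show "tensorial (forms1 A) p (\<Psi> \<alpha>)"
    proof (rule tensorialI)
      fix \<beta> \<gamma> assume \<beta>: "\<beta> \<in> forms1 A" and \<gamma>: "\<gamma> \<in> forms1 A"
      show "\<Psi> \<alpha> (\<beta> + \<gamma>) = \<Psi> \<alpha> \<beta> + \<Psi> \<alpha> \<gamma>"
        unfolding \<Psi>_def kosz_add_right[OF \<alpha> \<beta> \<gamma>] add[OF \<beta> \<gamma> \<alpha>] by simp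
    next
      fix f \<beta> assume f: "f \<in> cinf A" and \<beta>: "\<beta> \<in> forms1 A"
      show "\<Psi> \<alpha> (fscale f \<beta>) = f p * \<Psi> \<alpha> \<beta>"
        unfolding \<Psi>_def scale1_eq_fscale[symmetric] scale[OF f \<alpha> \<beta>] kosz_scale_right[OF f \<alpha> \<beta>]
        by (simp add: scale1_def algebra_simps)
    qed
  next
    fix \<alpha> \<beta> assume \<alpha>: "\<alpha> \<in> forms1 A" and \<beta>: "\<beta> \<in> forms1 A"
    show "\<Psi> \<alpha> \<beta> = - \<Psi> \<beta> \<alpha>"
      using anti[OF \<alpha> \<beta>, THEN fun_cong, THEN fun_cong, of p v]
        kosz_antisym[OF \<alpha> \<beta>, THEN fun_cong, THEN fun_cong, of p v]
      unfolding \<Psi>_def fun_Compl_def by linarith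
  qed (simp add: \<Psi>_def exact kosz_d0)
  then show "?K \<alpha> \<beta> p v = kosz \<alpha> \<beta> p v" by (simp add: \<Psi>_def)
qed

end

section \<open>The bracket of 1-forms\<close>

locale poisson_connection = poisson A \<pi>
  for A :: "('a::{t2_space,second_countable_topology}, 'n::finite) chart set" and \<pi> +
  fixes D :: "'a form1 \<Rightarrow> 'a form1 \<Rightarrow> 'a form1"
  assumes connection: "contravariant_connection A \<pi> D"
    and flat: "flat_connection A \<pi> D"
    and torsion: "torsion_free A \<pi> D"
begin

lemma D_form1: "\<alpha> \<in> forms1 A \<Longrightarrow> \<beta> \<in> forms1 A \<Longrightarrow> D \<alpha> \<beta> \<in> forms1 A"
  using connection[unfolded contravariant_connection_def bilinear_op1_def, THEN conjunct1,
      THEN conjunct1, rule_format] .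

lemma D_add:
  assumes "\<alpha> \<in> forms1 A" "\<beta> \<in> forms1 A" "\<gamma> \<in> forms1 A"
  shows "D (\<alpha> + \<beta>) \<gamma> = D \<alpha> \<gamma> + D \<beta> \<gamma>" "D \<gamma> (\<alpha> + \<beta>) = D \<gamma> \<alpha> + D \<gamma> \<beta>"
  using connection[unfolded contravariant_connection_def bilinear_op1_def, THEN conjunct1,
      THEN conjunct2, THEN conjunct1, rule_format, OF assms] by blast+

lemma D_scale:
  assumes "f \<in> cinf A" "\<alpha> \<in> forms1 A" "\<beta> \<in> forms1 A"
  shows "D (scale1 f \<alpha>) \<beta> = scale1 f (D \<alpha> \<beta>)"
    "D \<alpha> (scale1 f \<beta>) = scale1 f (D \<alpha> \<beta>) + scale1 (anchor_app A \<pi> \<alpha> f) \<beta>"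
  using connection[unfolded contravariant_connection_def, THEN conjunct2, rule_format, OF assms] by blast+

lemma D_torsion:
  assumes "\<alpha> \<in> forms1 A" "\<beta> \<in> forms1 A"
  shows "D \<alpha> \<beta> p v - D \<beta> \<alpha> p v = kosz \<alpha> \<beta> p v"
  using torsion[unfolded torsion_free_def, rule_format, OF assms, THEN fun_cong, THEN fun_cong, of p v]
  unfolding koszul_bracket_eq[OF assms] by simp

lemma D_flat:
  assumes "\<alpha> \<in> forms1 A" "\<beta> \<in> forms1 A" "\<gamma> \<in> forms1 A"
  shows "D \<alpha> (D \<beta> \<gamma>) p v - D \<beta> (D \<alpha> \<gamma>) p v = D (kosz \<alpha> \<beta>) \<gamma> p v"
  using flat[unfolded flat_connection_def, rule_format, OF assms, THEN fun_cong, THEN fun_cong, of p v]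
  unfolding koszul_bracket_eq[OF assms(1,2)] by simp

lemma D_scale_const:
  assumes "\<alpha> \<in> forms1 A" "\<beta> \<in> forms1 A"
  shows "D \<alpha> (scale1 (\<lambda>_. c) \<beta>) = scale1 (\<lambda>_. c) (D \<alpha> \<beta>)"
  unfolding D_scale(2)[OF cinf_const assms] sharp_const[OF assms(1)] by (simp add: scale1_def fun_eq_iff)

section \<open>The connection on vector fields and on 2-forms\<close>

abbreviation "cv \<equiv> conn_vfield A \<pi> D"
abbreviation "cf \<equiv> conn_form2 A \<pi> D"

text \<open>For the product rule of the derivation: (#\<alpha>)(X(f g)) produces the mixed terms
  (#\<alpha>)(f) X(g) and (#\<alpha>)(g) X(f), and D_\<alpha> applied to d(f g) = f dg + g df
  produces the same two, so they cancel.\<close>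

lemma cv_vfield:
  assumes \<alpha>: "\<alpha> \<in> forms1 A" and X: "X \<in> vfields A"
  shows "cv \<alpha> X \<in> vfields A"
proof (rule vfieldsI)
  fix p
  note Xt = vfield_tangent[OF X] and St = vfield_tangent[OF sharp_vfield[OF \<alpha>]]
  note Xc = vfield_cinf[OF X] and d = d0_form1
  show "cv \<alpha> X p \<in> tangent_space A p"
  proof (rule tangentI)
    fix f assume f: "f \<in> cinf A"
    show "cv \<alpha> X p (\<lambda>x. c * f x) = c * cv \<alpha> X p f" for c
      by (simp add: conn_vfield_def f cinf_mult tangent_cmult[OF Xt f] tangent_cmult[OF St Xc[OF f]]
          d0_cmult[OF f] D_scale_const[OF \<alpha> d[OF f]])
        (simp add: scale1_def algebra_simps)
    fix g assume g: "g \<in> cinf A"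
    show "cv \<alpha> X p (\<lambda>x. f x + g x) = cv \<alpha> X p f + cv \<alpha> X p g"
      by (simp add: conn_vfield_def f g cinf_add tangent_add[OF Xt f g] tangent_add[OF St Xc[OF f] Xc[OF g]]
          d0_add[OF f g] D_add(2)[OF d[OF f] d[OF g] \<alpha>])
    have "sharp \<alpha> p (\<lambda>q. X q f * g q + f q * X q g) =
        sharp \<alpha> p (\<lambda>q. X q f) * g p + X p f * sharp \<alpha> p g
        + (sharp \<alpha> p f * X p g + f p * sharp \<alpha> p (\<lambda>q. X q g))"
      by (simp add: tangent_add[OF St cinf_mult[OF Xc[OF f] g] cinf_mult[OF f Xc[OF g]]]
          tangent_mult[OF St Xc[OF f] g] tangent_mult[OF St f Xc[OF g]])
    moreover have "D \<alpha> (d0 A (\<lambda>x. f x * g x)) p (X p) =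
        f p * D \<alpha> (d0 A g) p (X p) + sharp \<alpha> p f * X p g + (g p * D \<alpha> (d0 A f) p (X p) + sharp \<alpha> p g * X p f)"
      unfolding d0_mult[OF f g] D_add(2)[OF forms1_scale[OF f d[OF g]] forms1_scale[OF g d[OF f]] \<alpha>]
        D_scale(2)[OF f \<alpha> d[OF g]] D_scale(2)[OF g \<alpha> d[OF f]]
      by (simp add: scale1_def d0_vfield[OF X])
    ultimately show "cv \<alpha> X p (\<lambda>x. f x * g x) = cv \<alpha> X p f * g p + f p * cv \<alpha> X p g"
      by (simp add: conn_vfield_def f g cinf_mult tangent_mult[OF Xt f g]) (simp add: algebra_simps)
  qed (simp add: conn_vfield_def)
next
  fix f assume f: "f \<in> cinf A"
  show "(\<lambda>p. cv \<alpha> X p f) \<in> cinf A"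
    using cinf_diff[OF sharp_cinf[OF \<alpha> vfield_cinf[OF X f]] form1_cinf[OF D_form1[OF \<alpha> d0_form1[OF f]] X]] f
    by (simp add: conn_vfield_def)
qed

text \<open>For exact \<open>\<beta>\<close> this is how \<open>conn_vfield\<close> is defined; both
  sides have the same Leibniz defect in \<open>\<beta>\<close>, so the general case follows.\<close>

lemma cv_pairing:
  assumes \<alpha>: "\<alpha> \<in> forms1 A" and \<beta>: "\<beta> \<in> forms1 A" and X: "X \<in> vfields A"
  shows "sharp \<alpha> p (\<lambda>q. \<beta> q (X q)) = D \<alpha> \<beta> p (X p) + \<beta> p (cv \<alpha> X p)"
proof -
  note St = vfield_tangent[OF sharp_vfield[OF \<alpha>]]
  let ?\<Phi> = "\<lambda>\<beta>. sharp \<alpha> p (\<lambda>q. \<beta> q (X q)) - D \<alpha> \<beta> p (X p) - \<beta> p (cv \<alpha> X p)"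
  have "?\<Phi> \<beta> = 0"
  proof (rule tensorial_forms1_zeroI[OF tensorialI \<beta>])
    fix \<beta> \<gamma> assume \<beta>: "\<beta> \<in> forms1 A" and \<gamma>: "\<gamma> \<in> forms1 A"
    show "?\<Phi> (\<beta> + \<gamma>) = ?\<Phi> \<beta> + ?\<Phi> \<gamma>"
      unfolding D_add(2)[OF \<beta> \<gamma> \<alpha>]
      by (simp add: tangent_add[OF St form1_cinf[OF \<beta> X] form1_cinf[OF \<gamma> X]])
  next
    fix f \<beta> assume f: "f \<in> cinf A" and \<beta>: "\<beta> \<in> forms1 A"
    show "?\<Phi> (fscale f \<beta>) = f p * ?\<Phi> \<beta>"
      unfolding scale1_eq_fscale[symmetric] D_scale(2)[OF f \<alpha> \<beta>]
      using tangent_mult[OF St f form1_cinf[OF \<beta> X]]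
      by (simp add: scale1_def algebra_simps)
  next
    fix f assume f: "f \<in> cinf A"
    show "?\<Phi> (d0 A f) = 0"
      by (simp add: d0_vfield[OF X] d0_vfield[OF cv_vfield[OF \<alpha> X]]) (simp add: conn_vfield_def f)
  qed
  then show ?thesis by simp
qed

lemma cv_add:
  assumes \<alpha>: "\<alpha> \<in> forms1 A" and X: "X \<in> vfields A" and Y: "Y \<in> vfields A"
  shows "cv \<alpha> (X + Y) = cv \<alpha> X + cv \<alpha> Y"
proof (rule vfields_eqI)
  fix p f assume f: "f \<in> cinf A"
  show "cv \<alpha> (X + Y) p f = (cv \<alpha> X + cv \<alpha> Y) p f"
    using tangent_add[OF vfield_tangent[OF sharp_vfield[OF \<alpha>]] vfield_cinf[OF X f] vfield_cinf[OF Y f]]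
      form1_vadd[OF D_form1[OF \<alpha> d0_form1[OF f]] X Y]
    by (simp add: conn_vfield_def f)
qed (intro cv_vfield vfields_add assms)+

lemma cv_scale:
  assumes f: "f \<in> cinf A" and \<alpha>: "\<alpha> \<in> forms1 A" and X: "X \<in> vfields A"
  shows "cv \<alpha> (fscale f X) = fscale f (cv \<alpha> X) + fscale (\<lambda>p. sharp \<alpha> p f) X"
proof (rule vfields_eqI)
  fix p g assume g: "g \<in> cinf A"
  show "cv \<alpha> (fscale f X) p g = (fscale f (cv \<alpha> X) + fscale (\<lambda>p. sharp \<alpha> p f) X) p g"
    using tangent_mult[OF vfield_tangent[OF sharp_vfield[OF \<alpha>]] f vfield_cinf[OF X g]]
    by (simp add: conn_vfield_def g form1_vscale[OF D_form1[OF \<alpha> d0_form1[OF g]] X])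
      (simp add: fscale_def conn_vfield_def g algebra_simps)
qed (intro cv_vfield vfields_add vfields_scale sharp_cinf assms)+

lemma cv_add_form:
  assumes \<alpha>: "\<alpha> \<in> forms1 A" and \<beta>: "\<beta> \<in> forms1 A" and X: "X \<in> vfields A"
  shows "cv (\<alpha> + \<beta>) X = cv \<alpha> X + cv \<beta> X"
proof (rule vfields_eqI)
  fix p f assume f: "f \<in> cinf A"
  show "cv (\<alpha> + \<beta>) X p f = (cv \<alpha> X + cv \<beta> X) p f"
    by (simp add: conn_vfield_def f sharp_add[OF \<alpha> \<beta>] D_add(1)[OF \<alpha> \<beta> d0_form1[OF f]])
qed (intro cv_vfield vfields_add forms1_add assms)+

lemma cv_scale_form:
  assumes f: "f \<in> cinf A" and \<alpha>: "\<alpha> \<in> forms1 A" and X: "X \<in> vfields A"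
  shows "cv (scale1 f \<alpha>) X = fscale f (cv \<alpha> X)"
proof (rule vfields_eqI)
  fix p g assume g: "g \<in> cinf A"
  show "cv (scale1 f \<alpha>) X p g = fscale f (cv \<alpha> X) p g"
    by (simp add: conn_vfield_def g sharp_scale[OF \<alpha>] D_scale(1)[OF f \<alpha> d0_form1[OF g]])
      (simp add: fscale_def scale1_def conn_vfield_def g algebra_simps)
qed (intro cv_vfield vfields_scale forms1_scale assms)+

text \<open>Gives the definite description in \<open>conn_form2\<close> its meaning. In the slot Y
  the term (#\<alpha>)(f) \<sigma>(X, Y) arises from the first and from the last summand, with
  opposite signs.\<close>

lemma cf_unique:
  assumes \<alpha>: "\<alpha> \<in> forms1 A" and \<sigma>: "\<sigma> \<in> forms2 A"
  shows "\<exists>!\<tau>. \<tau> \<in> forms2 A \<and> (\<forall>X\<in>vfields A. \<forall>Y\<in>vfields A. \<forall>p. \<tau> p (X p) (Y p) =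
    sharp \<alpha> p (\<lambda>q. \<sigma> q (X q) (Y q)) - \<sigma> p (cv \<alpha> X p) (Y p) - \<sigma> p (X p) (cv \<alpha> Y p))"
proof (rule form2_construct)
  note S = sharp_vfield[OF \<alpha>]
  fix X Y assume X: "X \<in> vfields A" and Y: "Y \<in> vfields A"
  show "(\<lambda>p. sharp \<alpha> p (\<lambda>q. \<sigma> q (X q) (Y q)) - \<sigma> p (cv \<alpha> X p) (Y p) - \<sigma> p (X p) (cv \<alpha> Y p)) \<in> cinf A"
    by (intro cinf_diff vfield_cinf[OF S] form2_cinf[OF \<sigma>] cv_vfield \<alpha> X Y)
  fix p
  have "(\<lambda>q. \<sigma> q (X q) (Y q)) = (\<lambda>q. - \<sigma> q (Y q) (X q))"
    by (rule ext, rule form2_antisym[OF \<sigma>])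
  then have "sharp \<alpha> p (\<lambda>q. \<sigma> q (X q) (Y q)) = - sharp \<alpha> p (\<lambda>q. \<sigma> q (Y q) (X q))"
    using tangent_minus[OF vfield_tangent[OF S] form2_cinf[OF \<sigma> Y X]] by simp
  then show "sharp \<alpha> p (\<lambda>q. \<sigma> q (X q) (Y q)) - \<sigma> p (cv \<alpha> X p) (Y p) - \<sigma> p (X p) (cv \<alpha> Y p) =
    - (sharp \<alpha> p (\<lambda>q. \<sigma> q (Y q) (X q)) - \<sigma> p (cv \<alpha> Y p) (X p) - \<sigma> p (Y p) (cv \<alpha> X p))"
    using form2_antisym[OF \<sigma>, of p "cv \<alpha> X p" "Y p"] form2_antisym[OF \<sigma>, of p "X p" "cv \<alpha> Y p"]
    by linarith
next
  note S = sharp_vfield[OF \<alpha>]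
  fix X p assume X: "X \<in> vfields A"
  show "tensorial (vfields A) p (\<lambda>Y. sharp \<alpha> p (\<lambda>q. \<sigma> q (X q) (Y q)) - \<sigma> p (cv \<alpha> X p) (Y p) - \<sigma> p (X p) (cv \<alpha> Y p))"
  proof (rule tensorialI)
    fix Y Z assume Y: "Y \<in> vfields A" and Z: "Z \<in> vfields A"
    show "sharp \<alpha> p (\<lambda>q. \<sigma> q (X q) ((Y + Z) q)) - \<sigma> p (cv \<alpha> X p) ((Y + Z) p) - \<sigma> p (X p) (cv \<alpha> (Y + Z) p) =
      sharp \<alpha> p (\<lambda>q. \<sigma> q (X q) (Y q)) - \<sigma> p (cv \<alpha> X p) (Y p) - \<sigma> p (X p) (cv \<alpha> Y p) +
      (sharp \<alpha> p (\<lambda>q. \<sigma> q (X q) (Z q)) - \<sigma> p (cv \<alpha> X p) (Z p) - \<sigma> p (X p) (cv \<alpha> Z p))"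
      unfolding form2_vadd[OF \<sigma> Y Z] cv_add[OF \<alpha> Y Z] form2_vadd[OF \<sigma> cv_vfield[OF \<alpha> Y] cv_vfield[OF \<alpha> Z]]
        tangent_add[OF vfield_tangent[OF S] form2_cinf[OF \<sigma> X Y] form2_cinf[OF \<sigma> X Z]]
      by simp
  next
    fix f Y assume f: "f \<in> cinf A" and Y: "Y \<in> vfields A"
    show "sharp \<alpha> p (\<lambda>q. \<sigma> q (X q) (fscale f Y q)) - \<sigma> p (cv \<alpha> X p) (fscale f Y p) - \<sigma> p (X p) (cv \<alpha> (fscale f Y) p) =
      f p * (sharp \<alpha> p (\<lambda>q. \<sigma> q (X q) (Y q)) - \<sigma> p (cv \<alpha> X p) (Y p) - \<sigma> p (X p) (cv \<alpha> Y p))"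
      unfolding cv_scale[OF f \<alpha> Y]
        form2_vadd[OF \<sigma> vfields_scale[OF f cv_vfield[OF \<alpha> Y]] vfields_scale[OF sharp_cinf[OF \<alpha> f] Y]]
        form2_vscale[OF \<sigma> cv_vfield[OF \<alpha> Y]] form2_vscale[OF \<sigma> Y]
        tangent_mult[OF vfield_tangent[OF S] f form2_cinf[OF \<sigma> X Y]]
      by (simp add: algebra_simps)
  qed
qed

lemma cf_form2: "\<alpha> \<in> forms1 A \<Longrightarrow> \<sigma> \<in> forms2 A \<Longrightarrow> cf \<alpha> \<sigma> \<in> forms2 A"
  unfolding conn_form2_def by (rule theI'[OF cf_unique, THEN conjunct1])

lemma cf_apply:
  assumes "\<alpha> \<in> forms1 A" "\<sigma> \<in> forms2 A" "X \<in> vfields A" "Y \<in> vfields A"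
  shows "cf \<alpha> \<sigma> p (X p) (Y p) =
    sharp \<alpha> p (\<lambda>q. \<sigma> q (X q) (Y q)) - \<sigma> p (cv \<alpha> X p) (Y p) - \<sigma> p (X p) (cv \<alpha> Y p)"
  unfolding conn_form2_def
  by (rule theI'[OF cf_unique[OF assms(1,2)], THEN conjunct2, rule_format, OF assms(3,4)])

lemma cf_add:
  assumes \<alpha>: "\<alpha> \<in> forms1 A" and \<sigma>: "\<sigma> \<in> forms2 A" and \<tau>: "\<tau> \<in> forms2 A"
  shows "cf \<alpha> (\<sigma> + \<tau>) = cf \<alpha> \<sigma> + cf \<alpha> \<tau>"
proof (rule forms2_eqI)
  fix X Y p assume X: "X \<in> vfields A" and Y: "Y \<in> vfields A"
  show "cf \<alpha> (\<sigma> + \<tau>) p (X p) (Y p) = (cf \<alpha> \<sigma> + cf \<alpha> \<tau>) p (X p) (Y p)"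
    by (simp add: cf_apply[OF \<alpha> _ X Y] forms2_add \<sigma> \<tau>
        tangent_add[OF vfield_tangent[OF sharp_vfield[OF \<alpha>]] form2_cinf[OF \<sigma> X Y] form2_cinf[OF \<tau> X Y]])
qed (intro cf_form2 forms2_add assms)+

lemma cf_scale:
  assumes f: "f \<in> cinf A" and \<alpha>: "\<alpha> \<in> forms1 A" and \<sigma>: "\<sigma> \<in> forms2 A"
  shows "cf \<alpha> (scale2 f \<sigma>) = scale2 f (cf \<alpha> \<sigma>) + scale2 (\<lambda>p. sharp \<alpha> p f) \<sigma>"
proof (rule forms2_eqI)
  fix X Y p assume X: "X \<in> vfields A" and Y: "Y \<in> vfields A"
  show "cf \<alpha> (scale2 f \<sigma>) p (X p) (Y p) = (scale2 f (cf \<alpha> \<sigma>) + scale2 (\<lambda>p. sharp \<alpha> p f) \<sigma>) p (X p) (Y p)"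
    using tangent_mult[OF vfield_tangent[OF sharp_vfield[OF \<alpha>]] f form2_cinf[OF \<sigma> X Y]]
    by (simp add: cf_apply[OF \<alpha> _ X Y] forms2_scale f \<sigma>)
      (simp add: scale2_def cf_apply[OF \<alpha> \<sigma> X Y] algebra_simps)
qed (intro cf_form2 forms2_add forms2_scale sharp_cinf assms)+

lemma cf_add_form:
  assumes \<alpha>: "\<alpha> \<in> forms1 A" and \<beta>: "\<beta> \<in> forms1 A" and \<sigma>: "\<sigma> \<in> forms2 A"
  shows "cf (\<alpha> + \<beta>) \<sigma> = cf \<alpha> \<sigma> + cf \<beta> \<sigma>"
proof (rule forms2_eqI)
  fix X Y p assume X: "X \<in> vfields A" and Y: "Y \<in> vfields A"
  note t = vfield_tangent[OF cv_vfield]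
  show "cf (\<alpha> + \<beta>) \<sigma> p (X p) (Y p) = (cf \<alpha> \<sigma> + cf \<beta> \<sigma>) p (X p) (Y p)"
    by (simp add: cf_apply[OF _ \<sigma> X Y] forms1_add \<alpha> \<beta> sharp_add[OF \<alpha> \<beta>] cv_add_form[OF \<alpha> \<beta>] X Y
        form2_add[OF \<sigma> t[OF \<alpha> X] t[OF \<beta> X]] form2_add[OF \<sigma> t[OF \<alpha> Y] t[OF \<beta> Y]])
qed (intro cf_form2 forms2_add forms1_add assms)+

lemma cf_scale_form:
  assumes f: "f \<in> cinf A" and \<alpha>: "\<alpha> \<in> forms1 A" and \<sigma>: "\<sigma> \<in> forms2 A"
  shows "cf (scale1 f \<alpha>) \<sigma> = scale2 f (cf \<alpha> \<sigma>)"
proof (rule forms2_eqI)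
  fix X Y p assume X: "X \<in> vfields A" and Y: "Y \<in> vfields A"
  note t = vfield_tangent[OF cv_vfield]
  show "cf (scale1 f \<alpha>) \<sigma> p (X p) (Y p) = scale2 f (cf \<alpha> \<sigma>) p (X p) (Y p)"
    by (simp add: cf_apply[OF _ \<sigma> X Y] forms1_scale f \<alpha> sharp_scale[OF \<alpha>] cv_scale_form[OF f \<alpha>] X Y fscale_apply
        form2_cmult[OF \<sigma> t[OF \<alpha> X]] form2_cmult[OF \<sigma> t[OF \<alpha> Y]])
      (simp add: scale2_def cf_apply[OF \<alpha> \<sigma> X Y] algebra_simps)
qed (intro cf_form2 forms2_scale forms1_scale assms)+

lemma cf_wedge:
  assumes \<alpha>: "\<alpha> \<in> forms1 A" and \<beta>: "\<beta> \<in> forms1 A" and \<gamma>: "\<gamma> \<in> forms1 A"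
  shows "cf \<alpha> (wedge \<beta> \<gamma>) = wedge (D \<alpha> \<beta>) \<gamma> + wedge \<beta> (D \<alpha> \<gamma>)"
proof (rule forms2_eqI)
  fix X Y p assume X: "X \<in> vfields A" and Y: "Y \<in> vfields A"
  note S = vfield_tangent[OF sharp_vfield[OF \<alpha>]]
  have "sharp \<alpha> p (\<lambda>q. \<beta> q (X q) * \<gamma> q (Y q) - \<beta> q (Y q) * \<gamma> q (X q)) =
      (D \<alpha> \<beta> p (X p) + \<beta> p (cv \<alpha> X p)) * \<gamma> p (Y p) + \<beta> p (X p) * (D \<alpha> \<gamma> p (Y p) + \<gamma> p (cv \<alpha> Y p))
      - ((D \<alpha> \<beta> p (Y p) + \<beta> p (cv \<alpha> Y p)) * \<gamma> p (X p) + \<beta> p (Y p) * (D \<alpha> \<gamma> p (X p) + \<gamma> p (cv \<alpha> X p)))"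
    unfolding tangent_diff[OF S cinf_mult[OF form1_cinf[OF \<beta> X] form1_cinf[OF \<gamma> Y]]
        cinf_mult[OF form1_cinf[OF \<beta> Y] form1_cinf[OF \<gamma> X]]]
      tangent_mult[OF S form1_cinf[OF \<beta> X] form1_cinf[OF \<gamma> Y]]
      tangent_mult[OF S form1_cinf[OF \<beta> Y] form1_cinf[OF \<gamma> X]]
      cv_pairing[OF \<alpha> \<beta> X] cv_pairing[OF \<alpha> \<beta> Y] cv_pairing[OF \<alpha> \<gamma> X] cv_pairing[OF \<alpha> \<gamma> Y]
    by (rule refl)
  then show "cf \<alpha> (wedge \<beta> \<gamma>) p (X p) (Y p) = (wedge (D \<alpha> \<beta>) \<gamma> + wedge \<beta> (D \<alpha> \<gamma>)) p (X p) (Y p)"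
    unfolding cf_apply[OF \<alpha> wedge_form2[OF \<beta> \<gamma>] X Y] plus_fun_apply
    unfolding wedge_def by (simp add: algebra_simps)
qed (intro cf_form2 forms2_add wedge_form2 D_form1 assms)+

lemma cf_zero:
  assumes \<alpha>: "\<alpha> \<in> forms1 A"
  shows "cf \<alpha> 0 = 0"
  using cf_add[OF \<alpha> forms2_zero forms2_zero] by simp


section \<open>Construction of the bracket and its Leibniz rules\<close>

text \<open>The tangent vector \<open>t\<close> with \<open>\<alpha>(t) = (D\<^sub>\<alpha> \<beta>)(v)\<close> for all \<open>\<alpha>\<close>.\<close>
definition adjoint_vec :: "'a form1 \<Rightarrow> 'a \<Rightarrow> 'a tvec \<Rightarrow> 'a tvec" where
  "adjoint_vec \<beta> p v = (\<lambda>f. if f \<in> cinf A then D (d0 A f) \<beta> p v else 0)"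

lemma adjoint_vec_tangent:
  assumes \<beta>: "\<beta> \<in> forms1 A"
  shows "adjoint_vec \<beta> p v \<in> tangent_space A p"
proof (rule tangentI)
  note d = d0_form1
  fix f assume f: "f \<in> cinf A"
  show "adjoint_vec \<beta> p v (\<lambda>x. c * f x) = c * adjoint_vec \<beta> p v f" for c
    by (simp add: adjoint_vec_def f cinf_mult d0_cmult[OF f] D_scale(1)[OF cinf_const d[OF f] \<beta>])
      (simp add: scale1_def)
  fix g assume g: "g \<in> cinf A"
  show "adjoint_vec \<beta> p v (\<lambda>x. f x + g x) = adjoint_vec \<beta> p v f + adjoint_vec \<beta> p v g"
    by (simp add: adjoint_vec_def f g cinf_add d0_add[OF f g] D_add(1)[OF d[OF f] d[OF g] \<beta>])
  show "adjoint_vec \<beta> p v (\<lambda>x. f x * g x) = adjoint_vec \<beta> p v f * g p + f p * adjoint_vec \<beta> p v g"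
    by (simp add: adjoint_vec_def f g cinf_mult d0_mult[OF f g]
        D_add(1)[OF forms1_scale[OF f d[OF g]] forms1_scale[OF g d[OF f]] \<beta>]
        D_scale(1)[OF f d[OF g] \<beta>] D_scale(1)[OF g d[OF f] \<beta>])
      (simp add: scale1_def)
qed (simp add: adjoint_vec_def)

lemma adjoint_vec_vfield:
  assumes \<beta>: "\<beta> \<in> forms1 A" and X: "X \<in> vfields A"
  shows "(\<lambda>p. adjoint_vec \<beta> p (X p)) \<in> vfields A"
proof (rule vfieldsI)
  fix f assume f: "f \<in> cinf A"
  show "(\<lambda>p. adjoint_vec \<beta> p (X p) f) \<in> cinf A"
    using form1_cinf[OF D_form1[OF d0_form1[OF f] \<beta>] X] f by (simp add: adjoint_vec_def)
qed (rule adjoint_vec_tangent[OF \<beta>])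

lemma adjoint_vec_add:
  assumes \<beta>: "\<beta> \<in> forms1 A" and uv: "u \<in> tangent_space A p" "v \<in> tangent_space A p"
  shows "adjoint_vec \<beta> p (u + v) = adjoint_vec \<beta> p u + adjoint_vec \<beta> p v"
  by (rule ext) (simp add: adjoint_vec_def form1_add[OF D_form1[OF d0_form1 \<beta>] uv])

lemma adjoint_vec_cmult:
  assumes \<beta>: "\<beta> \<in> forms1 A" and v: "v \<in> tangent_space A p"
  shows "adjoint_vec \<beta> p (\<lambda>f. c * v f) = (\<lambda>f. c * adjoint_vec \<beta> p v f)"
  by (rule ext) (simp add: adjoint_vec_def form1_cmult[OF D_form1[OF d0_form1 \<beta>] v])

lemma adjoint_vec_outside:
  assumes \<beta>: "\<beta> \<in> forms1 A" and v: "v \<notin> tangent_space A p"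
  shows "adjoint_vec \<beta> p v = (\<lambda>f. 0)"
  by (rule ext) (simp add: adjoint_vec_def form1_outside[OF D_form1[OF d0_form1 \<beta>] v])

lemma adjoint_vec_add_form:
  assumes "\<alpha> \<in> forms1 A" "\<beta> \<in> forms1 A"
  shows "adjoint_vec (\<alpha> + \<beta>) p v = adjoint_vec \<alpha> p v + adjoint_vec \<beta> p v"
  by (rule ext) (simp add: adjoint_vec_def D_add(2)[OF assms d0_form1])

text \<open>The second term comes from the Leibniz rule: D_dg(f \<alpha>) contains {g, f} \<alpha>,
  and {g, f} as a function of g is minus the Hamiltonian field of f.\<close>

lemma adjoint_vec_scale_form:
  assumes f: "f \<in> cinf A" and \<alpha>: "\<alpha> \<in> forms1 A"
  shows "adjoint_vec (scale1 f \<alpha>) p v = (\<lambda>g. f p * adjoint_vec \<alpha> p v g) + (\<lambda>g. - \<alpha> p v * sharp (d0 A f) p g)"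
proof
  fix g
  show "adjoint_vec (scale1 f \<alpha>) p v g = ((\<lambda>g. f p * adjoint_vec \<alpha> p v g) + (\<lambda>g. - \<alpha> p v * sharp (d0 A f) p g)) g"
  proof (cases "g \<in> cinf A")
    case True
    have "D (d0 A g) (scale1 f \<alpha>) p v = f p * D (d0 A g) \<alpha> p v + pb g f p * \<alpha> p v"
      unfolding D_scale(2)[OF f d0_form1[OF True] \<alpha>] sharp_d0[OF f] by (simp add: scale1_def)
    then show ?thesis
      using pb_antisym[of g f p] True by (simp add: adjoint_vec_def sharp_d0)
  qed (simp add: adjoint_vec_def anchor_def)
qed

lemma adjoint_vec_pairing:
  assumes \<alpha>: "\<alpha> \<in> forms1 A" and \<beta>: "\<beta> \<in> forms1 A"
  shows "\<alpha> p (adjoint_vec \<beta> p v) = D \<alpha> \<beta> p v"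
proof -
  let ?\<Phi> = "\<lambda>\<alpha>. \<alpha> p (adjoint_vec \<beta> p v) - D \<alpha> \<beta> p v"
  have "?\<Phi> \<alpha> = 0"
  proof (rule tensorial_forms1_zeroI[OF tensorialI \<alpha>])
    fix \<alpha> \<gamma> assume "\<alpha> \<in> forms1 A" "\<gamma> \<in> forms1 A"
    then show "?\<Phi> (\<alpha> + \<gamma>) = ?\<Phi> \<alpha> + ?\<Phi> \<gamma>"
      by (simp add: D_add(1)[OF _ _ \<beta>])
  next
    fix f \<alpha> assume "f \<in> cinf A" "\<alpha> \<in> forms1 A"
    then show "?\<Phi> (fscale f \<alpha>) = f p * ?\<Phi> \<alpha>"
      unfolding scale1_eq_fscale[symmetric] by (simp add: D_scale(1)[OF _ _ \<beta>]) (simp add: scale1_def algebra_simps)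
  next
    fix f assume "f \<in> cinf A"
    then show "?\<Phi> (d0 A f) = 0"
      by (simp add: d0_tangent adjoint_vec_tangent[OF \<beta>]) (simp add: adjoint_vec_def)
  qed
  then show ?thesis by simp
qed

text \<open>The endomorphism \<open>adjoint_vec \<beta> p\<close> of the tangent space, extended to
  2-forms as a derivation, with the sign of the dual action.\<close>

definition contract :: "'a form2 \<Rightarrow> 'a form1 \<Rightarrow> 'a form2" where
  "contract \<sigma> \<beta> p v w = - \<sigma> p (adjoint_vec \<beta> p v) w - \<sigma> p v (adjoint_vec \<beta> p w)"

lemma contract_form2:
  assumes \<sigma>: "\<sigma> \<in> forms2 A" and \<beta>: "\<beta> \<in> forms1 A"
  shows "contract \<sigma> \<beta> \<in> forms2 A"
proof (rule forms2I)
  note t = adjoint_vec_tangent[OF \<beta>]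
  have z: "\<sigma> p v (\<lambda>f. 0) = 0" for p v
    using form2_cmult(2)[OF \<sigma> tangent_space_zero, of p v 0] by (simp add: zero_fun_def)
  show "lin_on (tangent_space A p) (contract \<sigma> \<beta> p v)" for p v
    by (rule lin_onI)
      (simp_all add: contract_def form2_add[OF \<sigma>] form2_cmult[OF \<sigma>] form2_outside[OF \<sigma>] t z
        adjoint_vec_add[OF \<beta>] adjoint_vec_cmult[OF \<beta>] adjoint_vec_outside[OF \<beta>] algebra_simps)
  show "contract \<sigma> \<beta> p v w = - contract \<sigma> \<beta> p w v" for p v w
    using form2_antisym[OF \<sigma>, of p "adjoint_vec \<beta> p v" w] form2_antisym[OF \<sigma>, of p v "adjoint_vec \<beta> p w"]
    unfolding contract_def by linarith
next
  fix X Y assume X: "X \<in> vfields A" and Y: "Y \<in> vfields A"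
  show "(\<lambda>p. contract \<sigma> \<beta> p (X p) (Y p)) \<in> cinf A"
    unfolding contract_def
    by (intro cinf_diff cinf_minus form2_cinf[OF \<sigma> X adjoint_vec_vfield[OF \<beta> Y]] form2_cinf[OF \<sigma> adjoint_vec_vfield[OF \<beta> X] Y])
qed

text \<open>By \<open>adjoint_vec_pairing\<close> the endomorphism behind \<open>contract\<close> is
  the transpose of \<alpha> \<mapsto> D_\<alpha> \<gamma>, so it acts on each factor of the wedge
  product by that map.\<close>

lemma contract_wedge:
  assumes "\<alpha> \<in> forms1 A" "\<beta> \<in> forms1 A" "\<gamma> \<in> forms1 A"
  shows "contract (wedge \<alpha> \<beta>) \<gamma> = wedge \<beta> (D \<alpha> \<gamma>) - wedge \<alpha> (D \<beta> \<gamma>)"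
  by (simp add: fun_eq_iff contract_def wedge_def adjoint_vec_pairing assms algebra_simps)

lemma contract_scale_form:
  assumes \<sigma>: "\<sigma> \<in> forms2 A" and f: "f \<in> cinf A" and \<alpha>: "\<alpha> \<in> forms1 A"
  shows "contract \<sigma> (scale1 f \<alpha>) p v w = f p * contract \<sigma> \<alpha> p v w
    + \<alpha> p v * \<sigma> p (sharp (d0 A f) p) w - \<alpha> p w * \<sigma> p (sharp (d0 A f) p) v"
proof -
  note t = adjoint_vec_tangent[OF \<alpha>, of p] and s = vfield_tangent[OF sharp_vfield[OF d0_form1[OF f]], of p]
  note t' = tangent_space_cmult[OF t] and s' = tangent_space_cmult[OF s]
  show ?thesis
    using form2_antisym[OF \<sigma>, of p "sharp (d0 A f) p" v]
    unfolding contract_def adjoint_vec_scale_form[OF f \<alpha>] form2_add[OF \<sigma> t' s'] form2_cmult[OF \<sigma> t]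
      form2_cmult[OF \<sigma> s]
    by (simp add: algebra_simps)
qed

text \<open>
  The axioms force \<open>{df, \<beta>} = d(D\<^sub>d\<^sub>f \<beta>) - D\<^sub>d\<^sub>f(d\<beta>)\<close>. The same expression with \<open>\<alpha>\<close> for \<open>df\<close> violates
  the Leibniz rule in \<open>\<alpha>\<close>; the defect depends on \<open>d\<alpha>\<close> only and is cancelled by the last term.
\<close>
definition bracket :: "'a form1 \<Rightarrow> 'a form1 \<Rightarrow> 'a form2" where
  "bracket \<alpha> \<beta> = d1 A (D \<alpha> \<beta>) - cf \<alpha> (d1 A \<beta>) + contract (d1 A \<alpha>) \<beta>"

lemma bracket_form2: "\<alpha> \<in> forms1 A \<Longrightarrow> \<beta> \<in> forms1 A \<Longrightarrow> bracket \<alpha> \<beta> \<in> forms2 A"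
  unfolding bracket_def by (intro forms2_add forms2_diff d1_form2 D_form1 cf_form2 contract_form2)

lemma bracket_add_left:
  assumes \<alpha>: "\<alpha> \<in> forms1 A" and \<beta>: "\<beta> \<in> forms1 A" and \<gamma>: "\<gamma> \<in> forms1 A"
  shows "bracket (\<alpha> + \<beta>) \<gamma> = bracket \<alpha> \<gamma> + bracket \<beta> \<gamma>"
  unfolding bracket_def D_add(1)[OF \<alpha> \<beta> \<gamma>] d1_add[OF D_form1[OF \<alpha> \<gamma>] D_form1[OF \<beta> \<gamma>]] d1_add[OF \<alpha> \<beta>]
    cf_add_form[OF \<alpha> \<beta> d1_form2[OF \<gamma>]]
  by (simp add: fun_eq_iff contract_def)

lemma bracket_add_right:
  assumes \<alpha>: "\<alpha> \<in> forms1 A" and \<beta>: "\<beta> \<in> forms1 A" and \<gamma>: "\<gamma> \<in> forms1 A"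
  shows "bracket \<gamma> (\<alpha> + \<beta>) = bracket \<gamma> \<alpha> + bracket \<gamma> \<beta>"
  unfolding bracket_def D_add(2)[OF \<alpha> \<beta> \<gamma>] d1_add[OF D_form1[OF \<gamma> \<alpha>] D_form1[OF \<gamma> \<beta>]] d1_add[OF \<alpha> \<beta>]
    cf_add[OF \<gamma> d1_form2[OF \<alpha>] d1_form2[OF \<beta>]]
  by (simp add: fun_eq_iff contract_def adjoint_vec_add_form[OF \<alpha> \<beta>]
      form2_add[OF d1_form2[OF \<gamma>] adjoint_vec_tangent[OF \<alpha>] adjoint_vec_tangent[OF \<beta>]])

text \<open>Writing ^ for the wedge product: the first term of \<open>bracket\<close> leaves the
  defect df ^ D_\<alpha> \<beta>, and contracting the summand df ^ \<alpha> of d(f \<alpha>) gives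
  \<alpha> ^ D_df \<beta> minus exactly this defect.\<close>

lemma bracket_scale_left:
  assumes f: "f \<in> cinf A" and \<alpha>: "\<alpha> \<in> forms1 A" and \<beta>: "\<beta> \<in> forms1 A"
  shows "bracket (scale1 f \<alpha>) \<beta> = scale2 f (bracket \<alpha> \<beta>) + wedge \<alpha> (D (d0 A f) \<beta>)"
proof -
  have "contract (scale2 f (d1 A \<alpha>) + wedge (d0 A f) \<alpha>) \<beta> =
      scale2 f (contract (d1 A \<alpha>) \<beta>) + contract (wedge (d0 A f) \<alpha>) \<beta>"
    by (simp add: fun_eq_iff contract_def scale2_def algebra_simps)
  then show ?thesis
    unfolding bracket_def D_scale(1)[OF f \<alpha> \<beta>] d1_scale[OF f D_form1[OF \<alpha> \<beta>]] d1_scale[OF f \<alpha>]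
      cf_scale_form[OF f \<alpha> d1_form2[OF \<beta>]] contract_wedge[OF d0_form1[OF f] \<alpha> \<beta>]
    by (simp add: fun_eq_iff scale2_def algebra_simps)
qed

text \<open>Cartan's formula for the Lie derivative of \<beta> along the Hamiltonian field of f.
  That Lie derivative is [df, \<beta>] because d(df) = 0; vanishing torsion turns it into the two
  connection terms, and \<beta>(#df) = - (#\<beta>)(f) accounts for the last one.\<close>

lemma d1_hamiltonian:
  assumes f: "f \<in> cinf A" and \<beta>: "\<beta> \<in> forms1 A"
  shows "d1 A \<beta> p (sharp (d0 A f) p) w =
    D (d0 A f) \<beta> p w - D \<beta> (d0 A f) p w + d0 A (\<lambda>q. sharp \<beta> q f) p w"
proof (cases "w \<in> tangent_space A p")
  case True
  then obtain X where X: "X \<in> vfields A" "X p = w" by (rule vfield_extension)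
  note df = d0_form1[OF f]
  note S = sharp_vfield[OF df]
  have "(\<lambda>q. \<beta> q (sharp (d0 A f) q)) = (\<lambda>q. - sharp \<beta> q f)"
    unfolding sharp_pairing[OF df \<beta>] sharp_apply[OF f] by (rule ext, rule \<pi>_antisym)
  then have "X p (\<lambda>q. \<beta> q (sharp (d0 A f) q)) = - X p (\<lambda>q. sharp \<beta> q f)"
    using tangent_minus[OF vfield_tangent[OF X(1)] sharp_cinf[OF \<beta> f]] by simp
  then have "d1 A \<beta> p (sharp (d0 A f) p) (X p) = kosz (d0 A f) \<beta> p (X p) + X p (\<lambda>q. sharp \<beta> q f)"
    unfolding d1_apply[OF \<beta> S X(1)] kosz_apply[OF df \<beta> X(1)] d1_d0[OF f] by simp
  then show ?thesis
    unfolding D_torsion[OF df \<beta>] X(2) d0_tangent[OF True] .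
next
  case False
  note df = d0_form1[OF f]
  show ?thesis
    using form1_outside[OF D_form1[OF df \<beta>] False] form1_outside[OF D_form1[OF \<beta> df] False]
      form2_outside[OF d1_form2[OF \<beta>] False] False
    by (simp add: d0_def)
qed

text \<open>Computed directly, since \<open>bracket_sym\<close> rests on it. The unwanted terms
  contain D_\<beta> df and the differential of (#\<beta>)(f). Both cancel against the contribution
  of \<open>contract\<close>, which is \<alpha> wedge the contraction of d\<beta> with #df;
  \<open>d1_hamiltonian\<close> evaluates this contraction by vanishing torsion.\<close>

lemma bracket_scale_right:
  assumes f: "f \<in> cinf A" and \<alpha>: "\<alpha> \<in> forms1 A" and \<beta>: "\<beta> \<in> forms1 A"
  shows "bracket \<beta> (scale1 f \<alpha>) = scale2 f (bracket \<beta> \<alpha>) + wedge \<alpha> (D (d0 A f) \<beta>)"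
proof (intro ext)
  fix p v w
  let ?h = "\<lambda>q. sharp \<beta> q f"
  note df = d0_form1[OF f] and h = sharp_cinf[OF \<beta> f]
  show "bracket \<beta> (scale1 f \<alpha>) p v w = (scale2 f (bracket \<beta> \<alpha>) + wedge \<alpha> (D (d0 A f) \<beta>)) p v w"
    unfolding bracket_def D_scale(2)[OF f \<beta> \<alpha>]
      d1_add[OF forms1_scale[OF f D_form1[OF \<beta> \<alpha>]] forms1_scale[OF h \<alpha>]]
      d1_scale[OF f D_form1[OF \<beta> \<alpha>]] d1_scale[OF h \<alpha>] d1_scale[OF f \<alpha>]
      cf_add[OF \<beta> forms2_scale[OF f d1_form2[OF \<alpha>]] wedge_form2[OF df \<alpha>]]
      cf_scale[OF f \<beta> d1_form2[OF \<alpha>]] cf_wedge[OF \<beta> df \<alpha>]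
    by (simp add: contract_scale_form[OF d1_form2[OF \<beta>] f \<alpha>] d1_hamiltonian[OF f \<beta>])
      (simp add: wedge_def scale2_def algebra_simps)
qed

lemma contract_zero: "contract 0 \<beta> = 0"
  by (simp add: fun_eq_iff contract_def)

lemma bracket_d0:
  assumes f: "f \<in> cinf A" and \<beta>: "\<beta> \<in> forms1 A"
  shows "d1 A (D (d0 A f) \<beta>) = bracket (d0 A f) \<beta> + cf (d0 A f) (d1 A \<beta>)"
  unfolding bracket_def d1_d0[OF f] contract_zero by simp

text \<open>The two Leibniz rules add the same wedge term, so the difference is tensorial and exact
  forms suffice. For those, the two sides differ by d(D_df dg - D_dg df), and without torsion the
  argument of d is the closed form d{f, g}.\<close>

lemma bracket_sym:
  assumes \<alpha>: "\<alpha> \<in> forms1 A" and \<beta>: "\<beta> \<in> forms1 A"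
  shows "bracket \<alpha> \<beta> = bracket \<beta> \<alpha>"
proof (intro ext)
  fix p v w
  define \<Psi> where "\<Psi> \<alpha> \<beta> = bracket \<alpha> \<beta> p v w - bracket \<beta> \<alpha> p v w" for \<alpha> \<beta>
  have "\<Psi> \<alpha> \<beta> = 0"
  proof (rule tensorial2_zeroI[OF _ _ _ \<alpha> \<beta>])
    fix \<alpha> assume \<alpha>: "\<alpha> \<in> forms1 A"
    show "tensorial (forms1 A) p (\<Psi> \<alpha>)"
    proof (rule tensorialI)
      fix \<beta> \<gamma> assume \<beta>: "\<beta> \<in> forms1 A" and \<gamma>: "\<gamma> \<in> forms1 A"
      show "\<Psi> \<alpha> (\<beta> + \<gamma>) = \<Psi> \<alpha> \<beta> + \<Psi> \<alpha> \<gamma>"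
        unfolding \<Psi>_def bracket_add_left[OF \<beta> \<gamma> \<alpha>] bracket_add_right[OF \<beta> \<gamma> \<alpha>] by simp
    next
      fix f \<beta> assume f: "f \<in> cinf A" and \<beta>: "\<beta> \<in> forms1 A"
      show "\<Psi> \<alpha> (fscale f \<beta>) = f p * \<Psi> \<alpha> \<beta>"
        unfolding \<Psi>_def scale1_eq_fscale[symmetric] bracket_scale_left[OF f \<beta> \<alpha>] bracket_scale_right[OF f \<beta> \<alpha>]
        by (simp add: scale2_def algebra_simps)
    qed
  next
    fix f g assume f: "f \<in> cinf A" and g: "g \<in> cinf A"
    note df = d0_form1[OF f] and dg = d0_form1[OF g]
    have "D (d0 A f) (d0 A g) = D (d0 A g) (d0 A f) + d0 A (pb f g)"
    proof (intro ext)
      fix p v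
      show "D (d0 A f) (d0 A g) p v = (D (d0 A g) (d0 A f) + d0 A (pb f g)) p v"
        using D_torsion[OF df dg, of p v] unfolding kosz_d0[OF f g] by simp
    qed
    then have "d1 A (D (d0 A f) (d0 A g)) = d1 A (D (d0 A g) (d0 A f))"
      using d1_add[OF D_form1[OF dg df] d0_form1[OF pb_cinf[OF f g]]] d1_d0[OF pb_cinf[OF f g]] by simp
    then show "\<Psi> (d0 A f) (d0 A g) = 0"
      unfolding bracket_d0[OF f dg] bracket_d0[OF g df] d1_d0[OF f] d1_d0[OF g] cf_zero[OF df] cf_zero[OF dg] \<Psi>_def
      by simp
  qed (simp add: \<Psi>_def)
  then show "bracket \<alpha> \<beta> p v w = bracket \<beta> \<alpha> p v w" by (simp add: \<Psi>_def)
qed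

lemma bracket_scale_const:
  assumes "\<alpha> \<in> forms1 A" "\<beta> \<in> forms1 A"
  shows "bracket (scale1 (\<lambda>_. c) \<alpha>) \<beta> = scale2 (\<lambda>_. c) (bracket \<alpha> \<beta>)"
proof -
  have "D 0 \<beta> = 0" using D_add(1)[OF forms1_zero forms1_zero assms(2)] by simp
  then show ?thesis
    unfolding bracket_scale_left[OF cinf_const assms] d0_const by (simp add: fun_eq_iff wedge_def)
qed

lemma bracket_is_form1_bracket: "is_form1_bracket A \<pi> D bracket"
  unfolding is_form1_bracket_def fun_form1_bracket_def fun_form2_bracket_def
proof (intro conjI ballI allI)
  fix \<alpha> \<beta> assume \<alpha>: "\<alpha> \<in> forms1 A" and \<beta>: "\<beta> \<in> forms1 A"
  show "bracket \<alpha> \<beta> \<in> forms2 A" by (rule bracket_form2[OF \<alpha> \<beta>])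
  show "bracket \<alpha> \<beta> = bracket \<beta> \<alpha>" by (rule bracket_sym[OF \<alpha> \<beta>])
  show "bracket (scale1 (\<lambda>_. c) \<alpha>) \<beta> = scale2 (\<lambda>_. c) (bracket \<alpha> \<beta>)" for c
    by (rule bracket_scale_const[OF \<alpha> \<beta>])
  show "bracket \<alpha> (scale1 (\<lambda>_. c) \<beta>) = scale2 (\<lambda>_. c) (bracket \<alpha> \<beta>)" for c
    unfolding bracket_sym[OF \<alpha> forms1_scale[OF cinf_const \<beta>]] bracket_scale_const[OF \<beta> \<alpha>] bracket_sym[OF \<beta> \<alpha>]
    by (rule refl)
  show "bracket (scale1 f \<alpha>) \<beta> = scale2 f (bracket \<alpha> \<beta>) + wedge \<alpha> (D (d0 A f) \<beta>)" if "f \<in> cinf A" for f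
    by (rule bracket_scale_left[OF that \<alpha> \<beta>])
  fix \<gamma> assume \<gamma>: "\<gamma> \<in> forms1 A"
  show "bracket (\<alpha> + \<beta>) \<gamma> = bracket \<alpha> \<gamma> + bracket \<beta> \<gamma>" by (rule bracket_add_left[OF \<alpha> \<beta> \<gamma>])
  show "bracket \<gamma> (\<alpha> + \<beta>) = bracket \<gamma> \<alpha> + bracket \<gamma> \<beta>" by (rule bracket_add_right[OF \<alpha> \<beta> \<gamma>])
next
  fix f \<beta> assume "f \<in> cinf A" "\<beta> \<in> forms1 A"
  then show "d1 A (D (d0 A f) \<beta>) = bracket (d0 A f) \<beta> + cf (d0 A f) (d1 A \<beta>)" by (rule bracket_d0)
qed


section \<open>The obstruction tensor\<close>

abbreviation "br \<equiv> form1_bracket A \<pi> D"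

text \<open>\<open>bracket\<close> shows that the axioms can be satisfied; from here on the chosen
  \<open>br\<close> is used through its axioms alone.\<close>

lemma br_is_form1_bracket: "is_form1_bracket A \<pi> D br"
  unfolding form1_bracket_def by (rule someI[of "is_form1_bracket A \<pi> D", OF bracket_is_form1_bracket])

lemmas br_axioms = br_is_form1_bracket[unfolded is_form1_bracket_def fun_form1_bracket_def fun_form2_bracket_def]

lemmas br_form2 = br_axioms[THEN conjunct1, rule_format]
  and br_sym = br_axioms[THEN conjunct2, THEN conjunct1, rule_format]
  and br_add_left = br_axioms[THEN conjunct2, THEN conjunct2, THEN conjunct1, rule_format, THEN conjunct1]
  and br_add_right = br_axioms[THEN conjunct2, THEN conjunct2, THEN conjunct1, rule_format, THEN conjunct2]
  and br_scale = br_axioms[THEN conjunct2, THEN conjunct2, THEN conjunct2, THEN conjunct2, THEN conjunct1, rule_format]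
  and br_d0 = br_axioms[THEN conjunct2, THEN conjunct2, THEN conjunct2, THEN conjunct2, THEN conjunct2, rule_format]

definition obstruction :: "('a \<Rightarrow> real) \<Rightarrow> 'a form1 \<Rightarrow> 'a form1 \<Rightarrow> 'a form2" where
  "obstruction f \<beta> \<gamma> = cf (d0 A f) (br \<beta> \<gamma>) - br (D (d0 A f) \<beta>) \<gamma> - br (D (d0 A f) \<gamma>) \<beta>"

lemma obstruction_form2:
  assumes "f \<in> cinf A" "\<beta> \<in> forms1 A" "\<gamma> \<in> forms1 A"
  shows "obstruction f \<beta> \<gamma> \<in> forms2 A"
  unfolding obstruction_def by (intro forms2_diff cf_form2 br_form2 D_form1 d0_form1 assms)

lemma obstruction_sym:
  assumes "\<beta> \<in> forms1 A" "\<gamma> \<in> forms1 A"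
  shows "obstruction f \<beta> \<gamma> = obstruction f \<gamma> \<beta>"
  unfolding obstruction_def br_sym[OF assms] by simp

text \<open>The terms that do not scale with \<open>g\<close> add up to the curvature of \<open>D\<close> at \<open>df\<close>, \<open>dg\<close>.\<close>
lemma obstruction_tensorial:
  assumes f: "f \<in> cinf A" and \<gamma>: "\<gamma> \<in> forms1 A"
  shows "tensorial (forms1 A) p (\<lambda>\<beta>. obstruction f \<beta> \<gamma> p v w)"
proof (rule tensorialI)
  note df = d0_form1[OF f]
  fix \<alpha> \<beta> assume \<alpha>: "\<alpha> \<in> forms1 A" and \<beta>: "\<beta> \<in> forms1 A"
  show "obstruction f (\<alpha> + \<beta>) \<gamma> p v w = obstruction f \<alpha> \<gamma> p v w + obstruction f \<beta> \<gamma> p v w"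
    unfolding obstruction_def br_add_left[OF \<alpha> \<beta> \<gamma>] cf_add[OF df br_form2[OF \<alpha> \<gamma>] br_form2[OF \<beta> \<gamma>]]
      D_add(2)[OF \<alpha> \<beta> df] br_add_left[OF D_form1[OF df \<alpha>] D_form1[OF df \<beta>] \<gamma>]
      br_add_right[OF \<alpha> \<beta> D_form1[OF df \<gamma>]]
    by simp
next
  note df = d0_form1[OF f]
  fix g \<beta> assume g: "g \<in> cinf A" and \<beta>: "\<beta> \<in> forms1 A"
  note dg = d0_form1[OF g] and fg = pb_cinf[OF f g]
  have sh: "(\<lambda>p. sharp (d0 A f) p g) = pb f g" by (rule ext) (rule sharp_d0[OF g])
  \<comment> \<open>The terms with {f, g} {\<beta>, \<gamma>} and with D_df \<beta> wedge D_dg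
    \<gamma> occur in \<open>1\<close> and in \<open>2\<close> and cancel. What remains besides the
    multiples of \<open>g\<close> is \<beta> wedge the expression D_df D_dg \<gamma> - D_dg D_df
    \<gamma> - D_d{f,g} \<gamma>.\<close>
  have 1: "cf (d0 A f) (br (scale1 g \<beta>) \<gamma>) =
      scale2 g (cf (d0 A f) (br \<beta> \<gamma>)) + scale2 (pb f g) (br \<beta> \<gamma>)
      + (wedge (D (d0 A f) \<beta>) (D (d0 A g) \<gamma>) + wedge \<beta> (D (d0 A f) (D (d0 A g) \<gamma>)))"
    unfolding br_scale[OF g \<beta> \<gamma>]
      cf_add[OF df forms2_scale[OF g br_form2[OF \<beta> \<gamma>]] wedge_form2[OF \<beta> D_form1[OF dg \<gamma>]]]
      cf_scale[OF g df br_form2[OF \<beta> \<gamma>]] cf_wedge[OF df \<beta> D_form1[OF dg \<gamma>]] sh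
    by (rule refl)
  have 2: "br (D (d0 A f) (scale1 g \<beta>)) \<gamma> =
      scale2 g (br (D (d0 A f) \<beta>) \<gamma>) + wedge (D (d0 A f) \<beta>) (D (d0 A g) \<gamma>)
      + (scale2 (pb f g) (br \<beta> \<gamma>) + wedge \<beta> (D (d0 A (pb f g)) \<gamma>))"
    unfolding D_scale(2)[OF g df \<beta>] sh
      br_add_left[OF forms1_scale[OF g D_form1[OF df \<beta>]] forms1_scale[OF fg \<beta>] \<gamma>]
      br_scale[OF g D_form1[OF df \<beta>] \<gamma>] br_scale[OF fg \<beta> \<gamma>]
    by (rule refl)
  have 3: "br (D (d0 A f) \<gamma>) (scale1 g \<beta>) =
      scale2 g (br (D (d0 A f) \<gamma>) \<beta>) + wedge \<beta> (D (d0 A g) (D (d0 A f) \<gamma>))"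
    unfolding br_sym[OF D_form1[OF df \<gamma>] forms1_scale[OF g \<beta>]] br_scale[OF g \<beta> D_form1[OF df \<gamma>]]
      br_sym[OF \<beta> D_form1[OF df \<gamma>]]
    by (rule refl)
  have 4: "D (d0 A f) (D (d0 A g) \<gamma>) p v = D (d0 A g) (D (d0 A f) \<gamma>) p v + D (d0 A (pb f g)) \<gamma> p v" for v
    using D_flat[OF df dg \<gamma>, of p v] unfolding kosz_d0[OF f g] by linarith
  show "obstruction f (fscale g \<beta>) \<gamma> p v w = g p * obstruction f \<beta> \<gamma> p v w"
    unfolding scale1_eq_fscale[symmetric] obstruction_def 1 2 3
    by (simp add: scale2_def wedge_def 4 algebra_simps)
qed

text \<open>As {dg, dh} = d{g, dh}, the first term of the obstruction is d{f, {g, dh}} - {df, {g,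
  dh}}. Exchanging f and g changes d{f, {g, dh}} by {d{f, g}, dh} according to flatness, and {{f,
  dg}, dh} by the same amount according to vanishing torsion. The other two terms are exchanged by
  symmetry of the bracket.\<close>

lemma obstruction_exact:
  assumes f: "f \<in> cinf A" and g: "g \<in> cinf A" and h: "h \<in> cinf A"
  shows "obstruction f (d0 A g) (d0 A h) = obstruction g (d0 A f) (d0 A h)"
proof -
  note df = d0_form1[OF f] and dg = d0_form1[OF g] and dh = d0_form1[OF h]
  note fg = d0_form1[OF pb_cinf[OF f g]]
  have exact: "br (d0 A u) (d0 A h) = d1 A (D (d0 A u) (d0 A h))" if u: "u \<in> cinf A" for u
    using br_d0[OF u dh] unfolding d1_d0[OF h] cf_zero[OF d0_form1[OF u]] by simp
  have expand: "obstruction u (d0 A w) (d0 A h) =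
      d1 A (D (d0 A u) (D (d0 A w) (d0 A h))) - br (d0 A u) (D (d0 A w) (d0 A h))
      - br (D (d0 A u) (d0 A w)) (d0 A h) - br (D (d0 A u) (d0 A h)) (d0 A w)"
    if u: "u \<in> cinf A" and w: "w \<in> cinf A" for u w
    unfolding obstruction_def exact[OF w] br_d0[OF u D_form1[OF d0_form1[OF w] dh]] by simp
  have "D (d0 A f) (D (d0 A g) (d0 A h)) = D (d0 A g) (D (d0 A f) (d0 A h)) + D (d0 A (pb f g)) (d0 A h)"
  proof (intro ext)
    fix p v
    show "D (d0 A f) (D (d0 A g) (d0 A h)) p v =
        (D (d0 A g) (D (d0 A f) (d0 A h)) + D (d0 A (pb f g)) (d0 A h)) p v"
      using D_flat[OF df dg dh, of p v] unfolding kosz_d0[OF f g] plus_fun_apply by linarith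
  qed
  then have 1: "d1 A (D (d0 A f) (D (d0 A g) (d0 A h))) =
      d1 A (D (d0 A g) (D (d0 A f) (d0 A h))) + br (d0 A (pb f g)) (d0 A h)"
    using d1_add[OF D_form1[OF dg D_form1[OF df dh]] D_form1[OF fg dh]] exact[OF pb_cinf[OF f g]] by simp
  have "D (d0 A f) (d0 A g) = D (d0 A g) (d0 A f) + d0 A (pb f g)"
  proof (intro ext)
    fix p v
    show "D (d0 A f) (d0 A g) p v = (D (d0 A g) (d0 A f) + d0 A (pb f g)) p v"
      using D_torsion[OF df dg, of p v] unfolding kosz_d0[OF f g] plus_fun_apply by linarith
  qed
  then have 2: "br (D (d0 A f) (d0 A g)) (d0 A h) =
      br (D (d0 A g) (d0 A f)) (d0 A h) + br (d0 A (pb f g)) (d0 A h)"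
    using br_add_left[OF D_form1[OF dg df] fg dh] by simp
  show ?thesis
    unfolding expand[OF f g] expand[OF g f] 1 2
      br_sym[OF D_form1[OF df dh] dg] br_sym[OF D_form1[OF dg dh] df]
    by simp
qed

section \<open>From pointwise dependence to a tensor field\<close>

definition potential :: "'a \<Rightarrow> 'a covec \<Rightarrow> 'a \<Rightarrow> real" where
  "potential p a = (SOME f. f \<in> cinf A \<and> d0 A f p = a)"

lemma potential:
  assumes "a \<in> cotangent_space A p"
  shows "potential p a \<in> cinf A" "d0 A (potential p a) p = a"
proof -
  have "\<exists>f. f \<in> cinf A \<and> d0 A f p = a" by (rule covector_exact[OF assms]) blast
  from someI_ex[OF this] show "potential p a \<in> cinf A" "d0 A (potential p a) p = a"
    unfolding potential_def by blast+
qed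

text \<open>The choice of potentials does not matter by \<open>obstruction_cong\<close>. The value 0
  away from covectors is forced by \<open>lin_on\<close>.\<close>

definition obstruction_tensor :: "'a tensor32" where
  "obstruction_tensor p a b c v w =
     (if a \<in> cotangent_space A p \<and> b \<in> cotangent_space A p \<and> c \<in> cotangent_space A p
      then obstruction (potential p a) (d0 A (potential p b)) (d0 A (potential p c)) p v w else 0)"

lemma obstruction_cong:
  assumes fgh: "f \<in> cinf A" "f' \<in> cinf A" "d0 A f p = d0 A f' p"
    and \<beta>: "\<beta> \<in> forms1 A" "\<beta>' \<in> forms1 A" "\<beta> p = \<beta>' p"
    and \<gamma>: "\<gamma> \<in> forms1 A" "\<gamma>' \<in> forms1 A" "\<gamma> p = \<gamma>' p"
  shows "obstruction f \<beta> \<gamma> p v w = obstruction f' \<beta>' \<gamma>' p v w"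
proof -
  have left: "obstruction u \<beta>\<^sub>1 \<delta> p v w = obstruction u \<beta>\<^sub>2 \<delta> p v w"
    if "u \<in> cinf A" "\<delta> \<in> forms1 A" "\<beta>\<^sub>1 \<in> forms1 A" "\<beta>\<^sub>2 \<in> forms1 A" "\<beta>\<^sub>1 p = \<beta>\<^sub>2 p" for u \<beta>\<^sub>1 \<beta>\<^sub>2 \<delta>
    by (rule tensorial_forms1_eqI[OF obstruction_tensorial[OF that(1,2)] that(3-5)])
  have right: "obstruction u \<delta> \<beta>\<^sub>1 p v w = obstruction u \<delta> \<beta>\<^sub>2 p v w"
    if "u \<in> cinf A" "\<delta> \<in> forms1 A" "\<beta>\<^sub>1 \<in> forms1 A" "\<beta>\<^sub>2 \<in> forms1 A" "\<beta>\<^sub>1 p = \<beta>\<^sub>2 p" for u \<beta>\<^sub>1 \<beta>\<^sub>2 \<delta>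
    unfolding obstruction_sym[OF that(2,3)] obstruction_sym[OF that(2,4)] by (rule left[OF that])
  obtain g where g: "g \<in> cinf A" "d0 A g p = \<beta> p" by (rule covector_exact[OF form1_cotangent[OF \<beta>(1)]])
  obtain h where h: "h \<in> cinf A" "d0 A h p = \<gamma> p" by (rule covector_exact[OF form1_cotangent[OF \<gamma>(1)]])
  note df = d0_form1[OF fgh(1)] d0_form1[OF fgh(2)] and dg = d0_form1[OF g(1)] and dh = d0_form1[OF h(1)]
  have "obstruction f \<beta> \<gamma> p v w = obstruction f (d0 A g) \<gamma> p v w"
    by (rule left[OF fgh(1) \<gamma>(1) \<beta>(1) dg g(2)[symmetric]])
  also have "\<dots> = obstruction f (d0 A g) (d0 A h) p v w"
    by (rule right[OF fgh(1) dg \<gamma>(1) dh h(2)[symmetric]])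
  \<comment> \<open>The swap moves \<open>f\<close> into the slot of a 1-form, where tensoriality
    replaces its differential by that of \<open>f'\<close>; a second swap moves \<open>f'\<close>
    back.\<close>
  also have "\<dots> = obstruction g (d0 A f) (d0 A h) p v w"
    unfolding obstruction_exact[OF fgh(1) g(1) h(1)] by (rule refl)
  also have "\<dots> = obstruction g (d0 A f') (d0 A h) p v w"
    by (rule left[OF g(1) dh df fgh(3)])
  also have "\<dots> = obstruction f' (d0 A g) (d0 A h) p v w"
    unfolding obstruction_exact[OF fgh(2) g(1) h(1)] by (rule refl)
  also have "\<dots> = obstruction f' \<beta>' (d0 A h) p v w"
    by (rule left[OF fgh(2) dh dg \<beta>(2) trans[OF g(2) \<beta>(3)]])
  also have "\<dots> = obstruction f' \<beta>' \<gamma>' p v w"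
    by (rule right[OF fgh(2) \<beta>(2) dh \<gamma>(2) trans[OF h(2) \<gamma>(3)]])
  finally show ?thesis .
qed

lemma obstruction_tensor_apply:
  assumes f: "f \<in> cinf A" and \<beta>: "\<beta> \<in> forms1 A" and \<gamma>: "\<gamma> \<in> forms1 A"
  shows "obstruction_tensor p (d0 A f p) (\<beta> p) (\<gamma> p) v w = obstruction f \<beta> \<gamma> p v w"
proof -
  note c = d0_cotangent[OF f, of p] form1_cotangent[OF \<beta>, of p] form1_cotangent[OF \<gamma>, of p]
  show ?thesis
    using c obstruction_cong[OF potential(1)[OF c(1)] f potential(2)[OF c(1)]
        d0_form1[OF potential(1)[OF c(2)]] \<beta> potential(2)[OF c(2)]
        d0_form1[OF potential(1)[OF c(3)]] \<gamma> potential(2)[OF c(3)], of v w]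
    by (simp add: obstruction_tensor_def)
qed

lemma obstruction_tensor_sym:
  "obstruction_tensor p a b c v w = obstruction_tensor p b a c v w"
  "obstruction_tensor p a b c v w = obstruction_tensor p a c b v w"
proof -
  have "obstruction_tensor p a b c v w = obstruction_tensor p b a c v w \<and>
      obstruction_tensor p a b c v w = obstruction_tensor p a c b v w"
  proof (cases "a \<in> cotangent_space A p \<and> b \<in> cotangent_space A p \<and> c \<in> cotangent_space A p")
    case True
    then have p: "potential p a \<in> cinf A" "potential p b \<in> cinf A" "potential p c \<in> cinf A"
      using potential(1) by blast+
    show ?thesis
      using True obstruction_exact[OF p]
        obstruction_sym[OF d0_form1[OF p(2)] d0_form1[OF p(3)], of "potential p a"]
      by (simp add: obstruction_tensor_def)
  qed (auto simp: obstruction_tensor_def)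
  then show "obstruction_tensor p a b c v w = obstruction_tensor p b a c v w"
    "obstruction_tensor p a b c v w = obstruction_tensor p a c b v w"
    by blast+
qed

text \<open>The slot \<open>b\<close> corresponds to the argument in which
  \<open>obstruction_tensorial\<close> applies; the symmetry in \<open>a\<close>, \<open>b\<close>,
  \<open>c\<close> carries linearity to the other two.\<close>

lemma obstruction_tensor_lin_on:
  "lin_on (cotangent_space A p) (\<lambda>b. obstruction_tensor p a b c v w)"
proof (cases "a \<in> cotangent_space A p \<and> c \<in> cotangent_space A p")
  case True
  then have a: "a \<in> cotangent_space A p" and c: "c \<in> cotangent_space A p" by auto
  note pa = potential[OF a] and pc = potential[OF c]
  note tens = obstruction_tensorial[OF pa(1) d0_form1[OF pc(1)], of p v w]
  have eq: "obstruction_tensor p a (\<beta> p) c v w = obstruction (potential p a) \<beta> (d0 A (potential p c)) p v w"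
    if "\<beta> \<in> forms1 A" for \<beta>
    using obstruction_tensor_apply[OF pa(1) that d0_form1[OF pc(1)], of p v w] unfolding pa(2) pc(2) .
  show ?thesis
  proof (rule lin_onI)
    fix b b' assume b: "b \<in> cotangent_space A p" and b': "b' \<in> cotangent_space A p"
    note pb = potential[OF b] and pb' = potential[OF b']
    note db = d0_form1[OF pb(1)] and db' = d0_form1[OF pb'(1)]
    show "obstruction_tensor p a (b + b') c v w = obstruction_tensor p a b c v w + obstruction_tensor p a b' c v w"
      using eq[OF forms1_add[OF db db']] eq[OF db] eq[OF db'] tensorialD(1)[OF tens db db']
      unfolding plus_fun_apply[of "d0 A (potential p b)"] pb(2) pb'(2) by linarith
  next
    fix k b assume b: "b \<in> cotangent_space A p"
    note pb = potential[OF b]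
    note db = d0_form1[OF pb(1)]
    show "obstruction_tensor p a (\<lambda>v. k * b v) c v w = k * obstruction_tensor p a b c v w"
      using eq[OF forms1_scale[OF cinf_const[of k] db]] eq[OF db] tensorialD(2)[OF tens db cinf_const[of k]]
      unfolding scale1_eq_fscale fscale_apply[of _ "d0 A (potential p b)" p] pb(2) by simp
  qed (simp add: obstruction_tensor_def)
qed (auto simp: obstruction_tensor_def lin_on_def)

text \<open>For exact \<open>\<alpha>\<close> the function is a value of the 2-form
  \<open>obstruction\<close>. In general \<open>\<alpha>\<close> is expanded near \<open>p\<close>
  as the sum of \<alpha>(e_i) dx_i, which presents the function locally as a finite sum of smooth
  ones.\<close>

lemma obstruction_tensor_cinf:
  assumes \<alpha>: "\<alpha> \<in> forms1 A" and \<beta>: "\<beta> \<in> forms1 A" and \<gamma>: "\<gamma> \<in> forms1 A"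
    and X: "X \<in> vfields A" and Y: "Y \<in> vfields A"
  shows "(\<lambda>p. obstruction_tensor p (\<alpha> p) (\<beta> p) (\<gamma> p) (X p) (Y p)) \<in> cinf A"
proof (rule cinf_local)
  fix p
  obtain I :: "(real ^ 'n) set" and W \<eta> x e where fr: "finite I" "open W" "p \<in> W" "\<eta> \<in> cinf A"
    "\<And>q. q \<in> W \<Longrightarrow> \<eta> q = 1" "\<And>i. i \<in> I \<Longrightarrow> x i \<in> cinf A" "\<And>i. i \<in> I \<Longrightarrow> e i \<in> vfields A"
    "\<And>q v f. v \<in> tangent_space A q \<Longrightarrow> f \<in> cinf A \<Longrightarrow> \<eta> q * v f = (\<Sum>i\<in>I. v (x i) * e i q f)"
    by (rule frame[of p]) (rule that)
  let ?f = "\<lambda>q. \<Sum>i\<in>I. \<alpha> q (e i q) * obstruction (x i) \<beta> \<gamma> q (X q) (Y q)"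
  have "?f \<in> cinf A"
    by (intro cinf_sum cinf_mult form1_cinf[OF \<alpha> fr(7)] form2_cinf[OF obstruction_form2[OF fr(6) \<beta> \<gamma>] X Y])
  then have smooth: "smooth_in W ?f" by (rule smooth_in_cinf)
  have eq: "?f q = obstruction_tensor q (\<alpha> q) (\<beta> q) (\<gamma> q) (X q) (Y q)" if q: "q \<in> W" for q
  proof -
    let ?L = "\<lambda>a. obstruction_tensor q a (\<beta> q) (\<gamma> q) (X q) (Y q)"
    have L: "lin_on (cotangent_space A q) ?L"
      using obstruction_tensor_lin_on[of q "\<beta> q"] obstruction_tensor_sym(1)[of q _ "\<beta> q"] by simp
    have dx: "d0 A (x i) q \<in> cotangent_space A q" if "i \<in> I" for i
      by (rule d0_cotangent[OF fr(6)[OF that]])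
    \<comment> \<open>The induction also carries membership in the cotangent space, because
      \<open>?L\<close> is additive on covectors only.\<close>
    have "?L (\<Sum>i\<in>J. (\<lambda>v. \<alpha> q (e i q) * d0 A (x i) q v)) = (\<Sum>i\<in>J. \<alpha> q (e i q) * ?L (d0 A (x i) q))
        \<and> (\<Sum>i\<in>J. (\<lambda>v. \<alpha> q (e i q) * d0 A (x i) q v)) \<in> cotangent_space A q" if "J \<subseteq> I" for J
      using finite_subset[OF that fr(1)] that
    proof (induction J rule: finite_induct)
      case empty
      have "(0 :: 'a covec) \<in> cotangent_space A q"
        by (simp add: cotangent_space_def zero_fun_def lin_on_zero)
      then show ?case
        using lin_on_cmult[OF L, of 0 0] by (simp add: zero_fun_def)
    next
      case (insert i J)
      then have i: "i \<in> I" by simp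
      show ?case
        unfolding sum.insert[OF insert(1,2)]
        using insert lin_on_add[OF L cotangent_space_cmult[OF dx[OF i]]] lin_on_cmult[OF L dx[OF i]]
          cotangent_space_add[OF cotangent_space_cmult[OF dx[OF i]]]
        by (simp del: plus_fun_apply)
    qed
    then have "?L (\<Sum>i\<in>I. (\<lambda>v. \<alpha> q (e i q) * d0 A (x i) q v)) = (\<Sum>i\<in>I. \<alpha> q (e i q) * ?L (d0 A (x i) q))"
      by blast
    also have "(\<Sum>i\<in>I. (\<lambda>v. \<alpha> q (e i q) * d0 A (x i) q v)) = \<alpha> q"
    proof
      fix v
      have "1 * \<alpha> q v = (\<Sum>i\<in>I. \<alpha> q (e i q) * d0 A (x i) q v)"
        using form1_frame[OF fr(7,8) form1_cotangent[OF \<alpha>, of q], where v = v] unfolding fr(5)[OF q] .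
      then show "(\<Sum>i\<in>I. (\<lambda>v. \<alpha> q (e i q) * d0 A (x i) q v)) v = \<alpha> q v"
        unfolding sum_fun_apply by simp
    qed
    finally show ?thesis
      using obstruction_tensor_apply[OF fr(6) \<beta> \<gamma>, of _ q] by simp
  qed
  show "\<exists>W. open W \<and> p \<in> W \<and> smooth_in W (\<lambda>q. obstruction_tensor q (\<alpha> q) (\<beta> q) (\<gamma> q) (X q) (Y q))"
    by (intro exI[of _ W] conjI fr(2,3) smooth_in_cong[OF fr(2) eq smooth])
qed

lemma obstruction_tensor_form2:
  "lin_on (tangent_space A p) (obstruction_tensor p a b c v)"
  "lin_on (tangent_space A p) (\<lambda>v. obstruction_tensor p a b c v w)"
  "obstruction_tensor p a b c v w = - obstruction_tensor p a b c w v"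
proof -
  have "lin_on (tangent_space A p) (obstruction_tensor p a b c v) \<and>
    lin_on (tangent_space A p) (\<lambda>v. obstruction_tensor p a b c v w) \<and>
    obstruction_tensor p a b c v w = - obstruction_tensor p a b c w v"
  proof (cases "a \<in> cotangent_space A p \<and> b \<in> cotangent_space A p \<and> c \<in> cotangent_space A p")
    case True
    let ?N = "obstruction (potential p a) (d0 A (potential p b)) (d0 A (potential p c))"
    have N: "?N \<in> forms2 A"
      using True by (intro obstruction_form2 d0_form1 potential(1)) auto
    have "obstruction_tensor p a b c v w = ?N p v w" for v w
      using True by (simp add: obstruction_tensor_def)
    then have "obstruction_tensor p a b c = ?N p" by (intro ext)
    then show ?thesis
      using form2_lin_on[OF N] form2_antisym[OF N, of p v w] by simp
  next
    case False
    then have "obstruction_tensor p a b c = (\<lambda>v w. 0)"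
      by (intro ext) (auto simp: obstruction_tensor_def)
    then show ?thesis by (simp add: lin_on_zero)
  qed
  then show "lin_on (tangent_space A p) (obstruction_tensor p a b c v)"
    "lin_on (tangent_space A p) (\<lambda>v. obstruction_tensor p a b c v w)"
    "obstruction_tensor p a b c v w = - obstruction_tensor p a b c w v"
    by blast+
qed

lemma obstruction_tensor_tensors32: "obstruction_tensor \<in> tensors32 A"
  unfolding tensors32_def mem_Collect_eq
proof (intro conjI allI ballI)
  fix p a b c v w
  show "lin_on (cotangent_space A p) (\<lambda>b. obstruction_tensor p a b c v w)"
    by (rule obstruction_tensor_lin_on)
  show "lin_on (cotangent_space A p) (\<lambda>a. obstruction_tensor p a b c v w)"
    using obstruction_tensor_lin_on[of p b c v w] by (subst obstruction_tensor_sym(1))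
  show "lin_on (cotangent_space A p) (\<lambda>c. obstruction_tensor p a b c v w)"
    using obstruction_tensor_lin_on[of p a b v w] by (subst obstruction_tensor_sym(2))
  show "lin_on (tangent_space A p) (\<lambda>v. obstruction_tensor p a b c v w)"
    "lin_on (tangent_space A p) (\<lambda>w. obstruction_tensor p a b c v w)"
    by (rule obstruction_tensor_form2)+
qed (rule obstruction_tensor_cinf)

text \<open>Covectors at \<open>p\<close> are differentials there, and as soon as one of the first
  three arguments is not a covector both tensors vanish by \<open>lin_on\<close>. So triples of
  exact forms determine the tensor everywhere.\<close>

lemma tensors32_eqI:
  assumes M: "M \<in> tensors32 A" and N: "N \<in> tensors32 A"
    and eq: "\<And>f g h p. f \<in> cinf A \<Longrightarrow> g \<in> cinf A \<Longrightarrow> h \<in> cinf A \<Longrightarrow>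
      M p (d0 A f p) (d0 A g p) (d0 A h p) = N p (d0 A f p) (d0 A g p) (d0 A h p)"
  shows "M = N"
proof (intro ext)
  fix p a b c v w
  have zero: "K p a b c v w = 0" if "K \<in> tensors32 A"
    "\<not> (a \<in> cotangent_space A p \<and> b \<in> cotangent_space A p \<and> c \<in> cotangent_space A p)" for K
  proof -
    note K = that(1)[unfolded tensors32_def mem_Collect_eq]
    note l = K[THEN conjunct1, rule_format, THEN lin_on_outside]
      K[THEN conjunct2, THEN conjunct1, rule_format, THEN lin_on_outside]
      K[THEN conjunct2, THEN conjunct2, THEN conjunct1, rule_format, THEN lin_on_outside]
    show ?thesis using that(2) l[of _ p] by auto
  qed
  show "M p a b c v w = N p a b c v w"
  proof (cases "a \<in> cotangent_space A p \<and> b \<in> cotangent_space A p \<and> c \<in> cotangent_space A p")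
    case True
    then obtain f g h where "f \<in> cinf A" "d0 A f p = a" "g \<in> cinf A" "d0 A g p = b" "h \<in> cinf A" "d0 A h p = c"
      using potential by blast
    then show ?thesis using eq[of f g h p] by simp
  qed (simp add: zero M N)
qed

text \<open>Uniqueness needs the defining identity on exact \<beta> and \<gamma> only, through
  \<open>tensors32_eqI\<close>.\<close>

lemma obstruction_tensor_unique:
  "\<exists>!M. M \<in> tensors32 A \<and> contra_symmetric M \<and> co_antisymmetric M \<and>
    (\<forall>f\<in>cinf A. \<forall>\<beta>\<in>forms1 A. \<forall>\<gamma>\<in>forms1 A. tensor_apply M (d0 A f) \<beta> \<gamma> = obstruction f \<beta> \<gamma>)"
proof (rule ex1I[of _ obstruction_tensor])
  show "obstruction_tensor \<in> tensors32 A \<and> contra_symmetric obstruction_tensor \<and>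
    co_antisymmetric obstruction_tensor \<and> (\<forall>f\<in>cinf A. \<forall>\<beta>\<in>forms1 A. \<forall>\<gamma>\<in>forms1 A.
      tensor_apply obstruction_tensor (d0 A f) \<beta> \<gamma> = obstruction f \<beta> \<gamma>)"
    unfolding contra_symmetric_def co_antisymmetric_def tensor_apply_def
    by (intro conjI allI ballI ext obstruction_tensor_tensors32 obstruction_tensor_sym
        obstruction_tensor_form2(3) obstruction_tensor_apply)
next
  fix M assume M: "M \<in> tensors32 A \<and> contra_symmetric M \<and> co_antisymmetric M \<and>
    (\<forall>f\<in>cinf A. \<forall>\<beta>\<in>forms1 A. \<forall>\<gamma>\<in>forms1 A. tensor_apply M (d0 A f) \<beta> \<gamma> = obstruction f \<beta> \<gamma>)"
  show "M = obstruction_tensor"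
  proof (rule tensors32_eqI[OF conjunct1[OF M] obstruction_tensor_tensors32])
    fix f g h p assume f: "f \<in> cinf A" and g: "g \<in> cinf A" and h: "h \<in> cinf A"
    have "tensor_apply M (d0 A f) (d0 A g) (d0 A h) = obstruction f (d0 A g) (d0 A h)"
      using M f d0_form1[OF g] d0_form1[OF h] by simp
    then have "M p (d0 A f p) (d0 A g p) (d0 A h p) = obstruction f (d0 A g) (d0 A h) p"
      unfolding tensor_apply_def by (rule fun_cong)
    also have "\<dots> = obstruction_tensor p (d0 A f p) (d0 A g p) (d0 A h p)"
      by (intro ext) (rule obstruction_tensor_apply[OF f d0_form1[OF g] d0_form1[OF h], symmetric])
    finally show "M p (d0 A f p) (d0 A g p) (d0 A h p) = obstruction_tensor p (d0 A f p) (d0 A g p) (d0 A h p)" .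
  qed
qed

end

theorem theorem2p2:
  fixes A :: "('a::{t2_space,second_countable_topology}, 'n::finite) chart set"
    and \<pi> :: "'a bivector"
    and D :: "'a form1 \<Rightarrow> 'a form1 \<Rightarrow> 'a form1"
  assumes "poisson_manifold A \<pi>"
    and "contravariant_connection A \<pi> D"
    and "flat_connection A \<pi> D"
    and "torsion_free A \<pi> D"
  shows "\<exists>!M. M \<in> tensors32 A \<and> contra_symmetric M \<and> co_antisymmetric M \<and>
    (\<forall>f\<in>cinf A. \<forall>\<beta>\<in>forms1 A. \<forall>\<gamma>\<in>forms1 A.
       tensor_apply M (d0 A f) \<beta> \<gamma> =
         fun_form2_bracket A \<pi> D f (form1_bracket A \<pi> D \<beta> \<gamma>)
         - form1_bracket A \<pi> D (fun_form1_bracket A D f \<beta>) \<gamma>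
         - form1_bracket A \<pi> D (fun_form1_bracket A D f \<gamma>) \<beta>)"
proof -
  interpret poisson_connection A \<pi> D
    by unfold_locales (rule assms)+
  show ?thesis
    unfolding fun_form1_bracket_def fun_form2_bracket_def obstruction_def[symmetric]
    by (rule obstruction_tensor_unique)
qed

end
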